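(* Let $1\le n\le 3$, let $W$ be the Coxeter group of type $A_n$ with simple generators $S=\{s_1,\dots,s_n\}$, longest element $w_\circ$ and $N=\ell(w_\circ)$. Let $c$ be a Coxeter element (a word containing each letter of $S$ exactly once), let $Q=(q_1,\dots,q_r)$ be a word in $S$ such that the subword complex $\mathcal{SC}(Q)$ is spherical, and let $\varphi$ be an embedding of $Q$ into $c^m$. Let $D_\varphi$ be the restriction of the counting matrix $D_{c,m}$ to the columns $\varphi(1),\dots,\varphi(r)$, and let $M_\varphi\in\mathbb R^{(r-N)\times r}$ be a Gale dual matrix of $D_\varphi$. Then the fan $\mathcal F_{Q,M_\varphi}$ is a complete simplicial fan realization of $\mathcal{SC}(Q)$.
   Context: Type $A_n$: $W$ is the symmetric group on $n+1$ letters, $s_i=(i\ \ i+1)$, $w_\circ$ is its longest element, $N=\ell(w_\circ)=n(n+1)/2$. The positive roots are $\Phi^+=\{\alpha_i+\alpha_{i+1}+\dots+\alpha_j:1\le i\le j\le n\}$, where $\alpha_1,\dots,\alpha_n$ are the simple roots. Subword complex: for a word $Q=(q_1,\dots,q_r)$ in $S$, $\mathcal{SC}(Q)$ (short for $\mathcal{SC}(Q,w_\circ)$) is the simplicial complex whose faces are the subsets $I\subset[r]$ such that the subword of $Q$ with positions in $[r]\smallsetminus I$ contains a reduced expression of $w_\circ$ as a subword. It is spherical (homeomorphic to a sphere) whenever $Q$ contains a reduced expression of $w_\circ$ as a subword; only subword complexes of this form are considered. Embedding: $c^m=(p_1,\dots,p_{mn})$ is the concatenation of $m$ copies of the word $c$.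 An embedding of $Q$ into $c^m$ is a strictly increasing map $\varphi:[r]\to[mn]$ with $p_{\varphi(j)}=q_j$ for all $j$. Counting matrix: $D_{c,m}=(d_{\alpha,j})$ is the $N\times mn$ matrix with rows indexed by positive roots $\alpha$ (in any fixed order) and columns by positions $1\le j\le mn$ of $c^m$. For $\alpha\in\Phi^+$ let $S_\alpha\subset S$ be the set of generators whose simple roots appear in the decomposition of $\alpha$ into simple roots, and let $c_\alpha$ be the restriction of $c$ to the letters in $S_\alpha$. Then $d_{\alpha,j}$ is the number of subsets of positions of $c^m$ that contain $j$ and whose corresponding subword is a reduced expression of $c_\alpha$ (i.e. a copy of the word $c_\alpha$ up to commutations). In particular $d_{\alpha,j}=0$ if $p_j\notin S_\alpha$. Gale dual: for a full rank matrix $A$, a matrix $B$ is a Gale dual matrix of $A$ if the rows of $B$ form a basis of $\ker A$. Fan: for $M\in\mathbb R^{(r-N)\times r}$ with columns $M_1,\dots,M_r$, $\mathcal F_{Q,M}$ is the collection of cones $\operatorname{cone}(M_i: i\in I)\subset\mathbb R^{r-N}$, for $I$ ranging over the faces of $\mathcal{SC}(Q)$. It is a complete simplicial fan realization of $\mathcal{SC}(Q)$ if for every face $I$ the vectors $(M_i)_{i\in I}$ are linearly independent, the cones of any two faces $I,J$ intersect exactly in the cone of $I\cap J$, and the union of all cones is $\mathbb R^{r-N}$. *)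

theory Defs
  imports
    "HOL-Combinatorics.Permutations"
    "HOL-Library.Sublist"
    "Jordan_Normal_Form.Matrix_Kernel"
    "Jordan_Normal_Form.DL_Rank"
begin

section \<open>The Coxeter group of type A\<close>

text \<open>The group is the group of permutations of the letters \<open>{1..n + 1}\<close>.  The generator
  \<open>s\<^sub>i\<close> is represented by its index \<open>i \<in> {1..n}\<close>, and words are lists of such indices.\<close>

definition simple_refl :: "nat \<Rightarrow> nat \<Rightarrow> nat" where
  "simple_refl i = Transposition.transpose i (i + 1)"

definition is_word :: "nat \<Rightarrow> nat list \<Rightarrow> bool" where
  "is_word n u \<longleftrightarrow> set u \<subseteq> {1..n}"

definition word_prod :: "nat list \<Rightarrow> nat \<Rightarrow> nat" where
  "word_prod u = foldr (\<circ>) (map simple_refl u) id"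

definition cox_length :: "nat \<Rightarrow> (nat \<Rightarrow> nat) \<Rightarrow> nat" where
  "cox_length n w = (LEAST k. \<exists>u. is_word n u \<and> word_prod u = w \<and> length u = k)"

definition reduced_expression :: "nat \<Rightarrow> nat list \<Rightarrow> (nat \<Rightarrow> nat) \<Rightarrow> bool" where
  "reduced_expression n u w \<longleftrightarrow>
     is_word n u \<and> word_prod u = w \<and> length u = cox_length n w"

text \<open>The maximizer is unique, so the choice made by \<open>ARG_MAX\<close> is immaterial.\<close>

definition longest_element :: "nat \<Rightarrow> nat \<Rightarrow> nat" where
  "longest_element n = (ARG_MAX (cox_length n) w. w permutes {1..n + 1})"

definition coxeter_word :: "nat \<Rightarrow> nat list \<Rightarrow> bool" where
  "coxeter_word n c \<longleftrightarrow> distinct c \<and> set c = {1..n}"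

text \<open>Roots are given by their coordinates in the basis of simple roots.\<close>

definition simple_root :: "nat \<Rightarrow> nat \<Rightarrow> int" where
  "simple_root i = (\<lambda>k. if k = i then 1 else 0)"

definition positive_roots :: "nat \<Rightarrow> (nat \<Rightarrow> int) set" where
  "positive_roots n =
     {(\<lambda>k. \<Sum>l = i..j. simple_root l k) | i j. 1 \<le> i \<and> i \<le> j \<and> j \<le> n}"

definition root_support :: "nat \<Rightarrow> (nat \<Rightarrow> int) \<Rightarrow> nat set" where
  "root_support n \<alpha> = {i \<in> {1..n}. \<alpha> i \<noteq> 0}"

section \<open>Subword complexes\<close>

text \<open>Positions in words are counted from 0, so \<open>[r]\<close> is rendered as \<open>{..<r}\<close>.
  The term \<open>nths Q X\<close> is the subword of \<open>Q\<close> with positions in \<open>X\<close>.\<close>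

definition contains_reduced_expression :: "nat \<Rightarrow> nat list \<Rightarrow> (nat \<Rightarrow> nat) \<Rightarrow> bool" where
  "contains_reduced_expression n Q w \<longleftrightarrow> (\<exists>u. subseq u Q \<and> reduced_expression n u w)"

definition subword_complex :: "nat \<Rightarrow> nat list \<Rightarrow> nat set set" where
  "subword_complex n Q =
     {I. I \<subseteq> {..<length Q} \<and>
         contains_reduced_expression n (nths Q ({..<length Q} - I)) (longest_element n)}"

text \<open>The subword complex is spherical precisely when \<open>Q\<close> itself contains a reduced expression of the
  longest element, that is, when the complex is not void; sphericity is expressed in this form.\<close>

section \<open>The counting matrix\<close>

definition word_power :: "nat list \<Rightarrow> nat \<Rightarrow> nat list" where
  "word_power c m = concat (replicate m c)"

definition word_embedding :: "(nat \<Rightarrow> nat) \<Rightarrow> nat list \<Rightarrow> nat list \<Rightarrow> bool" where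
  "word_embedding \<phi> Q P \<longleftrightarrow>
     strict_mono_on {..<length Q} \<phi> \<and>
     (\<forall>j<length Q. \<phi> j < length P \<and> P ! \<phi> j = Q ! j)"

definition cox_restrict :: "nat \<Rightarrow> nat list \<Rightarrow> (nat \<Rightarrow> int) \<Rightarrow> nat list" where
  "cox_restrict n c \<alpha> = filter (\<lambda>s. s \<in> root_support n \<alpha>) c"

definition counting_entry :: "nat \<Rightarrow> nat list \<Rightarrow> nat \<Rightarrow> (nat \<Rightarrow> int) \<Rightarrow> nat \<Rightarrow> nat" where
  "counting_entry n c m \<alpha> j =
     card {X. X \<subseteq> {..<length (word_power c m)} \<and> j \<in> X \<and>
              reduced_expression n (nths (word_power c m) X) (word_prod (cox_restrict n c \<alpha>))}"

text \<open>The list \<open>rs\<close> enumerates the positive roots and fixes the order of the rows.\<close>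

definition counting_matrix :: "nat \<Rightarrow> (nat \<Rightarrow> int) list \<Rightarrow> nat list \<Rightarrow> nat \<Rightarrow> real mat" where
  "counting_matrix n rs c m =
     mat (length rs) (length (word_power c m)) (\<lambda>(i, j). real (counting_entry n c m (rs ! i) j))"

definition restrict_cols :: "real mat \<Rightarrow> (nat \<Rightarrow> nat) \<Rightarrow> nat \<Rightarrow> real mat" where
  "restrict_cols A \<phi> r = mat (dim_row A) r (\<lambda>(i, j). A $$ (i, \<phi> j))"

section \<open>Gale duality and fans\<close>

definition full_rank :: "real mat \<Rightarrow> bool" where
  "full_rank A \<longleftrightarrow> vec_space.rank (dim_row A) A = min (dim_row A) (dim_col A)"

text \<open>The notion is intended for matrices \<open>A\<close> of full rank.\<close>

definition gale_dual :: "real mat \<Rightarrow> real mat \<Rightarrow> bool" where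
  "gale_dual A B \<longleftrightarrow>
     dim_col B = dim_col A \<and> distinct (rows B) \<and> kernel.basis (dim_col A) A (set (rows B))"

definition cols_indep :: "real mat \<Rightarrow> nat set \<Rightarrow> bool" where
  "cols_indep M I \<longleftrightarrow>
     inj_on (col M) I \<and>
     \<not> module.lin_dep class_ring (module_vec TYPE(real) (dim_row M)) (col M ` I)"

definition cols_cone :: "real mat \<Rightarrow> nat set \<Rightarrow> real vec set" where
  "cols_cone M I =
     {finsum_vec TYPE(real) (dim_row M) (\<lambda>i. a i \<cdot>\<^sub>v col M i) I | a. \<forall>i\<in>I. 0 \<le> a i}"

definition subword_fan :: "nat \<Rightarrow> nat list \<Rightarrow> real mat \<Rightarrow> real vec set set" where
  "subword_fan n Q M = cols_cone M ` subword_complex n Q"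

definition complete_simplicial_fan_realization :: "nat \<Rightarrow> nat list \<Rightarrow> real mat \<Rightarrow> bool" where
  "complete_simplicial_fan_realization n Q M \<longleftrightarrow>
     (\<forall>I\<in>subword_complex n Q. cols_indep M I) \<and>
     (\<forall>I\<in>subword_complex n Q. \<forall>J\<in>subword_complex n Q.
        cols_cone M I \<inter> cols_cone M J = cols_cone M (I \<inter> J)) \<and>
     \<Union>(subword_fan n Q M) = carrier_vec (dim_row M)"

end

theory Submission
  imports Defs
begin

text \<open>Lift a point of the space of the fan to \<open>y \<in> \<real>\<^sup>r\<close>; the lift is unique up to adding elements of the
  row space of \<open>D\<^sub>\<phi>\<close>.  The fan is complete and simplicial as soon as for every \<open>y\<close> there is exactly
  one element \<open>g\<close> of the row space such that \<open>y + g \<ge> 0\<close> vanishes on the positions of a reduced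
  expression of \<open>w\<^sub>\<circ>\<close>.  Uniqueness means: a row combination that is nonnegative on one reduced
  expression and nonpositive on another one is trivial.  On the letters \<open>s\<^sub>1, s\<^sub>2, s\<^sub>3\<close> such a combination is
  given by three polynomials of degree at most 2 in the time of a position, whose quadratic
  coefficients are proportional to \<open>1, -2, 1\<close> and whose linear coefficients sum to 0; comparing their
  roots with the order of the letters in a reduced expression of \<open>w\<^sub>\<circ>\<close> gives the claim.  Existence
  follows from uniqueness and the exchange property by induction on the number of positions.\<close>

section \<open>Bases with the sign and exchange properties\<close>

text \<open>The obstacle is the sign property: an embedding may skip letters, so for a general
  \<open>Q\<close> only the order in which adjacent letters occur in reduced expressions is
  available. The polynomials come from counting. Around a fixed copy of one letter, the admissible
  copies of an adjacent letter form an initial or a final segment, so their number is linear in the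
  index of the copy. For the highest root of type A_3 the letter s_2 gets a product of two such
  linear functions, and s_1 and s_3 each get a sum of one. The times of s_2 are half-integers, so
  that this sum is an exact integral (midpoint rule); this gives the ratio 1, -2, 1 and leaves no
  linear error term. If a_i, b_i are the roots of the quadratics, the relation of the linear
  coefficients reads a_1 + b_1 + a_3 + b_3 = 2 (a_2 + b_2): the centre of the interval of s_2 is the
  mean of the two other centres. The letters s_1 and s_3 commute, and their times need not be
  strictly ordered like their positions, so only comparisons with s_2 are used. The facts about
  reduced words in rank at most 3, exchange included, are settled by evaluation.\<close>

lemma square_system_solvable:
  fixes A :: "'i \<Rightarrow> 'e \<Rightarrow> real"
  assumes fin: "finite I" "finite J" and card: "card I = card J"
    and inj: "\<And>x. \<forall>j\<in>J. (\<Sum>i\<in>I. x i * A i j) = 0 \<Longrightarrow> \<forall>i\<in>I. x i = 0"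
  shows "\<exists>x. \<forall>j\<in>J. (\<Sum>i\<in>I. x i * A i j) = y j"
proof -
  define k where "k = card I"
  obtain f where f: "bij_betw f {0..<k} I"
    using ex_bij_betw_nat_finite[OF fin(1)] k_def by blast
  obtain g where g: "bij_betw g {0..<k} J"
    using ex_bij_betw_nat_finite[OF fin(2)] k_def card by metis
  define B where "B = mat k k (\<lambda>(a, b). A (f b) (g a))"
  have B: "B \<in> carrier_mat k k" by (simp add: B_def)
  define ext where "ext v i = v $ the_inv_into {0..<k} f i" for v :: "real vec" and i
  have ext: "ext v (f b) = v $ b" if "b < k" for v b
    using that f unfolding ext_def by (auto simp: bij_betw_def the_inv_into_f_f)
  have mult: "(B *\<^sub>v v) $ a = (\<Sum>i\<in>I. ext v i * A i (g a))"
    if "v \<in> carrier_vec k" "a < k" for v a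
  proof -
    have "(\<Sum>i\<in>I. ext v i * A i (g a)) = (\<Sum>b = 0..<k. ext v (f b) * A (f b) (g a))"
      by (rule sum.reindex_bij_betw[OF f, symmetric])
    also have "\<dots> = (\<Sum>b = 0..<k. v $ b * A (f b) (g a))"
      by (intro sum.cong) (auto simp: ext)
    also have "\<dots> = (B *\<^sub>v v) $ a"
      using that by (simp add: B_def scalar_prod_def mult.commute)
    finally show ?thesis by simp
  qed
  have "det B \<noteq> 0"
  proof
    assume "det B = 0"
    then obtain v where v: "v \<in> carrier_vec k" "v \<noteq> 0\<^sub>v k" "B *\<^sub>v v = 0\<^sub>v k"
      using det_0_iff_vec_prod_zero_field[OF B] by blast
    have "\<forall>j\<in>J. (\<Sum>i\<in>I. ext v i * A i j) = 0"
    proof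
      fix j assume "j \<in> J"
      then obtain a where "a < k" "j = g a" using g by (auto simp: bij_betw_def)
      then show "(\<Sum>i\<in>I. ext v i * A i j) = 0" using mult[OF v(1)] v(3) by fastforce
    qed
    from inj[OF this] have "\<forall>b<k. v $ b = 0"
      using f ext by (force simp: bij_betw_def)
    then have "v = 0\<^sub>v k" using v(1) by (intro eq_vecI) auto
    then show False using v(2) by simp
  qed
  from det_non_zero_imp_unit[OF B this, of "()"] obtain C
    where C: "C \<in> carrier_mat k k" "B * C = 1\<^sub>m k"
    by (auto simp: Units_def ring_mat_def)
  define v where "v = C *\<^sub>v vec k (\<lambda>a. y (g a))"
  have v: "v \<in> carrier_vec k" using C by (simp add: v_def)
  have "B *\<^sub>v v = vec k (\<lambda>a. y (g a))"
    unfolding v_def using B C by (subst assoc_mult_mat_vec[symmetric]) auto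
  then have *: "(\<Sum>i\<in>I. ext v i * A i (g a)) = y (g a)" if "a < k" for a
    using mult[OF v that] that by simp
  have "\<forall>j\<in>J. (\<Sum>i\<in>I. ext v i * A i j) = y j"
  proof
    fix j assume "j \<in> J"
    then obtain a where "a < k" "j = g a" using g by (auto simp: bij_betw_def)
    then show "(\<Sum>i\<in>I. ext v i * A i j) = y j" using * by simp
  qed
  then show ?thesis by blast
qed

text \<open>Members of \<open>\<B>\<close> stand for the complements of facets. With
  \<open>P = P'\<close>, \<open>sign\<close> makes each of them a basis of the columns; with
  distinct members it keeps different cones apart. \<open>flip\<close> supplies a facet on the other
  side of every wall.\<close>

locale signed_bases =
  fixes L :: "'i set" and E :: "'e set" and D :: "'i \<Rightarrow> 'e \<Rightarrow> real" and \<B> :: "'e set set"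
  assumes finite_L: "finite L" and finite_E: "finite E"
    and basis_subset: "P \<in> \<B> \<Longrightarrow> P \<subseteq> E"
    and card_basis: "P \<in> \<B> \<Longrightarrow> card P = card L"
    and sign: "\<lbrakk>P \<in> \<B>; P' \<in> \<B>; \<forall>j\<in>P. 0 \<le> (\<Sum>i\<in>L. a i * D i j);
      \<forall>j\<in>P'. (\<Sum>i\<in>L. a i * D i j) \<le> 0\<rbrakk> \<Longrightarrow> \<forall>i\<in>L. a i = 0"
    and flip: "\<lbrakk>P \<in> \<B>; i \<in> E; i \<notin> P\<rbrakk> \<Longrightarrow> \<exists>j\<in>P. insert i (P - {j}) \<in> \<B>"
begin

definition rowcomb :: "('i \<Rightarrow> real) \<Rightarrow> 'e \<Rightarrow> real" where
  "rowcomb a j = (\<Sum>i\<in>L. a i * D i j)"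

lemma rowcomb_lin: "rowcomb (\<lambda>i. s * a i + t * b i) j = s * rowcomb a j + t * rowcomb b j"
  by (simp add: rowcomb_def sum_distrib_left sum.distrib algebra_simps)

lemma rowcomb_add: "rowcomb (\<lambda>i. a i + b i) j = rowcomb a j + rowcomb b j"
  using rowcomb_lin[of 1 a 1 b] by simp

lemma rowcomb_diff: "rowcomb (\<lambda>i. a i - b i) j = rowcomb a j - rowcomb b j"
  using rowcomb_lin[of 1 a "-1" b] by simp

lemma rowcomb_zero: "\<forall>i\<in>L. a i = 0 \<Longrightarrow> rowcomb a j = 0"
  by (simp add: rowcomb_def)

lemma basis_sign:
  "\<lbrakk>P \<in> \<B>; P' \<in> \<B>; \<forall>j\<in>P. 0 \<le> rowcomb a j; \<forall>j\<in>P'. rowcomb a j \<le> 0\<rbrakk> \<Longrightarrow> \<forall>i\<in>L. a i = 0"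
  unfolding rowcomb_def by (rule sign)

lemma basis_inj: "\<lbrakk>P \<in> \<B>; \<forall>j\<in>P. rowcomb a j = 0\<rbrakk> \<Longrightarrow> \<forall>i\<in>L. a i = 0"
  by (rule basis_sign[of P P]) simp_all

lemma basis_solve:
  assumes "P \<in> \<B>"
  shows "\<exists>a. \<forall>j\<in>P. rowcomb a j = y j"
  unfolding rowcomb_def
  using square_system_solvable[OF finite_L finite_subset[OF basis_subset[OF assms] finite_E]
      card_basis[OF assms, symmetric] basis_inj[OF assms, unfolded rowcomb_def]] .

text \<open>For the positions \<open>R\<close> of a subword this says that the point with lift
  \<open>y\<close> lies in a cone of the complex of that subword. The induction for existence runs
  over \<open>R\<close>.\<close>

definition solvable :: "'e set \<Rightarrow> ('e \<Rightarrow> real) \<Rightarrow> bool" where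
  "solvable R y \<longleftrightarrow> (\<exists>a P. P \<in> \<B> \<and> P \<subseteq> R \<and> (\<forall>j\<in>P. y j + rowcomb a j = 0) \<and>
     (\<forall>j\<in>R. 0 \<le> y j + rowcomb a j))"

lemma solvable_shift:
  assumes "solvable R (\<lambda>j. y j + rowcomb a j)"
  shows "solvable R y"
proof -
  from assms obtain b P where "P \<in> \<B>" "P \<subseteq> R" "\<forall>j\<in>P. y j + rowcomb a j + rowcomb b j = 0"
    "\<forall>j\<in>R. 0 \<le> y j + rowcomb a j + rowcomb b j"
    by (auto simp: solvable_def)
  then show ?thesis unfolding solvable_def
    by (intro exI[of _ "\<lambda>i. a i + b i"] exI[of _ P]) (auto simp: rowcomb_add add.assoc)
qed

text \<open>For a fixed basis the combination that cancels \<open>y\<close> on it is unique and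
  linear in \<open>y\<close>, so along a segment it interpolates between its values
  \<open>a P\<close> and \<open>b P\<close> at the ends. Solvability thus becomes a finite union,
  over the bases in \<open>R\<close>, of closed conditions on \<open>t\<close>.\<close>

lemma closed_solvable_segment:
  assumes "R \<subseteq> E"
  shows "closed {t. solvable R (\<lambda>j. (1 - t) * u j + t * w j)}"
proof -
  have "\<exists>a. \<forall>P\<in>\<B>. \<forall>j\<in>P. rowcomb (a P) j = - y j" for y
    using basis_solve[of _ "\<lambda>j. - y j"] by metis
  then obtain a b where a: "\<And>P j. P \<in> \<B> \<Longrightarrow> j \<in> P \<Longrightarrow> rowcomb (a P) j = - u j"
    and b: "\<And>P j. P \<in> \<B> \<Longrightarrow> j \<in> P \<Longrightarrow> rowcomb (b P) j = - w j"
    by metis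
  have eq: "{t. solvable R (\<lambda>j. (1 - t) * u j + t * w j)} =
    (\<Union>P\<in>{P\<in>\<B>. P \<subseteq> R}. \<Inter>j\<in>R. {t. 0 \<le> (1 - t) * (u j + rowcomb (a P) j) + t * (w j + rowcomb (b P) j)})"
    (is "?l = ?r")
  proof (intro equalityI subsetI)
    fix t assume "t \<in> ?l"
    then obtain c P where P: "P \<in> \<B>" "P \<subseteq> R"
      and c: "\<forall>j\<in>P. (1 - t) * u j + t * w j + rowcomb c j = 0"
        "\<forall>j\<in>R. 0 \<le> (1 - t) * u j + t * w j + rowcomb c j"
      by (auto simp: solvable_def)
    define d where "d i = ((1 - t) * a P i + t * b P i) - c i" for i
    have d: "rowcomb d j = (1 - t) * rowcomb (a P) j + t * rowcomb (b P) j - rowcomb c j" for j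
      unfolding d_def by (simp add: rowcomb_diff rowcomb_lin)
    have "rowcomb d j = 0" if "j \<in> P" for j
      using c(1) a[OF P(1) that] b[OF P(1) that] that unfolding d
      by (simp add: algebra_simps)
    then have "\<forall>i\<in>L. d i = 0" using basis_inj[OF P(1)] by blast
    then have "rowcomb d j = 0" for j by (rule rowcomb_zero)
    then have "rowcomb c j = (1 - t) * rowcomb (a P) j + t * rowcomb (b P) j" for j
      using d by simp
    then have "(1 - t) * (u j + rowcomb (a P) j) + t * (w j + rowcomb (b P) j) =
        (1 - t) * u j + t * w j + rowcomb c j" for j
      by (simp only: distrib_left)
    then have "\<forall>j\<in>R. 0 \<le> (1 - t) * (u j + rowcomb (a P) j) + t * (w j + rowcomb (b P) j)"
      using c(2) by simp
    with P show "t \<in> ?r" by blast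
  next
    fix t assume "t \<in> ?r"
    then obtain P where P: "P \<in> \<B>" "P \<subseteq> R"
      and *: "\<forall>j\<in>R. 0 \<le> (1 - t) * (u j + rowcomb (a P) j) + t * (w j + rowcomb (b P) j)"
      by auto
    have **: "(1 - t) * (u j + rowcomb (a P) j) + t * (w j + rowcomb (b P) j) =
        (1 - t) * u j + t * w j + rowcomb (\<lambda>i. (1 - t) * a P i + t * b P i) j" for j
      unfolding rowcomb_lin by (simp add: algebra_simps)
    have "\<forall>j\<in>P. (1 - t) * (u j + rowcomb (a P) j) + t * (w j + rowcomb (b P) j) = 0"
      using P by (simp add: a b)
    with * P show "t \<in> ?l" unfolding solvable_def mem_Collect_eq ** by blast
  qed
  have "finite {P\<in>\<B>. P \<subseteq> R}"
    using finite_E assms finite_subset[of _ "Pow R"] by (metis (no_types, lifting) PowI finite_Pow_iff finite_subset mem_Collect_eq subsetI)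
  then show ?thesis unfolding eq
    by (intro closed_UN closed_INT ballI closed_Collect_le) (auto intro!: continuous_intros)
qed

text \<open>Cross the wall by exchanging some \<open>j\<close> for \<open>i\<close>, and solve on
  the new basis. A negative value at \<open>j\<close> would make the solution nonnegative on the new
  basis and nonpositive on \<open>P\<close>, against \<open>sign\<close>.\<close>

lemma solvable_flip:
  assumes P: "P \<in> \<B>" "i \<in> E" "i \<notin> P" and y: "\<forall>j\<in>P. y j = 0" "y i < 0"
  shows "solvable (insert i P) y"
proof -
  obtain j where j: "j \<in> P" "insert i (P - {j}) \<in> \<B>" using flip[OF P] by blast
  let ?P' = "insert i (P - {j})"
  obtain a where a: "\<forall>l\<in>?P'. rowcomb a l = - y l" using basis_solve[OF j(2), of "\<lambda>l. - y l"] by blast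
  have "0 \<le> y j + rowcomb a j"
  proof (rule ccontr)
    assume "\<not> ?thesis"
    then have neg: "rowcomb a j < 0" using y j by simp
    have "\<forall>i\<in>L. a i = 0"
    proof (rule basis_sign[OF j(2) P(1)])
      show "\<forall>l\<in>?P'. 0 \<le> rowcomb a l" using a y by simp
      show "\<forall>l\<in>P. rowcomb a l \<le> 0"
      proof
        fix l assume "l \<in> P"
        then show "rowcomb a l \<le> 0" using a y neg by (cases "l = j") auto
      qed
    qed
    with neg show False using rowcomb_zero[of a j] by simp
  qed
  moreover have "\<forall>l\<in>?P'. y l + rowcomb a l = 0" using a by simp
  ultimately have "\<forall>l\<in>insert i P. 0 \<le> y l + rowcomb a l"
    by (metis Diff_iff empty_iff insertCI insertE order_refl)
  then show ?thesis unfolding solvable_def using j \<open>\<forall>l\<in>?P'. y l + rowcomb a l = 0\<close>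
    by (intro exI[of _ a] exI[of _ ?P']) auto
qed

text \<open>Walk from a solvable point towards the given one and stop at the last solvable point.  There
  some coordinate outside the basis is positive, so it stays positive for a while, and solving the
  smaller system of tight coordinates in the direction of the walk allows to go further.\<close>

lemma solvable_superset_basis:
  assumes "R \<subseteq> E" "P \<in> \<B>" "P \<subseteq> R"
  shows "solvable R y"
  using assms
proof (induction "card R" arbitrary: R P y rule: less_induct)
  case (less R P y)
  note P = less.prems(2,3)
  have finR: "finite R" using less.prems(1) finite_E finite_subset by blast
  \<comment> \<open>Adding a row combination does not affect solvability, so the point may be taken
    to vanish on \<open>P\<close>.\<close>
  obtain a0 where a0: "\<forall>j\<in>P. rowcomb a0 j = - y j" using basis_solve[OF P(1), of "\<lambda>j. - y j"] by blast
  define w where "w j = y j + rowcomb a0 j" for j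
  have wP: "\<forall>j\<in>P. w j = 0" using a0 by (simp add: w_def)
  have "solvable R w"
  proof (rule ccontr)
    assume unsolv: "\<not> solvable R w"
    have zero: "rowcomb (\<lambda>_. 0) j = 0" for j by (simp add: rowcomb_zero)
    have "\<exists>i\<in>R. w i < 0"
    proof (rule ccontr)
      assume "\<not> ?thesis"
      then have "solvable R w" unfolding solvable_def using P wP zero
        by (intro exI[of _ "\<lambda>_. 0"] exI[of _ P]) (auto simp: not_less)
      then show False using unsolv by simp
    qed
    then obtain i where i: "i \<in> R" "w i < 0" by blast
    have iP: "i \<notin> P" using i wP by auto
    \<comment> \<open>With only one position besides the basis a single exchange solves the problem,
      so there is a further position \<open>k\<close> to start a walk from.\<close>
    have "R \<noteq> insert i P"
      using solvable_flip[of P i w] P wP i iP less.prems(1) unsolv by auto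
    then obtain k where k: "k \<in> R" "k \<notin> P" "k \<noteq> i" using P i by blast
    \<comment> \<open>The start is solved by the zero combination. Being 1 at \<open>k\<close> and 0
      at \<open>i\<close>, it keeps the segment out of the row space before its end
      \<open>w\<close>.\<close>
    define u :: "'e \<Rightarrow> real" where "u j = (if j = k then 1 else 0)" for j
    define S where "S = {0..1} \<inter> {t. solvable R (\<lambda>j. (1 - t) * u j + t * w j)}"
    have "solvable R u" unfolding solvable_def using P k zero
      by (intro exI[of _ "\<lambda>_. 0"] exI[of _ P]) (auto simp: u_def)
    then have "0 \<in> S" by (simp add: S_def)
    moreover have "compact S" unfolding S_def
      by (intro compact_Int_closed compact_Icc closed_solvable_segment less.prems)
    ultimately obtain T where TS: "T \<in> S" "\<And>t. t \<in> S \<Longrightarrow> t \<le> T"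
      using compact_attains_sup[of S] by blast
    then have T: "0 \<le> T" "T \<le> 1" "solvable R (\<lambda>j. (1 - T) * u j + T * w j)"
      by (auto simp: S_def)
    have "T \<noteq> 1" using T(3) unsolv by auto
    with T have T1: "T < 1" by simp
    obtain a Q where Q: "Q \<in> \<B>" "Q \<subseteq> R"
      and a: "\<forall>j\<in>Q. (1 - T) * u j + T * w j + rowcomb a j = 0"
        "\<forall>j\<in>R. 0 \<le> (1 - T) * u j + T * w j + rowcomb a j"
      using T(3) by (auto simp: solvable_def)
    define h where "h j = (1 - T) * u j + T * w j + rowcomb a j" for j
    define K where "K = {j\<in>R. 0 < h j}"
    \<comment> \<open>If \<open>h\<close> vanished on \<open>R\<close>, its values on
      \<open>P\<close> would make \<open>a\<close> trivial; then the coordinate \<open>i\<close>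
      forces \<open>T = 0\<close>, and there the coordinate \<open>k\<close> equals 1.\<close>
    have "K \<noteq> {}"
    proof
      assume "K = {}"
      then have h0: "\<forall>j\<in>R. h j = 0" using a(2) by (force simp: K_def h_def)
      have "\<forall>j\<in>P. rowcomb a j = 0"
      proof
        fix j assume j: "j \<in> P"
        then have "h j = 0" using h0 P by auto
        moreover have "j \<noteq> k" using j k by auto
        ultimately show "rowcomb a j = 0" using wP j by (simp add: h_def u_def)
      qed
      then have "rowcomb a j = 0" for j using basis_inj[OF P(1)] rowcomb_zero by blast
      then have "T * w i = 0" "(1 - T) + T * w k = 0" using h0 i k by (auto simp: h_def u_def)
      then show False using i by auto
    qed
    then have "card (R - K) < card R"
      using finR by (intro psubset_card_mono) (auto simp: K_def)
    moreover have "Q \<subseteq> R - K" using Q a by (auto simp: K_def h_def)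
    \<comment> \<open>Only the coordinates in \<open>R - K\<close> are tight at \<open>T\<close>.
      They are fewer and still contain the basis \<open>Q\<close>, so the direction
      \<open>w - u\<close> can be solved on them; \<open>b\<close> is the first-order correction of
      \<open>a\<close>.\<close>
    ultimately have "solvable (R - K) (\<lambda>j. w j - u j)"
      using less.hyps less.prems(1) Q by blast
    then obtain b Q' where Q': "Q' \<in> \<B>" "Q' \<subseteq> R - K"
      and b: "\<forall>j\<in>Q'. w j - u j + rowcomb b j = 0" "\<forall>j\<in>R - K. 0 \<le> w j - u j + rowcomb b j"
      by (auto simp: solvable_def)
    define g where "g j = w j - u j + rowcomb b j" for j
    have "\<forall>j\<in>K. eventually (\<lambda>s. 0 < h j + s * g j) (at_right 0)"
    proof
      fix j assume "j \<in> K"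
      then have "0 < h j + 0 * g j" by (simp add: K_def)
      moreover have "((\<lambda>s. h j + s * g j) \<longlongrightarrow> h j + 0 * g j) (at_right 0)"
        by (intro tendsto_intros)
      ultimately show "eventually (\<lambda>s. 0 < h j + s * g j) (at_right 0)"
        by (rule order_tendstoD(1)[rotated])
    qed
    then have "eventually (\<lambda>s. \<forall>j\<in>K. 0 < h j + s * g j) (at_right 0)"
      using finR by (intro eventually_ball_finite) (auto simp: K_def)
    moreover have "eventually (\<lambda>s. s \<in> {0<..<1 - T}) (at_right 0)"
      using T1 by (intro eventually_at_right_real) simp
    ultimately have "eventually (\<lambda>s. (\<forall>j\<in>K. 0 < h j + s * g j) \<and> s \<in> {0<..<1 - T}) (at_right 0)"
      by (rule eventually_conj)
    then obtain s where s: "\<forall>j\<in>K. 0 < h j + s * g j" "0 < s" "s < 1 - T"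
      using eventually_happens'[of "at_right (0::real)"] by force
    \<comment> \<open>A further step \<open>s\<close> adds \<open>s\<close> times the corrected
      direction \<open>g\<close>, which is nonnegative on the tight coordinates and, for the chosen
      \<open>s\<close>, too small to destroy positivity on \<open>K\<close>.\<close>
    have eq: "(1 - (T + s)) * u j + (T + s) * w j + rowcomb (\<lambda>i. 1 * a i + s * b i) j = h j + s * g j" for j
      unfolding rowcomb_lin h_def g_def by (simp add: algebra_simps)
    have h0: "h j = 0" if "j \<in> R" "j \<notin> K" for j using that a(2) by (auto simp: K_def h_def)
    have "solvable R (\<lambda>j. (1 - (T + s)) * u j + (T + s) * w j)"
      unfolding solvable_def
    proof (intro exI conjI ballI)
      show "Q' \<in> \<B>" "Q' \<subseteq> R" using Q' by auto
      fix j
      show "(1 - (T + s)) * u j + (T + s) * w j + rowcomb (\<lambda>i. 1 * a i + s * b i) j = 0" if "j \<in> Q'"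
        unfolding eq using that Q' b(1) h0[of j] by (auto simp: g_def)
      show "0 \<le> (1 - (T + s)) * u j + (T + s) * w j + rowcomb (\<lambda>i. 1 * a i + s * b i) j" if "j \<in> R"
        unfolding eq using that s b(2) h0[of j] by (cases "j \<in> K") (auto simp: g_def less_imp_le)
    qed
    then have "T + s \<in> S" using T s by (simp add: S_def)
    then have "T + s \<le> T" by (rule TS(2))
    then show False using s by simp
  qed
  then have "solvable R (\<lambda>j. y j + rowcomb a0 j)" by (simp add: w_def[abs_def])
  then show ?case by (rule solvable_shift)
qed

lemma solution_unique:
  assumes "P \<in> \<B>" "P' \<in> \<B>" "P \<subseteq> R" "P' \<subseteq> R"
    and "\<forall>j\<in>P. y j + rowcomb a j = 0" "\<forall>j\<in>R. 0 \<le> y j + rowcomb a j"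
    and "\<forall>j\<in>P'. y j + rowcomb b j = 0" "\<forall>j\<in>R. 0 \<le> y j + rowcomb b j"
  shows "rowcomb a j = rowcomb b j"
proof -
  have "\<forall>i\<in>L. a i - b i = 0"
  proof (rule basis_sign[OF assms(2,1)]; unfold rowcomb_diff; intro ballI)
    fix j
    show "0 \<le> rowcomb a j - rowcomb b j" if "j \<in> P'"
      using assms(4,6,7) that by (smt (verit) subsetD)
    show "rowcomb a j - rowcomb b j \<le> 0" if "j \<in> P"
      using assms(3,5,8) that by (smt (verit) subsetD)
  qed
  then have "rowcomb (\<lambda>i. a i - b i) j = 0" by (rule rowcomb_zero)
  then show ?thesis by (simp add: rowcomb_diff)
qed

end

section \<open>Fans of Gale dual matrices\<close>

text \<open>Independence concerns the set of columns, so repeated columns must be excluded as well: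
  they would satisfy the relation with coefficients 1 and -1. Coefficients that vanish off
  \<open>I\<close> can later be summed over all positions.\<close>

lemma cols_indepI:
  assumes I: "finite I"
    and indep: "\<And>x. \<lbrakk>\<forall>j. j \<notin> I \<longrightarrow> x j = 0; \<forall>k<dim_row M. (\<Sum>j\<in>I. x j * col M j $ k) = 0\<rbrakk> \<Longrightarrow> \<forall>j\<in>I. x j = 0"
  shows "cols_indep M I"
proof -
  interpret vec_space "TYPE(real)" "dim_row M" .
  have inj: "inj_on (col M) I"
  proof (rule inj_onI, rule ccontr)
    fix i j assume ij: "i \<in> I" "j \<in> I" "col M i = col M j" "i \<noteq> j"
    define x :: "nat \<Rightarrow> real" where "x l = (if l = i then 1 else if l = j then -1 else 0)" for l
    have "(\<Sum>l\<in>I. x l * col M l $ k) = (\<Sum>l\<in>{i, j}. x l * col M l $ k)" for k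
      using I ij(1,2) by (intro sum.mono_neutral_right) (auto simp: x_def)
    moreover have "(\<Sum>l\<in>{i, j}. x l * col M l $ k) = 0" for k
      using ij(4) by (simp add: x_def ij(3))
    ultimately have "\<forall>k<dim_row M. (\<Sum>l\<in>I. x l * col M l $ k) = 0" by simp
    moreover have "\<forall>l. l \<notin> I \<longrightarrow> x l = 0" using ij(1,2) by (auto simp: x_def)
    ultimately have "x i = 0" using indep ij(1) by blast
    then show False by (simp add: x_def)
  qed
  moreover have "\<not> lin_dep (col M ` I)"
  proof
    assume "lin_dep (col M ` I)"
    then obtain A a v where A: "finite A" "A \<subseteq> col M ` I" "lincomb a A = 0\<^sub>v (dim_row M)" "v \<in> A" "a v \<noteq> 0"
      unfolding lin_dep_def by (auto simp: module_vec_simps)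
    define x where "x j = (if j \<in> I \<and> col M j \<in> A then a (col M j) else 0)" for j
    define J where "J = {j\<in>I. col M j \<in> A}"
    have J: "J \<subseteq> I" "col M ` J = A" using A by (auto simp: J_def)
    have "\<forall>k<dim_row M. (\<Sum>j\<in>I. x j * col M j $ k) = 0"
    proof (intro allI impI)
      fix k assume k: "k < dim_row M"
      have "(\<Sum>j\<in>I. x j * col M j $ k) = (\<Sum>j\<in>J. a (col M j) * col M j $ k)"
        using I by (intro sum.mono_neutral_cong_right) (auto simp: x_def J_def)
      also have "\<dots> = (\<Sum>v\<in>A. a v * v $ k)"
        using sum.reindex[OF inj_on_subset[OF inj J(1)], of "\<lambda>v. a v * v $ k"] J by simp
      also have "\<dots> = lincomb a A $ k"
        using A(2) by (subst lincomb_index[OF k]) auto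
      finally show "(\<Sum>j\<in>I. x j * col M j $ k) = 0" using A(3) k by simp
    qed
    moreover have "\<forall>j. j \<notin> I \<longrightarrow> x j = 0" by (simp add: x_def)
    ultimately have "\<forall>j\<in>I. x j = 0" using indep by blast
    moreover obtain j where "j \<in> I" "v = col M j" using A by blast
    ultimately show False using A by (auto simp: x_def)
  qed
  ultimately show ?thesis by (simp add: cols_indep_def)
qed

lemma full_rankI:
  assumes P: "P \<subseteq> {..<dim_col A}" "card P = dim_row A" and indep: "cols_indep A P"
  shows "full_rank A"
proof -
  interpret vec_space "TYPE(real)" "dim_row A" .
  have A: "A \<in> carrier_mat (dim_row A) (dim_col A)" by simp
  have sub: "col A ` P \<subseteq> set (cols A)" using P(1) by (auto simp: cols_def)
  have "card (col A ` P) = dim_row A"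
    using indep P(2) by (simp add: cols_indep_def card_image)
  moreover have "lin_indpt (col A ` P)" using indep by (simp add: cols_indep_def)
  ultimately have ge: "dim_row A \<le> rank A"
    using rank_ge_card_indpt[OF A sub] by simp
  have "\<exists>S. finite S \<and> maximal S (\<lambda>T. T \<subseteq> set (cols A) \<and> lin_indpt T) \<and> col A ` P \<subseteq> S"
    by (rule maximal_exists_superset[of "set (cols A)"])
      (use sub \<open>lin_indpt (col A ` P)\<close> in simp_all)
  then obtain S where S: "maximal S (\<lambda>T. T \<subseteq> set (cols A) \<and> lin_indpt T)" by (elim exE conjE)
  then have "S \<subseteq> set (cols A) \<and> lin_indpt S" unfolding maximal_def by (rule conjunct1)
  then have "S \<subseteq> carrier_vec (dim_row A)" "lin_indpt S"
    using cols_dim[of A] by (blast intro: subset_trans)+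
  then have "card S \<le> dim_row A" using li_le_dim(2)[OF fin_dim] dim_is_n by simp
  then have le: "rank A \<le> dim_row A" using rank_card_indpt[OF A S] by simp
  have "dim_row A \<le> dim_col A" using card_mono[OF _ P(1)] P(2) by simp
  then show ?thesis using ge le by (simp add: full_rank_def)
qed

text \<open>Coefficients are extended by 0 to all positions. Points of different cones then have
  lifts in the same space of vectors \<open>y\<close>, where they can be subtracted.\<close>

lemma cols_cone_iff:
  assumes M: "M \<in> carrier_mat d r" and I: "I \<subseteq> {..<r}"
  shows "x \<in> cols_cone M I \<longleftrightarrow> x \<in> carrier_vec d \<and>
    (\<exists>y. (\<forall>j<r. 0 \<le> y j) \<and> (\<forall>j<r. j \<notin> I \<longrightarrow> y j = 0) \<and> (\<forall>k<d. x $ k = (\<Sum>j<r. y j * M $$ (k, j))))"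
proof -
  have finI: "finite I" using I finite_subset by blast
  have fs: "finsum_vec TYPE(real) (dim_row M) (\<lambda>i. a i \<cdot>\<^sub>v col M i) I \<in> carrier_vec d" for a
  proof -
    have "finsum_vec TYPE(real) (dim_row M) (\<lambda>i. a i \<cdot>\<^sub>v col M i) I \<in> carrier_vec (dim_row M)"
      by (intro finsum_vec_closed) auto
    then show ?thesis using M by simp
  qed
  have idx: "finsum_vec TYPE(real) (dim_row M) (\<lambda>i. a i \<cdot>\<^sub>v col M i) I $ k = (\<Sum>j\<in>I. a j * M $$ (k, j))"
    if "k < d" for a k
  proof -
    have "finsum_vec TYPE(real) (dim_row M) (\<lambda>i. a i \<cdot>\<^sub>v col M i) I $ k = (\<Sum>i\<in>I. (a i \<cdot>\<^sub>v col M i) $ k)"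
      using that M finI by (intro index_finsum_vec) auto
    also have "\<dots> = (\<Sum>j\<in>I. a j * M $$ (k, j))"
      using that M I by (intro sum.cong) auto
    finally show ?thesis .
  qed
  have sum: "(\<Sum>j<r. y j * M $$ (k, j)) = (\<Sum>j\<in>I. y j * M $$ (k, j))"
    if "\<forall>j<r. j \<notin> I \<longrightarrow> y j = 0" for y k
    using I that by (intro sum.mono_neutral_right) auto
  show ?thesis
  proof
    assume "x \<in> cols_cone M I"
    then obtain a where a: "x = finsum_vec TYPE(real) (dim_row M) (\<lambda>i. a i \<cdot>\<^sub>v col M i) I" "\<forall>i\<in>I. 0 \<le> a i"
      by (auto simp: cols_cone_def)
    define y where "y j = (if j \<in> I then a j else 0)" for j
    have "x $ k = (\<Sum>j<r. y j * M $$ (k, j))" if "k < d" for k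
      unfolding a(1) idx[OF that] by (subst sum) (auto simp: y_def)
    then show "x \<in> carrier_vec d \<and> (\<exists>y. (\<forall>j<r. 0 \<le> y j) \<and> (\<forall>j<r. j \<notin> I \<longrightarrow> y j = 0) \<and>
        (\<forall>k<d. x $ k = (\<Sum>j<r. y j * M $$ (k, j))))"
      using a fs by (intro conjI exI[of _ y]) (auto simp: y_def)
  next
    assume *: "x \<in> carrier_vec d \<and> (\<exists>y. (\<forall>j<r. 0 \<le> y j) \<and> (\<forall>j<r. j \<notin> I \<longrightarrow> y j = 0) \<and>
        (\<forall>k<d. x $ k = (\<Sum>j<r. y j * M $$ (k, j))))"
    then obtain y where y: "\<forall>j<r. 0 \<le> y j" "\<forall>j<r. j \<notin> I \<longrightarrow> y j = 0"
      "\<forall>k<d. x $ k = (\<Sum>j<r. y j * M $$ (k, j))" by blast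
    have "x = finsum_vec TYPE(real) (dim_row M) (\<lambda>i. y i \<cdot>\<^sub>v col M i) I"
    proof (rule eq_vecI)
      fix k assume "k < dim_vec (finsum_vec TYPE(real) (dim_row M) (\<lambda>i. y i \<cdot>\<^sub>v col M i) I)"
      then have k: "k < d" using fs[of y] by (metis carrier_vecD)
      show "x $ k = finsum_vec TYPE(real) (dim_row M) (\<lambda>i. y i \<cdot>\<^sub>v col M i) I $ k"
        unfolding idx[OF k] sum[OF y(2), symmetric] using y(3) k by simp
    qed (use * fs[of y] in \<open>metis carrier_vecD\<close>)
    moreover have "\<forall>i\<in>I. 0 \<le> y i" using y I by auto
    ultimately show "x \<in> cols_cone M I" unfolding cols_cone_def by blast
  qed
qed

locale gale_fan = signed_bases "{..<N}" "{..<r}" "\<lambda>i j. A $$ (i, j)" \<B>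
  for N r :: nat and A :: "real mat" and \<B> :: "nat set set" +
  assumes A: "A \<in> carrier_mat N r" and nonempty: "\<B> \<noteq> {}"
begin

definition faces :: "nat set set" where
  "faces = {I. I \<subseteq> {..<r} \<and> (\<exists>P\<in>\<B>. P \<inter> I = {})}"

text \<open>The row combination that is 1 at \<open>j\<close> and 0 on the rest of \<open>P\<close>,
  paired with the relation \<open>x\<close>, reads off \<open>x j\<close>.\<close>

lemma basis_transpose_inj:
  assumes P: "P \<in> \<B>" and x: "\<forall>i\<in>{..<N}. (\<Sum>j\<in>P. x j * A $$ (i, j)) = 0"
  shows "\<forall>j\<in>P. x j = 0"
proof
  fix j assume j: "j \<in> P"
  have finP: "finite P" using basis_subset[OF P] finite_subset by blast
  obtain a where a: "\<forall>l\<in>P. rowcomb a l = (if l = j then 1 else 0)"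
    using basis_solve[OF P, of "\<lambda>l. if l = j then 1 else 0"] by blast
  have "x j = (\<Sum>l\<in>P. x l * rowcomb a l)"
    using j finP a by (simp add: if_distrib[of "\<lambda>z. _ * z"] cong: if_cong)
  also have "\<dots> = (\<Sum>i<N. a i * (\<Sum>l\<in>P. x l * A $$ (i, l)))"
    unfolding rowcomb_def sum_distrib_left by (subst sum.swap) (simp add: mult_ac)
  also have "\<dots> = 0" using x by simp
  finally show "x j = 0" .
qed

lemma basis_transpose_solve:
  assumes P: "P \<in> \<B>"
  shows "\<exists>x. \<forall>i\<in>{..<N}. (\<Sum>j\<in>P. x j * A $$ (i, j)) = y i"
proof (rule square_system_solvable)
  show "finite P" using basis_subset[OF P] finite_subset by blast
  show "card P = card {..<N}" by (rule card_basis[OF P])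
qed (simp, rule basis_transpose_inj[OF P])

lemma full_rank: "full_rank A"
proof -
  obtain P where P: "P \<in> \<B>" using nonempty by blast
  have "cols_indep A P"
  proof (rule cols_indepI)
    show "finite P" using basis_subset[OF P] finite_subset by blast
    fix x :: "nat \<Rightarrow> real"
    assume "\<forall>k<dim_row A. (\<Sum>j\<in>P. x j * col A j $ k) = 0"
    then have "\<forall>i\<in>{..<N}. (\<Sum>j\<in>P. x j * A $$ (i, j)) = 0"
      using A basis_subset[OF P] by (auto simp: subset_iff intro!: sum.cong)
    then show "\<forall>j\<in>P. x j = 0" by (rule basis_transpose_inj[OF P])
  qed
  then show ?thesis using basis_subset[OF P] card_basis[OF P] A by (intro full_rankI) auto
qed

section \<open>Row combinations as the linear relations between the columns of a Gale dual
  matrix\<close>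

context
  fixes M :: "real mat"
  assumes M: "M \<in> carrier_mat (r - N) r" and gale: "gale_dual A M"
begin

lemma rows_span: "set (rows M) \<subseteq> mat_kernel A" "mat_kernel A \<subseteq> kernel.span r A (set (rows M))"
proof -
  interpret kernel N r A by unfold_locales (rule A)
  have "basis (set (rows M))" using gale A by (simp add: gale_dual_def)
  then show "set (rows M) \<subseteq> mat_kernel A" "mat_kernel A \<subseteq> span (set (rows M))"
    unfolding Ker.basis_def by auto
qed

lemma gale_kernel_imp:
  assumes "\<forall>k<r - N. (\<Sum>j<r. y j * M $$ (k, j)) = 0" and v: "v \<in> mat_kernel A"
  shows "(\<Sum>j<r. y j * v $ j) = 0"
proof -
  interpret kernel N r A by unfold_locales (rule A)
  have "v \<in> span (set (rows M))" using rows_span(2) v by blast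
  then obtain a S where S: "finite S" "S \<subseteq> set (rows M)" "v = lincomb a S"
    unfolding Ker.span_def by blast
  have row0: "(\<Sum>j<r. y j * s $ j) = 0" if "s \<in> S" for s
  proof -
    have "s \<in> set (rows M)" using that S(2) by blast
    then obtain k where "k < r - N" "s = row M k" using M by (auto simp: rows_def)
    then show ?thesis using assms(1) M by simp
  qed
  have "(\<Sum>j<r. y j * v $ j) = (\<Sum>j<r. y j * (\<Sum>s\<in>S. a s * s $ j))"
    using lincomb_index[OF _ subset_trans[OF S(2) rows_span(1)]] unfolding S(3)
    by (intro sum.cong) simp_all
  also have "\<dots> = (\<Sum>s\<in>S. a s * (\<Sum>j<r. y j * s $ j))"
    unfolding sum_distrib_left by (subst sum.swap) (simp add: mult_ac)
  also have "\<dots> = 0" using row0 by simp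
  finally show ?thesis .
qed

lemma gale_rowcomb:
  assumes "k < r - N"
  shows "(\<Sum>j<r. rowcomb a j * M $$ (k, j)) = 0"
proof -
  have "row M k \<in> mat_kernel A" using rows_span(1) assms M by (auto simp: rows_def)
  then have "A *\<^sub>v row M k = 0\<^sub>v N" using mat_kernel[OF A] by blast
  then have *: "(\<Sum>j<r. A $$ (i, j) * M $$ (k, j)) = 0" if "i < N" for i
    using that A M assms by (auto simp: scalar_prod_def lessThan_atLeast0 dest!: arg_cong[where f = "\<lambda>v. v $ i"])
  have "(\<Sum>j<r. rowcomb a j * M $$ (k, j)) = (\<Sum>i<N. a i * (\<Sum>j<r. A $$ (i, j) * M $$ (k, j)))"
    unfolding rowcomb_def sum_distrib_left sum_distrib_right by (subst sum.swap) (simp add: mult_ac)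
  then show ?thesis using * by simp
qed

text \<open>The functionals \<open>y\<close> that vanish on the kernel are combinations of the rows: subtract the
  combination that agrees with \<open>y\<close> on a basis and test the rest on the fundamental circuits.\<close>

lemma gale_kernel:
  assumes y: "\<forall>k<r - N. (\<Sum>j<r. y j * M $$ (k, j)) = 0"
  shows "\<exists>a. \<forall>j<r. y j = rowcomb a j"
proof -
  obtain P where P: "P \<in> \<B>" using nonempty by blast
  note Pr = basis_subset[OF P]
  have finP: "finite P" using Pr finite_subset by blast
  obtain a where a: "\<forall>j\<in>P. rowcomb a j = y j" using basis_solve[OF P] by blast
  define z where "z j = y j - rowcomb a j" for j
  have z: "\<forall>k<r - N. (\<Sum>j<r. z j * M $$ (k, j)) = 0"
    using y gale_rowcomb by (simp add: z_def left_diff_distrib sum_subtractf)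
  have "z i = 0" if i: "i < r" for i
  proof (cases "i \<in> P")
    case True
    then show ?thesis using a by (simp add: z_def)
  next
    case False
    obtain x where x: "\<forall>l\<in>{..<N}. (\<Sum>j\<in>P. x j * A $$ (l, j)) = - A $$ (l, i)"
      using basis_transpose_solve[OF P, of "\<lambda>l. - A $$ (l, i)"] by blast
    define w where "w = vec r (\<lambda>j. if j = i then 1 else if j \<in> P then x j else 0)"
    have sum: "(\<Sum>j<r. f j * w $ j) = f i + (\<Sum>j\<in>P. f j * x j)" for f
    proof -
      have "(\<Sum>j<r. f j * w $ j) = (\<Sum>j\<in>insert i P. f j * w $ j)"
        using i Pr by (intro sum.mono_neutral_right) (auto simp: w_def)
      also have "\<dots> = f i * w $ i + (\<Sum>j\<in>P. f j * w $ j)" using finP False by simp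
      also have "(\<Sum>j\<in>P. f j * w $ j) = (\<Sum>j\<in>P. f j * x j)"
      proof (rule sum.cong)
        fix j assume "j \<in> P"
        then have "j < r" "j \<noteq> i" using Pr False by auto
        then show "f j * w $ j = f j * x j" using \<open>j \<in> P\<close> by (simp add: w_def)
      qed simp
      finally show ?thesis using i by (simp add: w_def)
    qed
    have "A *\<^sub>v w = 0\<^sub>v N"
    proof (rule eq_vecI)
      fix l assume "l < dim_vec (0\<^sub>v N)"
      then have l: "l < N" by simp
      have "(A *\<^sub>v w) $ l = (\<Sum>j<r. A $$ (l, j) * w $ j)"
        using l A by (simp add: scalar_prod_def w_def lessThan_atLeast0)
      also have "\<dots> = 0" using x l unfolding sum by (simp add: mult.commute)
      finally show "(A *\<^sub>v w) $ l = 0\<^sub>v N $ l" using l by simp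
    qed (use A in simp)
    then have "w \<in> mat_kernel A" using mat_kernel[OF A] by (simp add: w_def)
    from gale_kernel_imp[OF z this] have "z i + (\<Sum>j\<in>P. z j * x j) = 0" unfolding sum .
    moreover have "\<forall>j\<in>P. z j = 0" using a by (simp add: z_def)
    ultimately show ?thesis by simp
  qed
  then show ?thesis by (auto simp: z_def)
qed

text \<open>A linear relation between the columns of \<open>M\<close> is a row combination of
  \<open>A\<close>. If it is supported on a face, it vanishes on a basis disjoint from that face and
  is therefore trivial.\<close>

lemma face_indep:
  assumes I: "I \<in> faces" and y: "\<forall>j<r. j \<notin> I \<longrightarrow> y j = 0"
    and "\<forall>k<r - N. (\<Sum>j<r. y j * M $$ (k, j)) = 0"
  shows "\<forall>j<r. y j = 0"
proof -
  obtain P where P: "P \<in> \<B>" "P \<inter> I = {}" using I by (auto simp: faces_def)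
  obtain a where a: "\<forall>j<r. y j = rowcomb a j" using gale_kernel assms(3) by blast
  then have "\<forall>j\<in>P. rowcomb a j = 0" using y P basis_subset[OF P(1)] by (metis disjoint_iff lessThan_iff subsetD)
  then have "rowcomb a j = 0" for j using basis_inj[OF P(1)] rowcomb_zero by blast
  then show ?thesis using a by simp
qed

text \<open>The columns outside a basis are independent by \<open>face_indep\<close>, and there are
  exactly \<open>r - N\<close> of them.\<close>

lemma gale_surj: "\<exists>y. \<forall>k<r - N. (\<Sum>j<r. y j * M $$ (k, j)) = x k"
proof -
  obtain P where P: "P \<in> \<B>" using nonempty by blast
  define I where "I = {..<r} - P"
  have I: "I \<in> faces" using P by (auto simp: faces_def I_def)
  have sum: "(\<Sum>j<r. (if j \<in> I then y j else 0) * M $$ (k, j)) = (\<Sum>j\<in>I. y j * M $$ (k, j))" for y k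
    by (rule sum.mono_neutral_cong_right) (auto simp: I_def)
  have "\<exists>y. \<forall>k\<in>{..<r - N}. (\<Sum>j\<in>I. y j * M $$ (k, j)) = x k"
  proof (rule square_system_solvable)
    show "card I = card {..<r - N}"
      using card_basis[OF P] basis_subset[OF P] finite_subset[OF basis_subset[OF P]]
      by (simp add: I_def card_Diff_subset)
    fix y assume "\<forall>k\<in>{..<r - N}. (\<Sum>j\<in>I. y j * M $$ (k, j)) = 0"
    then have "\<forall>j<r. (if j \<in> I then y j else 0) = 0" by (intro face_indep[OF I]) (auto simp: sum)
    then show "\<forall>j\<in>I. y j = 0" by (auto simp: I_def)
  qed (auto simp: I_def)
  then obtain y where "\<forall>k<r - N. (\<Sum>j\<in>I. y j * M $$ (k, j)) = x k" by auto
  then show ?thesis using sum[of y] by metis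
qed

lemma faces_cols_indep:
  assumes I: "I \<in> faces"
  shows "cols_indep M I"
proof (rule cols_indepI)
  have Ir: "I \<subseteq> {..<r}" using I by (simp add: faces_def)
  then show "finite I" using finite_subset by blast
  fix x :: "nat \<Rightarrow> real"
  assume x: "\<forall>j. j \<notin> I \<longrightarrow> x j = 0" "\<forall>k<dim_row M. (\<Sum>j\<in>I. x j * col M j $ k) = 0"
  have "(\<Sum>j<r. x j * M $$ (k, j)) = 0" if k: "k < r - N" for k
  proof -
    have "(\<Sum>j<r. x j * M $$ (k, j)) = (\<Sum>j\<in>I. x j * col M j $ k)"
      using Ir M k x(1) by (intro sum.mono_neutral_cong_right) auto
    then show ?thesis using x(2) M k by simp
  qed
  then have "\<forall>j<r. x j = 0" using x(1) by (intro face_indep[OF I]) auto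
  then show "\<forall>j\<in>I. x j = 0" using Ir by auto
qed

text \<open>Two nonnegative lifts of a common point differ by a row combination. Both solve the
  problem for \<open>y\<close>, one with the zero combination, so they agree by
  \<open>solution_unique\<close> and the support lies in both faces.\<close>

lemma faces_cone_inter:
  assumes I: "I \<in> faces" and J: "J \<in> faces"
  shows "cols_cone M I \<inter> cols_cone M J = cols_cone M (I \<inter> J)"
proof -
  have Ir: "I \<subseteq> {..<r}" and Jr: "J \<subseteq> {..<r}" and IJr: "I \<inter> J \<subseteq> {..<r}" using I J by (auto simp: faces_def)
  show ?thesis
  proof (intro equalityI subsetI)
    fix x assume "x \<in> cols_cone M I \<inter> cols_cone M J"
    then obtain y z where x: "x \<in> carrier_vec (r - N)"
      and y: "\<forall>j<r. 0 \<le> y j" "\<forall>j<r. j \<notin> I \<longrightarrow> y j = 0" "\<forall>k<r - N. x $ k = (\<Sum>j<r. y j * M $$ (k, j))"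
      and z: "\<forall>j<r. 0 \<le> z j" "\<forall>j<r. j \<notin> J \<longrightarrow> z j = 0" "\<forall>k<r - N. x $ k = (\<Sum>j<r. z j * M $$ (k, j))"
      using cols_cone_iff[OF M Ir] cols_cone_iff[OF M Jr] by blast
    have "\<forall>k<r - N. (\<Sum>j<r. (z j - y j) * M $$ (k, j)) = 0"
      using y(3) z(3) by (simp add: left_diff_distrib sum_subtractf)
    then obtain a where a: "\<forall>j<r. z j - y j = rowcomb a j"
      using gale_kernel[of "\<lambda>j. z j - y j"] by blast
    obtain P where P: "P \<in> \<B>" "P \<inter> I = {}" using I by (auto simp: faces_def)
    obtain P' where P': "P' \<in> \<B>" "P' \<inter> J = {}" using J by (auto simp: faces_def)
    note PE = basis_subset[OF P(1)] basis_subset[OF P'(1)]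
    have zero: "rowcomb (\<lambda>_. 0) j = 0" for j by (simp add: rowcomb_zero)
    have "rowcomb a j = rowcomb (\<lambda>_. 0) j" for j
    proof (rule solution_unique[OF P'(1) P(1) PE(2,1)])
      have *: "y j + rowcomb a j = z j" if "j < r" for j using a that by (auto simp: algebra_simps)
      show "\<forall>j\<in>P'. y j + rowcomb a j = 0" using * z(2) P' PE by (metis disjoint_iff lessThan_iff subsetD)
      show "\<forall>j\<in>{..<r}. 0 \<le> y j + rowcomb a j" using * z(1) by simp
      show "\<forall>j\<in>P. y j + rowcomb (\<lambda>_. 0) j = 0" unfolding zero using y(2) P PE by (metis add_0_right disjoint_iff lessThan_iff subsetD)
      show "\<forall>j\<in>{..<r}. 0 \<le> y j + rowcomb (\<lambda>_. 0) j" unfolding zero using y(1) by simp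
    qed
    then have "\<forall>j<r. z j = y j" using a zero by simp
    then have "\<forall>j<r. j \<notin> I \<inter> J \<longrightarrow> y j = 0" using y(2) z(2) by auto
    then show "x \<in> cols_cone M (I \<inter> J)" using x y cols_cone_iff[OF M IJr] by blast
  next
    fix x assume "x \<in> cols_cone M (I \<inter> J)"
    then show "x \<in> cols_cone M I \<inter> cols_cone M J"
      unfolding Int_iff cols_cone_iff[OF M Ir] cols_cone_iff[OF M Jr] cols_cone_iff[OF M IJr] by blast
  qed
qed

lemma faces_cones_cover: "\<Union>(cols_cone M ` faces) = carrier_vec (dim_row M)"
proof (intro equalityI subsetI)
  fix x assume "x \<in> \<Union>(cols_cone M ` faces)"
  then obtain I where "I \<in> faces" "x \<in> cols_cone M I" by blast
  then show "x \<in> carrier_vec (dim_row M)" using cols_cone_iff[OF M, of I] M by (auto simp: faces_def)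
next
  fix x :: "real vec" assume x: "x \<in> carrier_vec (dim_row M)"
  obtain y where y: "\<forall>k<r - N. (\<Sum>j<r. y j * M $$ (k, j)) = x $ k" using gale_surj by blast
  obtain P0 where "P0 \<in> \<B>" using nonempty by blast
  then have "solvable {..<r} y" using solvable_superset_basis[OF order_refl] basis_subset by blast
  then obtain a P where P: "P \<in> \<B>" "\<forall>j\<in>P. y j + rowcomb a j = 0" "\<forall>j\<in>{..<r}. 0 \<le> y j + rowcomb a j"
    unfolding solvable_def by blast
  define I where "I = {..<r} - P"
  have I: "I \<in> faces" "I \<subseteq> {..<r}" using P by (auto simp: faces_def I_def)
  have "\<forall>k<r - N. x $ k = (\<Sum>j<r. (y j + rowcomb a j) * M $$ (k, j))"
    using y gale_rowcomb by (simp add: distrib_right sum.distrib)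
  moreover have "\<forall>j<r. j \<notin> I \<longrightarrow> y j + rowcomb a j = 0" using P(2) by (auto simp: I_def)
  ultimately have "x \<in> cols_cone M I"
    unfolding cols_cone_iff[OF M I(2)] using P(3) x M
    by (intro conjI exI[of _ "\<lambda>j. y j + rowcomb a j"]) auto
  then show "x \<in> \<Union>(cols_cone M ` faces)" using I by blast
qed

end

end

section \<open>Signs of quadratic polynomials\<close>

text \<open>Complete the square; the value at \<open>x\<close> shows that there are real roots. A
  double root \<open>a = b\<close> is possible, and the endpoints belong to both sign sets.\<close>

lemma quadratic_sign_interval:
  fixes u v k x :: real
  assumes k: "k > 0" and x: "u + v * x + k * x^2 \<le> 0"
  shows "\<exists>a b. a \<le> b \<and> a + b = - v / k \<and> (\<forall>t. u + v * t + k * t^2 \<le> 0 \<longleftrightarrow> a \<le> t \<and> t \<le> b) \<and>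
    (\<forall>t. 0 \<le> u + v * t + k * t^2 \<longleftrightarrow> t \<le> a \<or> b \<le> t)"
proof -
  define p where "p = - v / (2 * k)"
  define q where "q = p^2 - u / k"
  have eq: "u + v * t + k * t^2 = k * ((t - p)^2 - q)" for t
    using k unfolding p_def q_def by (simp add: field_simps power2_eq_square)
  have "(x - p)^2 \<le> q" using x k unfolding eq by (simp add: mult_le_0_iff)
  then have q: "0 \<le> q" by (smt (verit) zero_le_power2)
  define r where "r = sqrt q"
  have r: "0 \<le> r" "r^2 = q" using q by (auto simp: r_def)
  have le: "u + v * t + k * t^2 \<le> 0 \<longleftrightarrow> \<bar>t - p\<bar> \<le> r" for t
    using k r abs_le_square_iff[of "t - p" r] unfolding eq by (simp add: mult_le_0_iff)
  have ge: "0 \<le> u + v * t + k * t^2 \<longleftrightarrow> r \<le> \<bar>t - p\<bar>" for t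
    using k r abs_le_square_iff[of r "t - p"] unfolding eq by (simp add: zero_le_mult_iff)
  have "(p - r) + (p + r) = - v / k" using k by (simp add: p_def field_simps)
  then show ?thesis using r
    by (intro exI[of _ "p - r"] exI[of _ "p + r"]) (auto simp: le ge)
qed

text \<open>\<open>X i\<close> is the set of times at which the letter \<open>s\<^sub>i\<close> occurs.  The four parts say that the letters
  contain the elements \<open>s\<^sub>2 s\<^sub>1 s\<^sub>3 s\<^sub>2\<close>, \<open>s\<^sub>1 s\<^sub>2 s\<^sub>3 s\<^sub>2 s\<^sub>1\<close>, \<open>s\<^sub>1 s\<^sub>2 s\<^sub>3\<close> and \<open>s\<^sub>3 s\<^sub>2 s\<^sub>1\<close>.\<close>

definition full_times3 :: "(nat \<Rightarrow> real set) \<Rightarrow> bool" where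
  "full_times3 X \<longleftrightarrow>
    (\<exists>y\<in>X 2. \<exists>x\<in>X 1. \<exists>z\<in>X 3. \<exists>y'\<in>X 2. y < x \<and> x < y' \<and> y < z \<and> z < y') \<and>
    ((\<exists>x\<in>X 1. \<exists>y\<in>X 2. \<exists>z\<in>X 3. \<exists>y'\<in>X 2. \<exists>x'\<in>X 1. x < y \<and> y < z \<and> z < y' \<and> y' < x') \<or>
     (\<exists>z\<in>X 3. \<exists>y\<in>X 2. \<exists>x\<in>X 1. \<exists>y'\<in>X 2. \<exists>z'\<in>X 3. z < y \<and> y < x \<and> x < y' \<and> y' < z') \<or>
     (\<exists>x\<in>X 1. \<exists>z\<in>X 3. \<exists>y\<in>X 2. \<exists>x'\<in>X 1. \<exists>z'\<in>X 3. x < y \<and> z < y \<and> y < x' \<and> y < z')) \<and>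
    (\<exists>x\<in>X 1. \<exists>y\<in>X 2. \<exists>z\<in>X 3. x < y \<and> y < z) \<and>
    (\<exists>z\<in>X 3. \<exists>y\<in>X 2. \<exists>x\<in>X 1. z < y \<and> y < x)"

definition full_times2 :: "(nat \<Rightarrow> real set) \<Rightarrow> bool" where
  "full_times2 X \<longleftrightarrow> (\<exists>x\<in>X 1. \<exists>y\<in>X 2. x < y) \<and> (\<exists>y\<in>X 2. \<exists>x\<in>X 1. y < x)"

text \<open>For \<open>B < 0 < F\<close> the first function decreases, so the times in
  \<open>X 1\<close> are at most those in \<open>Y 1\<close>; the second increases, so those in
  \<open>Y 2\<close> are at most those in \<open>X 2\<close>. A 2 before a 1 in \<open>X\<close> and
  a 1 before a 2 in \<open>Y\<close> close this to a strict cycle.\<close>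

lemma linear_sign2:
  fixes A B E :: real
  assumes "full_times2 X" "full_times2 Y"
    and "\<forall>t\<in>X 1. 0 \<le> A + B * t" "\<forall>t\<in>X 2. 0 \<le> E + F * t"
    and "\<forall>t\<in>Y 1. A + B * t \<le> 0" "\<forall>t\<in>Y 2. E + F * t \<le> 0"
  shows "\<not> (B < 0 \<and> 0 < F)" "\<not> (0 < B \<and> F < 0)"
proof -
  obtain x1 y1 x2 y2 where X: "x1 \<in> X 1" "y1 \<in> X 2" "x1 < y1" "x2 \<in> X 1" "y2 \<in> X 2" "y2 < x2"
    using assms(1) by (auto simp: full_times2_def)
  obtain u1 v1 u2 v2 where Y: "u1 \<in> Y 1" "v1 \<in> Y 2" "u1 < v1" "u2 \<in> Y 1" "v2 \<in> Y 2" "v2 < u2"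
    using assms(2) by (auto simp: full_times2_def)
  have *: "0 \<le> A + B * x1" "0 \<le> A + B * x2" "0 \<le> E + F * y1" "0 \<le> E + F * y2"
    "A + B * u1 \<le> 0" "A + B * u2 \<le> 0" "E + F * v1 \<le> 0" "E + F * v2 \<le> 0"
    using assms X Y by blast+
  show "\<not> (B < 0 \<and> 0 < F)"
  proof
    assume "B < 0 \<and> 0 < F"
    then have BF: "B < 0" "0 < F" by auto
    have "B * (u1 - x2) \<le> 0" "F * (v1 - y2) \<le> 0" using * by (auto simp: algebra_simps)
    then have "x2 \<le> u1" "v1 \<le> y2" using BF by (auto simp: mult_le_0_iff)
    then show False using X Y by linarith
  qed
  show "\<not> (0 < B \<and> F < 0)"
  proof
    assume "0 < B \<and> F < 0"
    then have BF: "0 < B" "F < 0" by auto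
    have "B * (u2 - x1) \<le> 0" "F * (v2 - y1) \<le> 0" using * by (auto simp: algebra_simps)
    then have "u2 \<le> x1" "y1 \<le> v2" using BF by (auto simp: mult_le_0_iff)
    then show False using X Y by linarith
  qed
qed

lemma sign2:
  fixes A B E :: real
  assumes "full_times2 X" "full_times2 Y"
    and "\<forall>t\<in>X 1. 0 \<le> A + B * t" "\<forall>t\<in>X 2. 0 \<le> E + (- B) * t"
    and "\<forall>t\<in>Y 1. A + B * t \<le> 0" "\<forall>t\<in>Y 2. E + (- B) * t \<le> 0"
  shows "A = 0 \<and> B = 0 \<and> E = 0"
proof -
  have "B = 0" using linear_sign2[OF assms] by linarith
  then show ?thesis using assms by (auto simp: full_times2_def)
qed

text \<open>Suppose \<open>e > 0\<close>. By \<open>X\<close>, a 1 and a 3 between two 2s show that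
  neither outer interval contains \<open>[a2, b2]\<close>. By \<open>Y\<close>, either the first
  outer interval or the third does contain it, or both outer intervals reach beyond it on the same
  side. In the latter case their other endpoints lie strictly on that same side of the opposite
  endpoint of \<open>[a2, b2]\<close>, against the relation of the centres.\<close>

lemma quadratic_sign3:
  fixes A B C D E F e :: real
  assumes X: "full_times3 X" and Y: "full_times3 Y" and sum: "B + D + F = 0"
    and "\<forall>t\<in>X 1. 0 \<le> A + B * t + e / 2 * t^2" "\<forall>t\<in>X 3. 0 \<le> C + D * t + e / 2 * t^2"
      "\<forall>t\<in>X 2. 0 \<le> E + F * t - e * t^2"
    and "\<forall>t\<in>Y 1. A + B * t + e / 2 * t^2 \<le> 0" "\<forall>t\<in>Y 3. C + D * t + e / 2 * t^2 \<le> 0"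
      "\<forall>t\<in>Y 2. E + F * t - e * t^2 \<le> 0"
  shows "e \<le> 0"
proof (rule ccontr)
  assume "\<not> e \<le> 0"
  then have e: "0 < e" and e2: "0 < e / 2" by simp_all
  \<comment> \<open>Real roots need a nonpositive value: \<open>Y\<close> provides it for the outer
    polynomials, \<open>X\<close> for the negated middle one.\<close>
  obtain y0 where y0: "y0 \<in> X 2" using X by (auto simp: full_times3_def)
  obtain x0 z0 where x0: "x0 \<in> Y 1" "z0 \<in> Y 3" using Y by (auto simp: full_times3_def)
  obtain a1 b1 where 1: "a1 + b1 = - B / (e / 2)"
    "\<And>t. A + B * t + e / 2 * t^2 \<le> 0 \<longleftrightarrow> a1 \<le> t \<and> t \<le> b1"
    "\<And>t. 0 \<le> A + B * t + e / 2 * t^2 \<longleftrightarrow> t \<le> a1 \<or> b1 \<le> t"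
    using quadratic_sign_interval[OF e2, of A B x0] x0 assms(7) by blast
  obtain a3 b3 where 3: "a3 + b3 = - D / (e / 2)"
    "\<And>t. C + D * t + e / 2 * t^2 \<le> 0 \<longleftrightarrow> a3 \<le> t \<and> t \<le> b3"
    "\<And>t. 0 \<le> C + D * t + e / 2 * t^2 \<longleftrightarrow> t \<le> a3 \<or> b3 \<le> t"
    using quadratic_sign_interval[OF e2, of C D z0] x0 assms(8) by blast
  have neg: "(- E) + (- F) * t + e * t^2 = - (E + F * t - e * t^2)" for t by simp
  have "(- E) + (- F) * y0 + e * y0^2 \<le> 0" using y0 assms(6) by fastforce
  from quadratic_sign_interval[OF e this]
  obtain a2 b2 where 2: "a2 + b2 = F / e"
    "\<And>t. 0 \<le> E + F * t - e * t^2 \<longleftrightarrow> a2 \<le> t \<and> t \<le> b2"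
    "\<And>t. E + F * t - e * t^2 \<le> 0 \<longleftrightarrow> t \<le> a2 \<or> b2 \<le> t"
    unfolding neg neg_le_0_iff_le neg_0_le_iff_le minus_minus by blast
  \<comment> \<open>The sum of the roots is minus the linear over the quadratic coefficient; since
    the quadratic coefficients are \<open>e / 2\<close>, \<open>- e\<close>, \<open>e / 2\<close>,
    the linear ones sum to 0 exactly when the centres are related as in \<open>s\<close>.\<close>
  have "(a1 + b1) + (a3 + b3) - 2 * (a2 + b2) = (- 2) * (B + D + F) / e"
    unfolding 1(1) 2(1) 3(1) using e by (simp add: field_simps)
  then have s: "a1 + b1 + a3 + b3 = 2 * (a2 + b2)" using sum by simp
  note ge = assms(4-6)[unfolded 1 2 3]
  note le = assms(7-9)[unfolded 1 2 3]
  obtain y x z y' where "y \<in> X 2" "x \<in> X 1" "z \<in> X 3" "y' \<in> X 2" "y < x" "x < y'" "y < z" "z < y'"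
    using X by (auto simp: full_times3_def)
  then have X': "a2 < a1 \<or> b1 < b2" "a2 < a3 \<or> b3 < b2" using ge by fastforce+
  from Y[unfolded full_times3_def, THEN conjunct2, THEN conjunct1] show False
  proof (elim disjE bexE conjE, goal_cases)
    case (1 x y z y' x')
    then have "a1 \<le> x" "x' \<le> b1" "a3 \<le> z" "z \<le> b3" "y \<le> a2 \<or> b2 \<le> y" "y' \<le> a2 \<or> b2 \<le> y'"
      using le by simp_all
    then show False using 1 X' s by argo
  next
    case (2 z y x y' z')
    then have "a3 \<le> z" "z' \<le> b3" "a1 \<le> x" "x \<le> b1" "y \<le> a2 \<or> b2 \<le> y" "y' \<le> a2 \<or> b2 \<le> y'"
      using le by simp_all
    then show False using 2 X' s by argo
  next
    case (3 x z y x' z')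
    then have "a1 \<le> x" "x' \<le> b1" "a3 \<le> z" "z' \<le> b3" "y \<le> a2 \<or> b2 \<le> y"
      using le by simp_all
    then show False using 3 X' s by argo
  qed
qed

text \<open>The updates of \<open>X\<close> let the statement on two letters serve the pairs 3, 2
  and 1, 3 as well. The letters 1 and 3 are compared through a 2 between them.\<close>

lemma full_times3_imp_full_times2:
  assumes "full_times3 X"
  shows "full_times2 X" "full_times2 (X(1 := X 3))" "full_times2 (X(2 := X 3))"
proof -
  obtain x y z where xyz: "x \<in> X 1" "y \<in> X 2" "z \<in> X 3" "x < y" "y < z"
    using assms[unfolded full_times3_def, THEN conjunct2, THEN conjunct2, THEN conjunct1] by blast
  obtain z' y' x' where xyz': "z' \<in> X 3" "y' \<in> X 2" "x' \<in> X 1" "z' < y'" "y' < x'"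
    using assms[unfolded full_times3_def, THEN conjunct2, THEN conjunct2, THEN conjunct2] by blast
  have "x < z" "z' < x'" using xyz xyz' by auto
  with xyz xyz' show "full_times2 X" "full_times2 (X(1 := X 3))" "full_times2 (X(2 := X 3))"
    unfolding full_times2_def by (simp_all, blast+)
qed

text \<open>Changing all signs exchanges \<open>X\<close> and \<open>Y\<close>, so
  \<open>quadratic_sign3\<close> bounds \<open>e\<close> from both sides. Of the remaining linear
  functions no two have slopes of opposite signs, yet the slopes sum to 0.\<close>

lemma sign3:
  fixes A B C D E F e :: real
  assumes X: "full_times3 X" and Y: "full_times3 Y" and sum: "B + D + F = 0"
    and ge: "\<forall>t\<in>X 1. 0 \<le> A + B * t + e / 2 * t^2" "\<forall>t\<in>X 3. 0 \<le> C + D * t + e / 2 * t^2"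
      "\<forall>t\<in>X 2. 0 \<le> E + F * t - e * t^2"
    and le: "\<forall>t\<in>Y 1. A + B * t + e / 2 * t^2 \<le> 0" "\<forall>t\<in>Y 3. C + D * t + e / 2 * t^2 \<le> 0"
      "\<forall>t\<in>Y 2. E + F * t - e * t^2 \<le> 0"
  shows "A = 0 \<and> B = 0 \<and> C = 0 \<and> D = 0 \<and> E = 0 \<and> F = 0 \<and> e = 0"
proof -
  have "e \<le> 0" by (rule quadratic_sign3[OF X Y sum ge le])
  moreover have "- e \<le> 0"
  proof (rule quadratic_sign3[OF Y X])
    show "- B + - D + - F = 0" using sum by simp
    show "\<forall>t\<in>Y 1. 0 \<le> - A + - B * t + - e / 2 * t^2" using le(1) by force
    show "\<forall>t\<in>Y 3. 0 \<le> - C + - D * t + - e / 2 * t^2" using le(2) by force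
    show "\<forall>t\<in>Y 2. 0 \<le> - E + - F * t - - e * t^2" using le(3) by force
    show "\<forall>t\<in>X 1. - A + - B * t + - e / 2 * t^2 \<le> 0" using ge(1) by force
    show "\<forall>t\<in>X 3. - C + - D * t + - e / 2 * t^2 \<le> 0" using ge(2) by force
    show "\<forall>t\<in>X 2. - E + - F * t - - e * t^2 \<le> 0" using ge(3) by force
  qed
  ultimately have e: "e = 0" by simp
  have ge': "\<forall>t\<in>X 1. 0 \<le> A + B * t" "\<forall>t\<in>X 3. 0 \<le> C + D * t" "\<forall>t\<in>X 2. 0 \<le> E + F * t"
    and le': "\<forall>t\<in>Y 1. A + B * t \<le> 0" "\<forall>t\<in>Y 3. C + D * t \<le> 0" "\<forall>t\<in>Y 2. E + F * t \<le> 0"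
    using ge le e by simp_all
  note t2X = full_times3_imp_full_times2[OF X] and t2Y = full_times3_imp_full_times2[OF Y]
  have "\<not> (B < 0 \<and> 0 < F)" "\<not> (0 < B \<and> F < 0)"
    using linear_sign2[OF t2X(1) t2Y(1) ge'(1,3) le'(1,3)] by auto
  moreover have "\<not> (D < 0 \<and> 0 < F)" "\<not> (0 < D \<and> F < 0)"
    using linear_sign2[OF t2X(2) t2Y(2), of C D E F] ge' le' by auto
  moreover have "\<not> (B < 0 \<and> 0 < D)" "\<not> (0 < B \<and> D < 0)"
    using linear_sign2[OF t2X(3) t2Y(3), of A B C D] ge' le' by auto
  ultimately have BDF: "B = 0" "D = 0" "F = 0" using sum by linarith+
  obtain x y z x' y' z' where "x \<in> X 1" "y \<in> X 2" "z \<in> X 3" "x' \<in> Y 1" "y' \<in> Y 2" "z' \<in> Y 3"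
    using X Y unfolding full_times3_def by blast
  then have "A = 0" "C = 0" "E = 0" using ge' le' BDF by (auto intro: order_antisym)
  with BDF e show ?thesis by simp
qed

section \<open>Lengths and reduced words\<close>

definition inversions :: "nat \<Rightarrow> (nat \<Rightarrow> nat) \<Rightarrow> (nat \<times> nat) set" where
  "inversions n w = {(i, j). 1 \<le> i \<and> i < j \<and> j \<le> n + 1 \<and> w j < w i}"

lemma finite_inversions: "finite (inversions n w)"
  by (rule finite_subset[of _ "{1..n + 1} \<times> {1..n + 1}"]) (auto simp: inversions_def)

lemma simple_refl_apply: "simple_refl s x = (if x = s then s + 1 else if x = s + 1 then s else x)"
  by (simp add: simple_refl_def transpose_def)

lemma word_prod_Nil: "word_prod [] = id"
  and word_prod_Cons: "word_prod (s # u) = simple_refl s \<circ> word_prod u"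
  by (simp_all add: word_prod_def)

lemma simple_refl_invol: "simple_refl s \<circ> simple_refl s = id"
  by (simp add: simple_refl_def)

lemma simple_refl_permutes: "s \<in> {1..n} \<Longrightarrow> simple_refl s permutes {1..n + 1}"
  unfolding simple_refl_def by (rule permutes_swap_id) auto

lemma word_prod_permutes: "is_word n u \<Longrightarrow> word_prod u permutes {1..n + 1}"
proof (induction u)
  case (Cons s u)
  then have "s \<in> {1..n}" "is_word n u" by (auto simp: is_word_def)
  then have "simple_refl s permutes {1..n + 1}" "word_prod u permutes {1..n + 1}"
    using Cons.IH simple_refl_permutes by blast+
  then show ?case unfolding word_prod_Cons by (rule permutes_compose[rotated])
qed (simp add: word_prod_Nil)

text \<open>Left multiplication exchanges the consecutive values \<open>s\<close> and
  \<open>s + 1\<close>, so only the comparison of the places \<open>a\<close> and \<open>b\<close>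
  of these two values changes.\<close>

lemma inversions_simple_refl:
  assumes w: "w permutes {1..n + 1}" and ab: "w a = s" "w b = s + 1"
  shows "inversions n (simple_refl s \<circ> w) \<subseteq> insert (a, b) (inversions n w)"
    and "b < a \<Longrightarrow> inversions n (simple_refl s \<circ> w) \<subseteq> inversions n w - {(b, a)}"
proof -
  have inj: "w x = w y \<longleftrightarrow> x = y" for x y using permutes_inj[OF w] by (auto dest: injD)
  have *: "w x = s \<longleftrightarrow> x = a" "w x = s + 1 \<longleftrightarrow> x = b" for x using inj[of x a] inj[of x b] ab by auto
  have **: "(simple_refl s \<circ> w) x = (if x = a then s + 1 else if x = b then s else w x)" for x
    unfolding comp_apply simple_refl_apply * ..
  show "inversions n (simple_refl s \<circ> w) \<subseteq> insert (a, b) (inversions n w)"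
  proof
    fix p assume p: "p \<in> inversions n (simple_refl s \<circ> w)"
    obtain i j where ij: "p = (i, j)" by fastforce
    show "p \<in> insert (a, b) (inversions n w)"
      using p *[of i] *[of j] ab unfolding ij inversions_def mem_Collect_eq prod.case **
      by (auto split: if_splits)
  qed
  show "inversions n (simple_refl s \<circ> w) \<subseteq> inversions n w - {(b, a)}" if "b < a"
  proof
    fix p assume p: "p \<in> inversions n (simple_refl s \<circ> w)"
    obtain i j where ij: "p = (i, j)" by fastforce
    show "p \<in> inversions n w - {(b, a)}"
      using p *[of i] *[of j] ab that unfolding ij inversions_def mem_Collect_eq prod.case **
      by (auto simp: inversions_def split: if_splits)
  qed
qed

lemma card_inversions_word_prod: "is_word n u \<Longrightarrow> card (inversions n (word_prod u)) \<le> length u"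
proof (induction u)
  case (Cons s u)
  have w: "word_prod u permutes {1..n + 1}" using Cons.prems by (intro word_prod_permutes) (simp add: is_word_def)
  obtain a b where ab: "word_prod u a = s" "word_prod u b = s + 1"
    using permutes_surj[OF w] by (metis surjD)
  have "card (inversions n (word_prod (s # u))) \<le> card (insert (a, b) (inversions n (word_prod u)))"
    unfolding word_prod_Cons using inversions_simple_refl(1)[OF w ab] finite_inversions
    by (intro card_mono) auto
  also have "\<dots> \<le> Suc (card (inversions n (word_prod u)))" by (simp add: card_insert_if finite_inversions)
  finally show ?case using Cons by (auto simp: is_word_def)
next
  case Nil
  have "inversions n id = {}" by (auto simp: inversions_def)
  then show ?case by (simp add: word_prod_Nil flip: id_def)
qed

lemma permutes_increasing_id:
  assumes w: "w permutes {1..n + 1::nat}" and inc: "\<And>s. s \<in> {1..n} \<Longrightarrow> w s < w (s + 1)"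
  shows "w = id"
proof (rule permutes_natset_ge[OF w], rule ballI)
  fix i assume "i \<in> {1..n + 1}"
  then have "1 \<le> i" "i \<le> n + 1" by auto
  then show "i \<le> w i"
  proof (induction i rule: dec_induct)
    case base
    then show ?case using permutes_in_image[OF w, of 1] by simp
  next
    case (step m)
    then have "m \<le> w m" "w m < w (m + 1)" using inc[of m] by auto
    then show ?case by simp
  qed
qed

text \<open>If the value \<open>s + 1\<close> stands to the left of \<open>s\<close>, exchanging
  them lowers the number of inversions. If this never happens, the inverse is increasing and hence
  the identity.\<close>

lemma exists_short_word:
  "w permutes {1..n + 1} \<Longrightarrow> \<exists>u. is_word n u \<and> word_prod u = w \<and> length u \<le> card (inversions n w)"
proof (induction "card (inversions n w)" arbitrary: w rule: less_induct)
  case (less w)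
  note w = less.prems
  show ?case
  proof (cases "\<exists>s\<in>{1..n}. Hilbert_Choice.inv w (s + 1) < Hilbert_Choice.inv w s")
    case True
    then obtain s where s: "s \<in> {1..n}" "Hilbert_Choice.inv w (s + 1) < Hilbert_Choice.inv w s" by blast
    let ?a = "Hilbert_Choice.inv w s" and ?b = "Hilbert_Choice.inv w (s + 1)"
    have ab: "w ?a = s" "w ?b = s + 1" using permutes_inverses(1)[OF w] by auto
    have "?a \<in> {1..n + 1}" "?b \<in> {1..n + 1}"
      using permutes_in_image[OF permutes_inv[OF w]] s(1) by auto
    then have "(?b, ?a) \<in> inversions n w" using ab s by (auto simp: inversions_def)
    then have lt: "card (inversions n (simple_refl s \<circ> w)) < card (inversions n w)"
      using inversions_simple_refl(2)[OF w ab s(2)] finite_inversions by (intro psubset_card_mono) auto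
    moreover have "simple_refl s \<circ> w permutes {1..n + 1}"
      using permutes_compose[OF w simple_refl_permutes[OF s(1)]] .
    ultimately obtain u where u: "is_word n u" "word_prod u = simple_refl s \<circ> w"
      "length u \<le> card (inversions n (simple_refl s \<circ> w))"
      using less.hyps by blast
    have "word_prod (s # u) = w"
      unfolding word_prod_Cons u(2) comp_assoc[symmetric] simple_refl_invol by simp
    then show ?thesis using u lt s by (intro exI[of _ "s # u"]) (auto simp: is_word_def)
  next
    case False
    have "Hilbert_Choice.inv w s < Hilbert_Choice.inv w (s + 1)" if "s \<in> {1..n}" for s
    proof -
      have "Hilbert_Choice.inv w s \<noteq> Hilbert_Choice.inv w (s + 1)"
        using permutes_inj[OF permutes_inv[OF w]] by (metis injD n_not_Suc_n Suc_eq_plus1)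
      then show ?thesis using False that by (meson linorder_neqE_nat)
    qed
    then have "Hilbert_Choice.inv w = id" by (rule permutes_increasing_id[OF permutes_inv[OF w]])
    then have "w = id" using w by (metis inv_id permutes_inv_inv)
    then show ?thesis by (intro exI[of _ "[]"]) (auto simp: is_word_def word_prod_Nil)
  qed
qed

lemma cox_length_eq_card_inversions:
  assumes "w permutes {1..n + 1}"
  shows "cox_length n w = card (inversions n w)"
  unfolding cox_length_def
proof (rule Least_equality)
  obtain u where u: "is_word n u" "word_prod u = w" "length u \<le> card (inversions n w)"
    using exists_short_word[OF assms] by blast
  then show "\<exists>u. is_word n u \<and> word_prod u = w \<and> length u = card (inversions n w)"
    using card_inversions_word_prod[OF u(1)] by (intro exI[of _ u]) auto
qed (use card_inversions_word_prod in blast)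

definition reversal :: "nat \<Rightarrow> nat \<Rightarrow> nat" where
  "reversal n i = (if i \<in> {1..n + 1} then n + 2 - i else i)"

lemma reversal_permutes: "reversal n permutes {1..n + 1}"
  by (rule bij_imp_permutes, rule bij_betwI[of _ _ _ "reversal n"]) (auto simp: reversal_def)

lemma inversions_subset: "inversions n w \<subseteq> inversions n (reversal n)"
  by (auto simp: inversions_def reversal_def)

lemma all_inversions_imp_reversal:
  assumes w: "w permutes {1..n + 1}" and "inversions n w = inversions n (reversal n)"
  shows "w = reversal n"
proof -
  have dec: "w (s + 1) < w s" if "s \<in> {1..n}" for s
  proof -
    have "(s, s + 1) \<in> inversions n (reversal n)" using that by (auto simp: inversions_def reversal_def)
    then show ?thesis using assms(2) by (auto simp: inversions_def)
  qed
  have "reversal n \<circ> w = id"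
  proof (rule permutes_increasing_id[OF permutes_compose[OF w reversal_permutes]])
    fix s assume s: "s \<in> {1..n}"
    then have "w s \<in> {1..n + 1}" "w (s + 1) \<in> {1..n + 1}" using permutes_in_image[OF w] by auto
    then show "(reversal n \<circ> w) s < (reversal n \<circ> w) (s + 1)"
      using dec[OF s] by (auto simp: reversal_def)
  qed
  moreover have "reversal n \<circ> reversal n = id" by (auto simp: reversal_def fun_eq_iff)
  ultimately show ?thesis by (metis comp_assoc comp_id id_comp)
qed

text \<open>Every pair is an inversion of the reversal. A permutation of maximal length must
  therefore have all pairs as inversions, which determines it.\<close>

lemma longest_element_eq: "longest_element n = reversal n"
proof -
  have le: "cox_length n w \<le> cox_length n (reversal n)" if "w permutes {1..n + 1}" for w
    unfolding cox_length_eq_card_inversions[OF that] cox_length_eq_card_inversions[OF reversal_permutes]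
    by (rule card_mono[OF finite_inversions inversions_subset])
  have "is_arg_max (cox_length n) (\<lambda>w. w permutes {1..n + 1}) (longest_element n)"
    unfolding longest_element_def arg_max_def
    by (rule someI[of _ "reversal n"]) (use le reversal_permutes in \<open>auto simp: is_arg_max_linorder\<close>)
  then have w: "longest_element n permutes {1..n + 1}"
    and ge: "cox_length n (reversal n) \<le> cox_length n (longest_element n)"
    using reversal_permutes by (auto simp: is_arg_max_linorder)
  have "inversions n (longest_element n) = inversions n (reversal n)"
    using ge unfolding cox_length_eq_card_inversions[OF w] cox_length_eq_card_inversions[OF reversal_permutes]
    by (rule card_seteq[OF finite_inversions inversions_subset])
  then show ?thesis by (rule all_inversions_imp_reversal[OF w])
qed

section \<open>Executable enumeration of reduced words in rank at most 3\<close>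

lemma word_prod_eqI:
  assumes "is_word n u" "w permutes {1..n + 1}" "map (word_prod u) [1..<n + 2] = map w [1..<n + 2]"
  shows "word_prod u = w"
proof
  fix x
  show "word_prod u x = w x"
  proof (cases "x \<in> {1..n + 1}")
    case True
    then have "x \<in> set [1..<n + 2]" by auto
    then show ?thesis using assms(3) by (metis map_eq_conv)
  next
    case False
    then show ?thesis using assms(1,2) word_prod_permutes by (metis permutes_not_in)
  qed
qed

lemma card_inversions_code: "card (inversions n w) =
    length (filter (\<lambda>(i, j). i < j \<and> w j < w i) (List.product [1..<n + 2] [1..<n + 2]))"
proof -
  have "inversions n w = set (filter (\<lambda>(i, j). i < j \<and> w j < w i) (List.product [1..<n + 2] [1..<n + 2]))"
    by (auto simp: inversions_def)
  then show ?thesis by (simp only: distinct_card[OF distinct_filter[OF distinct_product[OF distinct_upt distinct_upt]]])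
qed

text \<open>Both ingredients can be evaluated: the length is given by counting inversions, and
  equality of permutations is reduced to equality of two lists of values.\<close>

definition reduced_words :: "nat \<Rightarrow> (nat \<Rightarrow> nat) \<Rightarrow> nat list list" where
  "reduced_words n w = filter (\<lambda>u. map (word_prod u) [1..<n + 2] = map w [1..<n + 2])
     (List.n_lists (length (filter (\<lambda>(i, j). i < j \<and> w j < w i) (List.product [1..<n + 2] [1..<n + 2])))
       [1..<n + 1])"

lemma reduced_expression_iff:
  assumes "w permutes {1..n + 1}"
  shows "reduced_expression n u w \<longleftrightarrow> u \<in> set (reduced_words n w)"
proof -
  have "is_word n u \<and> length u = card (inversions n w) \<longleftrightarrow> u \<in> set (List.n_lists (card (inversions n w)) [1..<n + 1])"
    by (auto simp: set_n_lists is_word_def atLeastLessThanSuc_atLeastAtMost)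
  moreover have "word_prod u = w \<longleftrightarrow> map (word_prod u) [1..<n + 2] = map w [1..<n + 2]" if "is_word n u"
    using word_prod_eqI[OF that assms] by metis
  ultimately show ?thesis
    unfolding reduced_expression_def cox_length_eq_card_inversions[OF assms] reduced_words_def
      card_inversions_code[symmetric] set_filter by blast
qed

abbreviation longest_words :: "nat \<Rightarrow> nat list list" where
  "longest_words n \<equiv> reduced_words n (reversal n)"

lemma reduced_expression_longest_iff:
  "reduced_expression n u (longest_element n) \<longleftrightarrow> u \<in> set (longest_words n)"
  unfolding longest_element_eq by (rule reduced_expression_iff[OF reversal_permutes])

lemma reduced_expression_word_prod_iff:
  "is_word n v \<Longrightarrow> reduced_expression n u (word_prod v) \<longleftrightarrow> u \<in> set (reduced_words n (word_prod v))"
  by (rule reduced_expression_iff[OF word_prod_permutes])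

lemma cox_length_longest: "cox_length n (longest_element n) =
    length (filter (\<lambda>(i, j). i < j \<and> reversal n j < reversal n i) (List.product [1..<n + 2] [1..<n + 2]))"
  unfolding longest_element_eq cox_length_eq_card_inversions[OF reversal_permutes] card_inversions_code ..

lemma cox_length_longest_small:
  "cox_length 1 (longest_element 1) = 1" "cox_length 2 (longest_element 2) = 3" "cox_length 3 (longest_element 3) = 6"
  unfolding cox_length_longest by code_simp+

lemma longest_words_small:
  "longest_words 1 = [[1]]"
  "longest_words 2 = [[1,2,1], [2,1,2]]"
  "longest_words 3 = [[1,2,3,1,2,1], [1,2,1,3,2,1], [2,1,2,3,2,1], [2,3,1,2,3,1], [2,1,3,2,3,1],
    [1,2,3,2,1,2], [3,1,2,3,1,2], [1,3,2,3,1,2], [3,1,2,1,3,2], [1,3,2,1,3,2],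
    [3,2,1,2,3,2], [2,3,1,2,1,3], [2,1,3,2,1,3], [2,3,2,1,2,3], [3,2,3,1,2,3], [3,2,1,3,2,3]]"
  by code_simp+

lemma reduced_words_first_letter:
  "reduced_words n (word_prod [1]) = [[1]]" if "n = 1 \<or> n = 2 \<or> n = 3" for n
  using that by (elim disjE; hypsubst) code_simp+

text \<open>These are the products of the restrictions of \<open>c\<close> to supports of roots. A
  second reduced word appears only when the commuting letters 1 and 3 are neighbours in the
  word.\<close>

lemma reduced_words_coxeter:
  "reduced_words 2 (word_prod [2]) = [[2]]"
  "reduced_words 2 (word_prod [1,2]) = [[1,2]]"
  "reduced_words 2 (word_prod [2,1]) = [[2,1]]"
  "reduced_words 3 (word_prod [2]) = [[2]]"
  "reduced_words 3 (word_prod [3]) = [[3]]"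
  "reduced_words 3 (word_prod [1,2]) = [[1,2]]"
  "reduced_words 3 (word_prod [2,1]) = [[2,1]]"
  "reduced_words 3 (word_prod [2,3]) = [[2,3]]"
  "reduced_words 3 (word_prod [3,2]) = [[3,2]]"
  "reduced_words 3 (word_prod [1,2,3]) = [[1,2,3]]"
  "reduced_words 3 (word_prod [1,3,2]) = [[3,1,2],[1,3,2]]"
  "reduced_words 3 (word_prod [3,1,2]) = [[3,1,2],[1,3,2]]"
  "reduced_words 3 (word_prod [2,1,3]) = [[2,3,1],[2,1,3]]"
  "reduced_words 3 (word_prod [2,3,1]) = [[2,3,1],[2,1,3]]"
  "reduced_words 3 (word_prod [3,2,1]) = [[3,2,1]]"
  by code_simp+

text \<open>This is the exchange property for the longest element in a form that can be evaluated.
  The condition \<open>l \<noteq> k\<close> forbids deleting the inserted letter itself; a word of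
  length \<open>length u\<close> has \<open>length u + 1\<close> gaps, and as many letters after the
  insertion.\<close>

definition flip_check :: "nat list list \<Rightarrow> nat \<Rightarrow> bool" where
  "flip_check us n \<longleftrightarrow> (\<forall>u\<in>set us. \<forall>k\<in>set [0..<Suc (length u)]. \<forall>s\<in>set [1..<n + 1].
     \<exists>l\<in>set [0..<Suc (length u)]. l \<noteq> k \<and>
       take l (take k u @ s # drop k u) @ drop (Suc l) (take k u @ s # drop k u) \<in> set us)"

lemma flip_check_longest_words:
  "flip_check (longest_words 1) 1" "flip_check (longest_words 2) 2" "flip_check (longest_words 3) 3"
  unfolding longest_words_small by code_simp+

section \<open>Positions in powers of a Coxeter word\<close>

lemma nths_eq_map_filter: "nths xs A = map ((!) xs) (filter (\<lambda>i. i \<in> A) [0..<length xs])"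
proof -
  have "zip xs [0..<length xs] = map (\<lambda>i. (xs ! i, i)) [0..<length xs]"
    by (rule nth_equalityI) auto
  then show ?thesis by (simp add: nths_def filter_map comp_def)
qed

lemma filter_upt_sorted:
  assumes "sorted_wrt (<) ps" "set ps \<subseteq> {..<r::nat}"
  shows "filter (\<lambda>i. i \<in> set ps) [0..<r] = ps"
proof (rule sorted_distinct_set_unique)
  show "sorted ps" "distinct ps" using assms(1) by (simp_all add: strict_sorted_iff)
qed (use assms(2) in \<open>auto simp: sorted_wrt_filter\<close>)

text \<open>Counting entries range over sets of positions, whereas orders of letters concern
  increasing lists; this translates between the two.\<close>

lemma nths_eq_iff:
  assumes "X \<subseteq> {..<length xs}"
  shows "nths xs X = u \<longleftrightarrow> (\<exists>ps. sorted_wrt (<) ps \<and> set ps = X \<and> map ((!) xs) ps = u)"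
proof
  assume "nths xs X = u"
  then show "\<exists>ps. sorted_wrt (<) ps \<and> set ps = X \<and> map ((!) xs) ps = u"
    using assms unfolding nths_eq_map_filter
    by (intro exI[of _ "filter (\<lambda>i. i \<in> X) [0..<length xs]"]) (auto intro: sorted_wrt_filter)
next
  assume "\<exists>ps. sorted_wrt (<) ps \<and> set ps = X \<and> map ((!) xs) ps = u"
  then show "nths xs X = u" using assms filter_upt_sorted unfolding nths_eq_map_filter by metis
qed

lemma subseq_nthsD:
  assumes "subseq v (nths xs X)"
  shows "\<exists>ps. sorted_wrt (<) ps \<and> set ps \<subseteq> X \<inter> {..<length xs} \<and> map ((!) xs) ps = v"
proof -
  obtain Z where Z: "v = nths (nths xs X) Z" using assms by (auto simp: subseq_conv_nths)
  let ?f = "filter (\<lambda>i. i \<in> X) [0..<length xs]"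
  have "v = map ((!) xs) (nths ?f Z)" unfolding Z nths_eq_map_filter[of xs] nths_map ..
  moreover have "sorted_wrt (<) (nths ?f Z)"
    unfolding strict_sorted_iff by (auto intro!: sorted_nths distinct_nthsI sorted_wrt_filter)
  moreover have "set (nths ?f Z) \<subseteq> set ?f" by (rule set_nths_subset)
  ultimately show ?thesis by (intro exI[of _ "nths ?f Z"]) auto
qed

lemma length_word_power: "length (word_power c m) = m * length c"
  by (simp add: word_power_def length_concat sum_list_replicate)

lemma nth_word_power: "j < m * length c \<Longrightarrow> word_power c m ! j = c ! (j mod length c)"
proof (induction m arbitrary: j)
  case (Suc m)
  then show ?case
    by (cases "j < length c") (auto simp: word_power_def nth_append le_mod_geq)
qed simp

locale coxeter_power =
  fixes n m :: nat and c :: "nat list"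
  assumes c: "coxeter_word n c" and n: "1 \<le> n"
begin

definition idx :: "nat \<Rightarrow> nat" where
  "idx s = (THE i. i < n \<and> c ! i = s)"

definition pos :: "nat \<Rightarrow> nat \<Rightarrow> nat" where
  "pos s k = k * n + idx s"

definition before :: "nat \<Rightarrow> nat \<Rightarrow> bool" where
  "before s t \<longleftrightarrow> idx s < idx t"

abbreviation W :: "nat list" where "W \<equiv> word_power c m"

lemma length_c: "length c = n"
  using c distinct_card[of c] by (simp add: coxeter_word_def)

lemma idx_nth:
  assumes "i < n"
  shows "idx (c ! i) = i"
  unfolding idx_def
proof (rule the_equality)
  fix j assume "j < n \<and> c ! j = c ! i"
  then show "j = i" using assms c length_c nth_eq_iff_index_eq[of c j i] by (simp add: coxeter_word_def)
qed (use assms in simp)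

lemma idx: "s \<in> {1..n} \<Longrightarrow> idx s < n \<and> c ! idx s = s"
  using c idx_nth length_c by (metis coxeter_word_def in_set_conv_nth)

lemma idx_eqD: "\<lbrakk>s \<in> {1..n}; t \<in> {1..n}; idx s = idx t\<rbrakk> \<Longrightarrow> s = t"
  using idx by metis

lemma length_W: "length W = m * n"
  by (simp add: length_word_power length_c)

lemma nth_W: "j < m * n \<Longrightarrow> W ! j = c ! (j mod n)"
  using nth_word_power[of j m c] length_c by simp

lemma letter_W: "j < m * n \<Longrightarrow> W ! j \<in> {1..n}"
proof -
  assume j: "j < m * n"
  have "j mod n < length c" using n length_c by simp
  then have "c ! (j mod n) \<in> set c" by (rule nth_mem)
  then show "W ! j \<in> {1..n}" using nth_W[OF j] c by (simp add: coxeter_word_def)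
qed

lemma pos_less: "s \<in> {1..n} \<Longrightarrow> k < m \<Longrightarrow> pos s k < m * n"
proof -
  assume s: "s \<in> {1..n}" and k: "k < m"
  have "pos s k < (k + 1) * n" using idx[OF s] by (simp add: pos_def)
  also have "\<dots> \<le> m * n" using k by (intro mult_right_mono) auto
  finally show ?thesis .
qed

lemma pos_div: "s \<in> {1..n} \<Longrightarrow> pos s k div n = k"
  using idx[of s] by (simp add: pos_def)

lemma nth_pos: "s \<in> {1..n} \<Longrightarrow> k < m \<Longrightarrow> W ! pos s k = s"
  using nth_W[OF pos_less] idx[of s] by (simp add: pos_def)

lemma pos_letter: "j < m * n \<Longrightarrow> pos (W ! j) (j div n) = j"
  using nth_W[of j] n by (simp add: pos_def idx_nth)

lemma copy_less: "j < m * n \<Longrightarrow> j div n < m"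
  using n by (simp add: less_mult_imp_div_less)

lemma pos_eq_iff: "\<lbrakk>s \<in> {1..n}; t \<in> {1..n}\<rbrakk> \<Longrightarrow> pos s k = pos t l \<longleftrightarrow> s = t \<and> k = l"
  using idx_eqD pos_div by (metis add_left_cancel pos_def)

lemma pos_less_iff:
  assumes "s \<in> {1..n}" "t \<in> {1..n}"
  shows "pos s k < pos t l \<longleftrightarrow> k < l \<or> k = l \<and> before s t"
proof (cases k l rule: linorder_cases)
  case less
  then have "(k + 1) * n \<le> l * n" by (intro mult_right_mono) auto
  then show ?thesis using less idx[OF assms(1)] by (simp add: pos_def)
next
  case greater
  then have "(l + 1) * n \<le> k * n" by (intro mult_right_mono) auto
  then show ?thesis using greater idx[OF assms(2)] by (simp add: pos_def)
qed (simp add: pos_def before_def)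

lemma before_asym: "\<lbrakk>s \<in> {1..n}; t \<in> {1..n}; s \<noteq> t\<rbrakk> \<Longrightarrow> before t s \<longleftrightarrow> \<not> before s t"
  using idx_eqD[of s t] unfolding before_def by linarith

text \<open>For distinct \<open>s\<close> and \<open>t\<close> the two copies are aligned when
  together they spell the restriction of \<open>c\<close> to these letters.\<close>

definition aligned :: "nat \<Rightarrow> nat \<Rightarrow> nat \<Rightarrow> nat \<Rightarrow> bool" where
  "aligned s t k l \<longleftrightarrow> (pos s k < pos t l \<longleftrightarrow> before s t)"

lemma aligned_iff:
  "\<lbrakk>s \<in> {1..n}; t \<in> {1..n}\<rbrakk> \<Longrightarrow> aligned s t k l \<longleftrightarrow> (if before s t then k \<le> l else l \<le> k)"
  by (auto simp: aligned_def pos_less_iff)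

lemma nths_W1:
  assumes "X \<subseteq> {..<m * n}" "s \<in> {1..n}"
  shows "nths W X = [s] \<longleftrightarrow> (\<exists>k<m. X = {pos s k})"
proof -
  have "nths W X = [s] \<longleftrightarrow> (\<exists>ps. sorted_wrt (<) ps \<and> set ps = X \<and> map ((!) W) ps = [s])"
    using assms(1) by (intro nths_eq_iff) (simp add: length_W)
  also have "\<dots> \<longleftrightarrow> (\<exists>p. X = {p} \<and> W ! p = s)"
  proof
    assume "\<exists>p. X = {p} \<and> W ! p = s"
    then obtain p where "X = {p}" "W ! p = s" by blast
    then show "\<exists>ps. sorted_wrt (<) ps \<and> set ps = X \<and> map ((!) W) ps = [s]"
      by (intro exI[of _ "[p]"]) simp
  qed (auto simp: map_eq_Cons_conv)
  also have "\<dots> \<longleftrightarrow> (\<exists>k<m. X = {pos s k})"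
    (is "?l \<longleftrightarrow> ?r")
  proof
    assume ?l
    then obtain p where "X = {p}" "W ! p = s" by blast
    then show ?r using assms(1) pos_letter[of p] copy_less[of p]
      by (intro exI[of _ "p div n"] conjI) auto
  next
    assume ?r
    then show ?l using nth_pos assms(2) by blast
  qed
  finally show ?thesis .
qed

lemma nths_W2:
  assumes "X \<subseteq> {..<m * n}" "s \<in> {1..n}" "t \<in> {1..n}"
  shows "nths W X = [s, t] \<longleftrightarrow> (\<exists>k<m. \<exists>l<m. X = {pos s k, pos t l} \<and> pos s k < pos t l)"
proof -
  have "nths W X = [s, t] \<longleftrightarrow> (\<exists>p q. X = {p, q} \<and> p < q \<and> W ! p = s \<and> W ! q = t)"
    (is "_ \<longleftrightarrow> ?m")
  proof -
    have "nths W X = [s, t] \<longleftrightarrow> (\<exists>ps. sorted_wrt (<) ps \<and> set ps = X \<and> map ((!) W) ps = [s, t])"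
      using assms(1) by (intro nths_eq_iff) (simp add: length_W)
    also have "\<dots> \<longleftrightarrow> ?m"
    proof
      assume ?m
      then obtain p q where "X = {p, q}" "p < q" "W ! p = s" "W ! q = t" by blast
      then show "\<exists>ps. sorted_wrt (<) ps \<and> set ps = X \<and> map ((!) W) ps = [s, t]"
        by (intro exI[of _ "[p, q]"]) simp
    next
      assume "\<exists>ps. sorted_wrt (<) ps \<and> set ps = X \<and> map ((!) W) ps = [s, t]"
      then obtain ps where ps: "sorted_wrt (<) ps" "set ps = X" "map ((!) W) ps = [s, t]" by (elim exE conjE)
      then obtain p q where "ps = [p, q]" by (auto simp: map_eq_Cons_conv)
      then show ?m using ps by (intro exI[of _ p] exI[of _ q]) auto
    qed
    finally show ?thesis .
  qed
  also have "\<dots> \<longleftrightarrow> (\<exists>k<m. \<exists>l<m. X = {pos s k, pos t l} \<and> pos s k < pos t l)"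
    (is "?l \<longleftrightarrow> ?r")
  proof
    assume ?l
    then obtain p q where pq: "X = {p, q}" "p < q" "W ! p = s" "W ! q = t" by blast
    then have "p < m * n" "q < m * n" using assms(1) by auto
    with pq have "pos s (p div n) = p" "pos t (q div n) = q" "p div n < m" "q div n < m"
      using pos_letter copy_less by blast+
    with pq show ?r by metis
  next
    assume ?r
    then show ?l using nth_pos assms by blast
  qed
  finally show ?thesis .
qed

lemma nths_W3:
  assumes "X \<subseteq> {..<m * n}" "s \<in> {1..n}" "t \<in> {1..n}" "u \<in> {1..n}"
  shows "nths W X = [s, t, u] \<longleftrightarrow> (\<exists>k<m. \<exists>l<m. \<exists>h<m. X = {pos s k, pos t l, pos u h} \<and>
    pos s k < pos t l \<and> pos t l < pos u h)"
proof -
  have "nths W X = [s, t, u] \<longleftrightarrow> (\<exists>p q v. X = {p, q, v} \<and> p < q \<and> q < v \<and> W ! p = s \<and> W ! q = t \<and> W ! v = u)"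
    (is "_ \<longleftrightarrow> ?m")
  proof -
    have "nths W X = [s, t, u] \<longleftrightarrow> (\<exists>ps. sorted_wrt (<) ps \<and> set ps = X \<and> map ((!) W) ps = [s, t, u])"
      using assms(1) by (intro nths_eq_iff) (simp add: length_W)
    also have "\<dots> \<longleftrightarrow> ?m"
    proof
      assume ?m
      then obtain p q v where "X = {p, q, v}" "p < q" "q < v" "W ! p = s" "W ! q = t" "W ! v = u" by blast
      then show "\<exists>ps. sorted_wrt (<) ps \<and> set ps = X \<and> map ((!) W) ps = [s, t, u]"
        by (intro exI[of _ "[p, q, v]"]) simp
    next
      assume "\<exists>ps. sorted_wrt (<) ps \<and> set ps = X \<and> map ((!) W) ps = [s, t, u]"
      then obtain ps where ps: "sorted_wrt (<) ps" "set ps = X" "map ((!) W) ps = [s, t, u]" by (elim exE conjE)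
      then obtain p q v where "ps = [p, q, v]" by (auto simp: map_eq_Cons_conv)
      then show ?m using ps by (intro exI[of _ p] exI[of _ q] exI[of _ v]) auto
    qed
    finally show ?thesis .
  qed
  also have "\<dots> \<longleftrightarrow> (\<exists>k<m. \<exists>l<m. \<exists>h<m. X = {pos s k, pos t l, pos u h} \<and> pos s k < pos t l \<and> pos t l < pos u h)"
    (is "?l \<longleftrightarrow> ?r")
  proof
    assume ?l
    then obtain p q v where pq: "X = {p, q, v}" "p < q" "q < v" "W ! p = s" "W ! q = t" "W ! v = u" by blast
    then have "p < m * n" "q < m * n" "v < m * n" using assms(1) by auto
    with pq have "pos s (p div n) = p" "pos t (q div n) = q" "pos u (v div n) = v"
      "p div n < m" "q div n < m" "v div n < m"
      using pos_letter copy_less by blast+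
    with pq show ?r by metis
  next
    assume ?r
    then obtain k l h where "k < m" "l < m" "h < m" "X = {pos s k, pos t l, pos u h}"
      "pos s k < pos t l" "pos t l < pos u h" by blast
    then show ?l using nth_pos assms
      by (intro exI[of _ "pos s k"] exI[of _ "pos t l"] exI[of _ "pos u h"]) simp
  qed
  finally show ?thesis .
qed


section \<open>Counting the occurrences of two and three letters through a given position\<close>

definition partners :: "nat \<Rightarrow> nat \<Rightarrow> nat \<Rightarrow> nat" where
  "partners s t k = (if before s t then m - k else k + 1)"

lemma aligned_sym:
  "\<lbrakk>s \<in> {1..n}; t \<in> {1..n}; s \<noteq> t\<rbrakk> \<Longrightarrow> aligned t s l k \<longleftrightarrow> aligned s t k l"
  using before_asym[of s t] by (simp add: aligned_iff)

lemma card_aligned: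
  assumes "s \<in> {1..n}" "t \<in> {1..n}" "k < m"
  shows "card {l. l < m \<and> aligned s t k l} = partners s t k"
proof -
  \<comment> \<open>The index \<open>k\<close> belongs to either segment, since two letters of the
    same copy of \<open>c\<close> are aligned. This gives \<open>m - k\<close> and
    \<open>k + 1\<close>.\<close>
  have "{l. l < m \<and> aligned s t k l} = (if before s t then {k..<m} else {..k})"
    using assms by (auto simp: aligned_iff)
  then show ?thesis by (simp add: partners_def)
qed

lemma card_nths_W1:
  assumes "s \<in> {1..n}" "j < m * n"
  shows "card {X. X \<subseteq> {..<m * n} \<and> j \<in> X \<and> nths W X = [s]} = (if W ! j = s then 1 else 0)"
proof -
  have "{X. X \<subseteq> {..<m * n} \<and> j \<in> X \<and> nths W X = [s]} = (if W ! j = s then {{j}} else {})"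
  proof (intro equalityI subsetI)
    fix X assume X: "X \<in> {X. X \<subseteq> {..<m * n} \<and> j \<in> X \<and> nths W X = [s]}"
    then obtain k where "k < m" "X = {pos s k}" using nths_W1[OF _ assms(1)] by blast
    with X show "X \<in> (if W ! j = s then {{j}} else {})" using nth_pos[OF assms(1)] by auto
  next
    fix X assume "X \<in> (if W ! j = s then {{j}} else {})"
    then have "W ! j = s" "X = {j}" by (auto split: if_splits)
    then show "X \<in> {X. X \<subseteq> {..<m * n} \<and> j \<in> X \<and> nths W X = [s]}"
      using assms nths_W1[of "{j}" s] pos_letter[of j] copy_less[of j] by auto
  qed
  then show ?thesis by simp
qed

definition pairs :: "nat \<Rightarrow> nat \<Rightarrow> nat set set" where
  "pairs s t = {X. \<exists>k<m. \<exists>l<m. X = {pos s k, pos t l} \<and> aligned s t k l}"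

lemma pairs_sym:
  assumes "s \<in> {1..n}" "t \<in> {1..n}" "s \<noteq> t"
  shows "pairs s t = pairs t s"
  unfolding pairs_def using aligned_sym[OF assms] by (auto simp: insert_commute)

lemma nths_W_pairs:
  assumes "X \<subseteq> {..<m * n}" "s \<in> {1..n}" "t \<in> {1..n}" "s \<noteq> t"
  shows "nths W X = (if before s t then [s, t] else [t, s]) \<longleftrightarrow> X \<in> pairs s t"
proof -
  have *: "nths W X = [s, t] \<longleftrightarrow> X \<in> pairs s t"
    if "before s t" "s \<in> {1..n}" "t \<in> {1..n}" for s t
    unfolding nths_W2[OF assms(1) that(2,3)] pairs_def using that(1) by (simp add: aligned_def)
  show ?thesis
    using *[OF _ assms(2,3)] *[OF _ assms(3,2)] before_asym[OF assms(2-4)] pairs_sym[OF assms(2-4)] by simp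
qed

lemma card_pairs_left:
  assumes s: "s \<in> {1..n}" and t: "t \<in> {1..n}" and st: "s \<noteq> t" and j: "j < m * n" "W ! j = s"
  shows "card {X. j \<in> X \<and> X \<in> pairs s t} = partners s t (j div n)"
proof -
  define k where "k = j div n"
  have k: "k < m" "pos s k = j" using pos_letter[OF j(1)] copy_less[OF j(1)] j(2) by (auto simp: k_def)
  have "{X. j \<in> X \<and> X \<in> pairs s t} = (\<lambda>l. {pos s k, pos t l}) ` {l. l < m \<and> aligned s t k l}"
  proof (intro equalityI subsetI)
    fix X assume "X \<in> {X. j \<in> X \<and> X \<in> pairs s t}"
    then obtain k' l where X: "k' < m" "l < m" "X = {pos s k', pos t l}" "aligned s t k' l" "j \<in> X"
      by (auto simp: pairs_def)
    then have "k' = k" using k(2) pos_eq_iff[OF s s] pos_eq_iff[OF s t] st by auto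
    with X show "X \<in> (\<lambda>l. {pos s k, pos t l}) ` {l. l < m \<and> aligned s t k l}" by blast
  next
    fix X assume "X \<in> (\<lambda>l. {pos s k, pos t l}) ` {l. l < m \<and> aligned s t k l}"
    then show "X \<in> {X. j \<in> X \<and> X \<in> pairs s t}" using k by (auto simp: pairs_def)
  qed
  moreover have "inj_on (\<lambda>l. {pos s k, pos t l}) {l. l < m \<and> aligned s t k l}"
    by (rule inj_onI) (auto simp: doubleton_eq_iff pos_eq_iff[OF t t] pos_eq_iff[OF s t] st)
  ultimately show ?thesis using card_aligned[OF s t k(1)] by (simp add: card_image k_def)
qed

lemma card_pairs:
  assumes "s \<in> {1..n}" "t \<in> {1..n}" "s \<noteq> t" "j < m * n"
  shows "card {X. j \<in> X \<and> X \<in> pairs s t} =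
    (if W ! j = s then partners s t (j div n) else if W ! j = t then partners t s (j div n) else 0)"
proof -
  have "card {X. j \<in> X \<and> X \<in> pairs s t} = 0" if "W ! j \<noteq> s" "W ! j \<noteq> t"
  proof -
    have "{X. j \<in> X \<and> X \<in> pairs s t} = {}" using nth_pos assms that by (auto simp: pairs_def)
    then show ?thesis by (simp only: card.empty)
  qed
  then show ?thesis
    using card_pairs_left[of s t j] card_pairs_left[of t s j] assms pairs_sym[OF assms(1-3)]
    by (cases "W ! j = s"; cases "W ! j = t") simp_all
qed

text \<open>Here \<open>t\<close> is the middle node of the diagram. No order is imposed between
  \<open>s\<close> and \<open>u\<close>: they will be the commuting letters 1 and 3, so both orders
  spell the same element.\<close>

definition triples :: "nat \<Rightarrow> nat \<Rightarrow> nat \<Rightarrow> nat set set" where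
  "triples s t u = {X. \<exists>k<m. \<exists>l<m. \<exists>h<m. X = {pos s k, pos t l, pos u h} \<and> aligned s t k l \<and> aligned u t h l}"

lemma triples_sym: "triples s t u = triples u t s"
proof -
  have "triples s t u \<subseteq> triples u t s" for s t u
  proof
    fix X assume "X \<in> triples s t u"
    then obtain k l h where "k < m" "l < m" "h < m" "X = {pos s k, pos t l, pos u h}"
      "aligned s t k l" "aligned u t h l" by (auto simp: triples_def)
    moreover from this have "X = {pos u h, pos t l, pos s k}" by auto
    ultimately show "X \<in> triples u t s" unfolding triples_def by blast
  qed
  then show ?thesis by blast
qed

lemma triple_pos_inj:
  assumes "s \<in> {1..n}" "t \<in> {1..n}" "u \<in> {1..n}" "distinct [s, t, u]"
    and eq: "{pos s k, pos t l, pos u h} = {pos s k', pos t l', pos u h'}"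
  shows "k = k' \<and> l = l' \<and> h = h'"
proof -
  have "pos s k \<in> {pos s k', pos t l', pos u h'}" "pos t l \<in> {pos s k', pos t l', pos u h'}"
    "pos u h \<in> {pos s k', pos t l', pos u h'}" using eq by auto
  then show ?thesis using assms(1-4) by (auto simp: pos_eq_iff)
qed

text \<open>Once the copy of the middle letter is fixed, the two outer copies are chosen
  independently; hence a product.\<close>

lemma card_triples_middle:
  assumes s: "s \<in> {1..n}" and t: "t \<in> {1..n}" and u: "u \<in> {1..n}" and dist: "distinct [s, t, u]"
    and j: "j < m * n" "W ! j = t"
  shows "card {X. j \<in> X \<and> X \<in> triples s t u} = partners t s (j div n) * partners t u (j div n)"
proof -
  define l where "l = j div n"
  have l: "l < m" "pos t l = j" using pos_letter[OF j(1)] copy_less[OF j(1)] j(2) by (auto simp: l_def)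
  let ?S = "{k. k < m \<and> aligned t s l k} \<times> {h. h < m \<and> aligned t u l h}"
  let ?f = "\<lambda>(k, h). {pos s k, pos t l, pos u h}"
  have sym: "aligned t s l k \<longleftrightarrow> aligned s t k l" "aligned t u l k \<longleftrightarrow> aligned u t k l" for k
    using aligned_sym s t u dist by auto
  have "{X. j \<in> X \<and> X \<in> triples s t u} = ?f ` ?S"
  proof (intro equalityI subsetI)
    fix X assume "X \<in> {X. j \<in> X \<and> X \<in> triples s t u}"
    then obtain k l' h where X: "k < m" "l' < m" "h < m" "X = {pos s k, pos t l', pos u h}"
      "aligned s t k l'" "aligned u t h l'" "j \<in> X"
      by (auto simp: triples_def)
    then have "l' = l" using l(2) pos_eq_iff s t u dist by auto
    with X have "X = ?f (k, h)" "(k, h) \<in> ?S" using sym by auto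
    then show "X \<in> ?f ` ?S" by (rule image_eqI)
  next
    fix X assume "X \<in> ?f ` ?S"
    then show "X \<in> {X. j \<in> X \<and> X \<in> triples s t u}" using l sym by (auto simp: triples_def)
  qed
  moreover have "inj_on ?f ?S"
    using triple_pos_inj[OF s t u dist] by (intro inj_onI) (auto split: prod.splits)
  ultimately show ?thesis
    using card_aligned[OF t s l(1)] card_aligned[OF t u l(1)]
    by (simp add: card_image card_cartesian_product l_def)
qed

text \<open>Choose the middle copy first. The number of copies of the far letter depends on it
  alone; hence a sum over the middle copies.\<close>

lemma card_triples_end:
  assumes s: "s \<in> {1..n}" and t: "t \<in> {1..n}" and u: "u \<in> {1..n}" and dist: "distinct [s, t, u]"
    and j: "j < m * n" "W ! j = s"
  shows "card {X. j \<in> X \<and> X \<in> triples s t u} = (\<Sum>l | l < m \<and> aligned s t (j div n) l. partners t u l)"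
proof -
  define k where "k = j div n"
  have k: "k < m" "pos s k = j" using pos_letter[OF j(1)] copy_less[OF j(1)] j(2) by (auto simp: k_def)
  let ?S = "SIGMA l:{l. l < m \<and> aligned s t k l}. {h. h < m \<and> aligned t u l h}"
  let ?f = "\<lambda>(l, h). {pos s k, pos t l, pos u h}"
  have sym: "aligned t u l h \<longleftrightarrow> aligned u t h l" for l h
    using aligned_sym t u dist by auto
  have "{X. j \<in> X \<and> X \<in> triples s t u} = ?f ` ?S"
  proof (intro equalityI subsetI)
    fix X assume "X \<in> {X. j \<in> X \<and> X \<in> triples s t u}"
    then obtain k' l h where X: "k' < m" "l < m" "h < m" "X = {pos s k', pos t l, pos u h}"
      "aligned s t k' l" "aligned u t h l" "j \<in> X"
      by (auto simp: triples_def)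
    then have "k' = k" using k(2) pos_eq_iff s t u dist by auto
    with X have "X = ?f (l, h)" "(l, h) \<in> ?S" using sym by auto
    then show "X \<in> ?f ` ?S" by (rule image_eqI)
  next
    fix X assume "X \<in> ?f ` ?S"
    then show "X \<in> {X. j \<in> X \<and> X \<in> triples s t u}" using k sym by (auto simp: triples_def)
  qed
  moreover have "inj_on ?f ?S"
    using triple_pos_inj[OF s t u dist] by (intro inj_onI) (auto split: prod.splits)
  ultimately have "card {X. j \<in> X \<and> X \<in> triples s t u} = card ?S" by (simp add: card_image)
  also have "\<dots> = (\<Sum>l | l < m \<and> aligned s t k l. partners t u l)"
    by (subst card_SigmaI) (auto intro!: sum.cong card_aligned t u)
  finally show ?thesis by (simp add: k_def)
qed

text \<open>With these times the rows of the counting matrix are polynomials in the time of a position, and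
  adjacent letters occur in the order of their times.\<close>

definition time :: "nat \<Rightarrow> nat \<Rightarrow> real" where
  "time s k = (if s = 2 then k + 1 / 2 else if before s 2 then k else k + 1)"

text \<open>\<open>slope s\<close> and \<open>offset s\<close> are the coefficients of the number of
  copies of an outer letter \<open>s\<close> aligned with a copy of the letter 2, as a function of
  the time of the latter.\<close>

definition slope :: "nat \<Rightarrow> real" where
  "slope s = (if before s 2 then 1 else -1)"

definition offset :: "nat \<Rightarrow> real" where
  "offset s = (if before s 2 then 1 / 2 else m + 1 / 2)"

lemma time_less:
  assumes "s \<in> {1..n}" "2 \<in> {1..n}" "s \<noteq> 2"
  shows "pos s k < pos 2 l \<Longrightarrow> time s k < time 2 l" "pos 2 l < pos s k \<Longrightarrow> time 2 l < time s k"
  using assms before_asym[of s 2] by (auto simp: pos_less_iff time_def)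

lemma real_partners_two:
  assumes "s \<in> {1..n}" "2 \<in> {1..n}" "s \<noteq> 2" "k < m"
  shows "real (partners 2 s k) = slope s * time 2 k + offset s"
  using assms before_asym[of s 2] by (auto simp: partners_def slope_def offset_def time_def of_nat_diff)

lemma real_partners_end:
  assumes "s \<noteq> 2" "k < m"
  shows "real (partners s 2 k) = (if before s 2 then m else 0) - slope s * time s k"
  using assms by (auto simp: partners_def slope_def time_def of_nat_diff)

text \<open>The midpoint rule is exact for linear functions: the sum over the half-integers below
  \<open>k\<close> is the integral from 0 to \<open>k\<close>. This is the reason for the
  \<open>1 / 2\<close> in the times of the letter 2.\<close>

lemma sum_odd: "(\<Sum>l<k. a * (real l + 1 / 2) + b) = a / 2 * (real k)^2 + b * real k"
  by (induction k) (auto simp: field_simps power2_eq_square)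

text \<open>The copies aligned with copy \<open>k\<close> of \<open>s\<close> are those from
  \<open>k\<close> on or those up to \<open>k\<close>, so the integral runs from \<open>k\<close> to
  \<open>m\<close> or from 0 to \<open>k + 1\<close>. Its moving endpoint is
  \<open>time s k\<close>, which explains the two values of that time.\<close>

lemma real_sum_partners:
  assumes s: "s \<in> {1..n}" "s \<noteq> 2" and u: "u \<in> {1..n}" "u \<noteq> 2" and two: "2 \<in> {1..n}" and k: "k < m"
  shows "real (\<Sum>l | l < m \<and> aligned s 2 k l. partners 2 u l) =
    (if before s 2 then slope u / 2 * (real m)^2 + offset u * real m else 0) -
    slope s * (slope u / 2 * (time s k)^2 + offset u * time s k)"
proof -
  define G where "G k = slope u / 2 * (real k)^2 + offset u * real k" for k
  have G: "(\<Sum>l<k. real (partners 2 u l)) = G k" if "k \<le> m" for k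
  proof -
    have "(\<Sum>l<k. real (partners 2 u l)) = (\<Sum>l<k. slope u * (real l + 1 / 2) + offset u)"
      using that real_partners_two[OF u(1) two u(2)] by (intro sum.cong) (auto simp: time_def)
    then show ?thesis unfolding sum_odd G_def .
  qed
  show ?thesis
  proof (cases "before s 2")
    case True
    have "{l. l < m \<and> aligned s 2 k l} = {..<m} - {..<k}" using s two True by (auto simp: aligned_iff)
    then have "real (\<Sum>l | l < m \<and> aligned s 2 k l. partners 2 u l) = (\<Sum>l\<in>{..<m} - {..<k}. real (partners 2 u l))"
      by simp
    also have "\<dots> = G m - G k" using k by (subst sum_diff) (auto simp: G)
    finally show ?thesis using True s by (simp add: G_def slope_def time_def)
  next
    case False
    have "{l. l < m \<and> aligned s 2 k l} = {..<Suc k}" using s two False k by (auto simp: aligned_iff)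
    then have "real (\<Sum>l | l < m \<and> aligned s 2 k l. partners 2 u l) = G (Suc k)"
      using G[of "Suc k"] k by simp
    then show ?thesis using False s by (simp add: G_def slope_def time_def add.commute)
  qed
qed

end

section \<open>Positive roots as intervals, and the Coxeter words of rank at most 3\<close>

definition interval_root :: "nat \<Rightarrow> nat \<Rightarrow> nat \<Rightarrow> int" where
  "interval_root i j = (\<lambda>k. \<Sum>l = i..j. simple_root l k)"

lemma interval_root_apply: "interval_root i j k = (if k \<in> {i..j} then 1 else 0)"
  by (simp add: interval_root_def simple_root_def)

lemma interval_root_eq_iff:
  "i \<le> j \<Longrightarrow> i' \<le> j' \<Longrightarrow> interval_root i j = interval_root i' j' \<longleftrightarrow> i = i' \<and> j = j'"
proof
  assume le: "i \<le> j" "i' \<le> j'" and "interval_root i j = interval_root i' j'"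
  then have "k \<in> {i..j} \<longleftrightarrow> k \<in> {i'..j'}" for k by (metis interval_root_apply zero_neq_one)
  then have "{i..j} = {i'..j'}" by blast
  then show "i = i' \<and> j = j'" using le by (simp add: Icc_eq_Icc)
qed auto

lemma root_support_interval: "\<lbrakk>1 \<le> i; j \<le> n\<rbrakk> \<Longrightarrow> root_support n (interval_root i j) = {i..j}"
  by (auto simp: root_support_def interval_root_apply)

lemma positive_roots_interval: "positive_roots n = {interval_root i j | i j. 1 \<le> i \<and> i \<le> j \<and> j \<le> n}"
  by (simp add: positive_roots_def interval_root_def)

lemma positive_roots_image:
  "positive_roots n = (\<lambda>(i, j). interval_root i j) ` {(i, j). 1 \<le> i \<and> i \<le> j \<and> j \<le> n}"
  unfolding positive_roots_interval by auto

lemma sum_positive_roots: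
  "(\<Sum>\<alpha>\<in>positive_roots n. f \<alpha>) = (\<Sum>(i, j)\<in>{(i, j). 1 \<le> i \<and> i \<le> j \<and> j \<le> n}. f (interval_root i j))"
proof -
  have "inj_on (\<lambda>(i, j). interval_root i j) {(i, j). 1 \<le> i \<and> i \<le> j \<and> j \<le> n}"
    by (rule inj_onI) (auto simp: interval_root_eq_iff)
  then show ?thesis unfolding positive_roots_image by (simp add: sum.reindex case_prod_unfold)
qed

lemma card_positive_roots: "card (positive_roots n) = card {(i, j). 1 \<le> i \<and> i \<le> j \<and> j \<le> n}"
  unfolding positive_roots_image by (rule card_image, rule inj_onI) (auto simp: interval_root_eq_iff)

lemma intervals_small:
  "{(i, j). 1 \<le> i \<and> i \<le> j \<and> j \<le> (1::nat)} = {(1, 1)}"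
  "{(i, j). 1 \<le> i \<and> i \<le> j \<and> j \<le> (2::nat)} = {(1, 1), (2, 2), (1, 2)}"
  "{(i, j). 1 \<le> i \<and> i \<le> j \<and> j \<le> (3::nat)} = {(1, 1), (2, 2), (3, 3), (1, 2), (2, 3), (1, 3)}"
  by auto

lemma coxeter_words_small:
  "coxeter_word 1 c \<Longrightarrow> c = [1]"
  "coxeter_word 2 c \<Longrightarrow> c = [1, 2] \<or> c = [2, 1]"
  "coxeter_word 3 c \<Longrightarrow> c = [1, 2, 3] \<or> c = [1, 3, 2] \<or> c = [3, 1, 2] \<or> c = [2, 1, 3] \<or> c = [2, 3, 1] \<or> c = [3, 2, 1]"
proof -
  have len: "length c = n" if "coxeter_word n c" for n
    using that distinct_card[of c] by (simp add: coxeter_word_def)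
  show "c = [1]" if c: "coxeter_word 1 c"
  proof -
    obtain x where "c = [x]" using len[OF c] by (metis One_nat_def length_0_conv length_Suc_conv)
    then show ?thesis using c by (simp add: coxeter_word_def)
  qed
  show "c = [1, 2] \<or> c = [2, 1]" if c: "coxeter_word 2 c"
  proof -
    obtain x y where xy: "c = [x, y]" using len[OF c] by (auto simp: length_Suc_conv numeral_2_eq_2)
    have "{1..2} = {1, 2::nat}" by auto
    then show ?thesis using c unfolding xy by (auto simp: coxeter_word_def doubleton_eq_iff)
  qed
  show "c = [1, 2, 3] \<or> c = [1, 3, 2] \<or> c = [3, 1, 2] \<or> c = [2, 1, 3] \<or> c = [2, 3, 1] \<or> c = [3, 2, 1]"
    if c: "coxeter_word 3 c"
  proof -
    obtain x y z where xyz: "c = [x, y, z]" using len[OF c] by (auto simp: length_Suc_conv numeral_3_eq_3)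
    have "{1..3} = {1, 2, 3::nat}" by auto
    then have "x \<in> {1, 2, 3}" "y \<in> {1, 2, 3}" "z \<in> {1, 2, 3}" "distinct [x, y, z]"
      using c unfolding xyz by (auto simp: coxeter_word_def)
    then show ?thesis unfolding xyz by auto
  qed
qed

section \<open>Row combinations of the counting matrix as polynomials in the time\<close>

context coxeter_power
begin

lemma counting_entry_eq:
  "counting_entry n c m \<alpha> j = card {X. X \<subseteq> {..<m * n} \<and> j \<in> X \<and>
     nths W X \<in> set (reduced_words n (word_prod (cox_restrict n c \<alpha>)))}"
proof -
  have w: "is_word n (cox_restrict n c \<alpha>)"
  proof -
    have "set (cox_restrict n c \<alpha>) \<subseteq> set c" unfolding cox_restrict_def by (rule filter_is_subset)
    also have "set c = {1..n}" using c unfolding coxeter_word_def by (rule conjunct2)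
    finally show ?thesis unfolding is_word_def .
  qed
  show ?thesis
    unfolding counting_entry_def length_W reduced_expression_word_prod_iff[OF w] ..
qed

lemma counting_entry_single:
  assumes "cox_restrict n c \<alpha> = [s]" "set (reduced_words n (word_prod [s])) = {[s]}" "s \<in> {1..n}" "j < m * n"
  shows "counting_entry n c m \<alpha> j = (if W ! j = s then 1 else 0)"
  unfolding counting_entry_eq assms(1,2) singleton_iff by (rule card_nths_W1[OF assms(3,4)])

lemma pairs_subset: "X \<in> pairs s t \<Longrightarrow> s \<in> {1..n} \<Longrightarrow> t \<in> {1..n} \<Longrightarrow> X \<subseteq> {..<m * n}"
  using pos_less by (auto simp: pairs_def)

lemma triples_subset:
  "X \<in> triples s t u \<Longrightarrow> s \<in> {1..n} \<Longrightarrow> t \<in> {1..n} \<Longrightarrow> u \<in> {1..n} \<Longrightarrow> X \<subseteq> {..<m * n}"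
  using pos_less by (auto simp: triples_def)

lemma counting_entry_pair:
  assumes v: "v = (if before s t then [s, t] else [t, s])"
    and \<alpha>: "cox_restrict n c \<alpha> = v" "set (reduced_words n (word_prod v)) = {v}"
    and st: "s \<in> {1..n}" "t \<in> {1..n}" "s \<noteq> t" and j: "j < m * n"
  shows "counting_entry n c m \<alpha> j =
    (if W ! j = s then partners s t (j div n) else if W ! j = t then partners t s (j div n) else 0)"
proof -
  have "{X. X \<subseteq> {..<m * n} \<and> j \<in> X \<and> nths W X \<in> {v}} = {X. j \<in> X \<and> X \<in> pairs s t}"
    using nths_W_pairs[OF _ st] pairs_subset[OF _ st(1,2)] unfolding v singleton_iff by blast
  then show ?thesis unfolding counting_entry_eq \<alpha> using card_pairs[OF st j] by simp
qed

lemma triples_iff: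
  assumes "1 \<in> {1..n}" "2 \<in> {1..n}" "3 \<in> {1..n}"
  shows "X \<in> triples 1 2 3 \<longleftrightarrow> (\<exists>k<m. \<exists>l<m. \<exists>h<m. X = {pos 1 k, pos 2 l, pos 3 h} \<and>
    (if before 1 2 then pos 1 k < pos 2 l else pos 2 l < pos 1 k) \<and>
    (if before 3 2 then pos 3 h < pos 2 l else pos 2 l < pos 3 h))"
proof -
  have "aligned s 2 k l \<longleftrightarrow> (if before s 2 then pos s k < pos 2 l else pos 2 l < pos s k)"
    if "s \<in> {1..n}" "s \<noteq> 2" for s k l
    using pos_eq_iff[OF that(1) assms(2), of k l] that(2) by (auto simp: aligned_def)
  then show ?thesis unfolding triples_def using assms by simp
qed

text \<open>When 1 and 3 lie on the same side of 2 in \<open>c\<close>, their copies may come in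
  either order, which accounts for the two words. Copies of different letters have different
  positions, so one of the two orders always holds.\<close>

lemma nths_W_triples:
  assumes X: "X \<subseteq> {..<m * n}" and n: "1 \<in> {1..n}" "2 \<in> {1..n}" "3 \<in> {1..n}"
  shows "nths W X \<in> (if before 1 2 then if before 3 2 then {[3,1,2], [1,3,2]} else {[1,2,3]}
      else if before 3 2 then {[3,2,1]} else {[2,3,1], [2,1,3]}) \<longleftrightarrow> X \<in> triples 1 2 3"
    (is "?l \<longleftrightarrow> ?r")
proof -
  note W3 = nths_W3[OF X]
  have ne: "pos 1 k \<noteq> pos 3 h" for k h using pos_eq_iff[OF n(1,3)] by simp
  have perm: "{a, b, d} = {b, a, d}" "{a, b, d} = {a, d, b}" for a b d :: nat by auto
  consider "before 1 2" "before 3 2" | "before 1 2" "\<not> before 3 2" | "\<not> before 1 2" "before 3 2"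
    | "\<not> before 1 2" "\<not> before 3 2" by blast
  then show ?thesis
  proof cases
    case 1
    have "?l \<longleftrightarrow> (\<exists>k<m. \<exists>l<m. \<exists>h<m. X = {pos 1 k, pos 2 l, pos 3 h} \<and> pos 1 k < pos 2 l \<and> pos 3 h < pos 2 l)"
      (is "_ \<longleftrightarrow> ?m")
    proof
      assume ?l
      then consider "nths W X = [3,1,2]" | "nths W X = [1,3,2]" using 1 by auto
      then show ?m
      proof cases
        case 1
        then obtain h k l where *: "h < m" "k < m" "l < m" "X = {pos 3 h, pos 1 k, pos 2 l}"
          "pos 3 h < pos 1 k" "pos 1 k < pos 2 l" unfolding W3[OF n(3,1,2)] by blast
        then have "X = {pos 1 k, pos 2 l, pos 3 h}" "pos 3 h < pos 2 l" by auto
        with * show ?m by blast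
      next
        case 2
        then obtain k h l where *: "k < m" "h < m" "l < m" "X = {pos 1 k, pos 3 h, pos 2 l}"
          "pos 1 k < pos 3 h" "pos 3 h < pos 2 l" unfolding W3[OF n(1,3,2)] by blast
        then have "X = {pos 1 k, pos 2 l, pos 3 h}" "pos 1 k < pos 2 l" by auto
        with * show ?m by blast
      qed
    next
      assume ?m
      then obtain k l h where *: "k < m" "l < m" "h < m" "X = {pos 1 k, pos 2 l, pos 3 h}"
        "pos 1 k < pos 2 l" "pos 3 h < pos 2 l" by blast
      then have "X = {pos 1 k, pos 3 h, pos 2 l}" "X = {pos 3 h, pos 1 k, pos 2 l}" by auto
      moreover have "pos 1 k < pos 3 h \<or> pos 3 h < pos 1 k" using ne[of k h] by linarith
      ultimately have "nths W X = [3,1,2] \<or> nths W X = [1,3,2]"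
        unfolding W3[OF n(3,1,2)] W3[OF n(1,3,2)] using * by blast
      then show ?l using 1 by auto
    qed
    then show ?thesis unfolding triples_iff[OF n] using 1 by simp
  next
    case 2
    then show ?thesis unfolding triples_iff[OF n] using W3[OF n] by simp
  next
    case 3
    have "?l \<longleftrightarrow> (\<exists>h<m. \<exists>l<m. \<exists>k<m. X = {pos 3 h, pos 2 l, pos 1 k} \<and> pos 3 h < pos 2 l \<and> pos 2 l < pos 1 k)"
      using 3 W3[OF n(3,2,1)] by simp
    also have "\<dots> \<longleftrightarrow> (\<exists>k<m. \<exists>l<m. \<exists>h<m. X = {pos 1 k, pos 2 l, pos 3 h} \<and> pos 2 l < pos 1 k \<and> pos 3 h < pos 2 l)"
      by (metis perm)
    finally show ?thesis unfolding triples_iff[OF n] using 3 by simp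
  next
    case 4
    have "?l \<longleftrightarrow> (\<exists>k<m. \<exists>l<m. \<exists>h<m. X = {pos 1 k, pos 2 l, pos 3 h} \<and> pos 2 l < pos 1 k \<and> pos 2 l < pos 3 h)"
      (is "_ \<longleftrightarrow> ?m")
    proof
      assume ?l
      then consider "nths W X = [2,3,1]" | "nths W X = [2,1,3]" using 4 by auto
      then show ?m
      proof cases
        case 1
        then obtain l h k where *: "l < m" "h < m" "k < m" "X = {pos 2 l, pos 3 h, pos 1 k}"
          "pos 2 l < pos 3 h" "pos 3 h < pos 1 k" unfolding W3[OF n(2,3,1)] by blast
        then have "X = {pos 1 k, pos 2 l, pos 3 h}" "pos 2 l < pos 1 k" by auto
        with * show ?m by blast
      next
        case 2
        then obtain l k h where *: "l < m" "k < m" "h < m" "X = {pos 2 l, pos 1 k, pos 3 h}"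
          "pos 2 l < pos 1 k" "pos 1 k < pos 3 h" unfolding W3[OF n(2,1,3)] by blast
        then have "X = {pos 1 k, pos 2 l, pos 3 h}" "pos 2 l < pos 3 h" by auto
        with * show ?m by blast
      qed
    next
      assume ?m
      then obtain k l h where *: "k < m" "l < m" "h < m" "X = {pos 1 k, pos 2 l, pos 3 h}"
        "pos 2 l < pos 1 k" "pos 2 l < pos 3 h" by blast
      then have "X = {pos 2 l, pos 1 k, pos 3 h}" "X = {pos 2 l, pos 3 h, pos 1 k}" by auto
      moreover have "pos 1 k < pos 3 h \<or> pos 3 h < pos 1 k" using ne[of k h] by linarith
      ultimately have "nths W X = [2,3,1] \<or> nths W X = [2,1,3]"
        unfolding W3[OF n(2,3,1)] W3[OF n(2,1,3)] using * by blast
      then show ?l using 4 by auto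
    qed
    then show ?thesis unfolding triples_iff[OF n] using 4 by simp
  qed
qed

definition letter_times :: "nat set \<Rightarrow> nat \<Rightarrow> real set" where
  "letter_times X s = {time s (j div n) | j. j \<in> X \<and> W ! j = s}"

text \<open>Coefficients are attached to roots instead of row indices, which makes the expression
  independent of the enumeration of the roots.\<close>

definition rootsum :: "((nat \<Rightarrow> int) \<Rightarrow> real) \<Rightarrow> nat \<Rightarrow> real" where
  "rootsum \<Lambda> j = (\<Sum>\<alpha>\<in>positive_roots n. \<Lambda> \<alpha> * real (counting_entry n c m \<alpha> j))"

lemma rootsum_intervals:
  "rootsum \<Lambda> j = (\<Sum>(i, k)\<in>{(i, k). 1 \<le> i \<and> i \<le> k \<and> k \<le> n}.
     \<Lambda> (interval_root i k) * real (counting_entry n c m (interval_root i k) j))"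
  by (simp add: rootsum_def sum_positive_roots)

lemma before_nth: "i < n \<Longrightarrow> j < n \<Longrightarrow> before (c ! i) (c ! j) \<longleftrightarrow> i < j"
  by (simp add: before_def idx_nth)

lemma rootsum1:
  assumes n1: "n = 1" and j: "j < m * n"
  shows "rootsum \<Lambda> j = \<Lambda> (interval_root 1 1)"
proof -
  have c1: "c = [1]" using c n1 coxeter_words_small by simp
  have "cox_restrict n c (interval_root 1 1) = [1]"
    by (simp add: cox_restrict_def n1 c1 root_support_interval)
  then have "counting_entry n c m (interval_root 1 1) j = (if W ! j = 1 then 1 else 0)"
    using reduced_words_first_letter[of n] j n1 by (intro counting_entry_single) auto
  moreover have "W ! j = 1" using letter_W[OF j] n1 by simp
  moreover have "{(i, k). 1 \<le> i \<and> i \<le> k \<and> k \<le> n} = {(1, 1)}" unfolding n1 intervals_small ..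
  ultimately show ?thesis unfolding rootsum_intervals by simp
qed

lemma restrict_cases2:
  assumes n2: "n = 2"
  shows "cox_restrict n c (interval_root 1 1) = [1]" "cox_restrict n c (interval_root 2 2) = [2]"
    "cox_restrict n c (interval_root 1 2) = (if before 1 2 then [1, 2] else [2, 1])"
proof -
  have "c = [1, 2] \<or> c = [2, 1]" using c n2 coxeter_words_small by simp
  moreover have "before 1 2" if "c = [1, 2]"
  proof -
    have "c ! 0 = 1" "c ! 1 = 2" using that by simp_all
    then show ?thesis using before_nth[of 0 1] n2 by simp
  qed
  moreover have "\<not> before 1 2" if "c = [2, 1]"
  proof -
    have "c ! 0 = 2" "c ! 1 = 1" using that by simp_all
    then show ?thesis using before_nth[of 1 0] n2 by simp
  qed
  ultimately show "cox_restrict n c (interval_root 1 1) = [1]" "cox_restrict n c (interval_root 2 2) = [2]"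
    "cox_restrict n c (interval_root 1 2) = (if before 1 2 then [1, 2] else [2, 1])"
    by (auto simp: cox_restrict_def n2 root_support_interval)
qed

lemma rootsum2:
  assumes n2: "n = 2" and j: "j < m * n"
  shows "W ! j = 1 \<Longrightarrow> rootsum \<Lambda> j = \<Lambda> (interval_root 1 1) +
      \<Lambda> (interval_root 1 2) * ((if before 1 2 then m else 0) - slope 1 * time 1 (j div n))"
    "W ! j = 2 \<Longrightarrow> rootsum \<Lambda> j = \<Lambda> (interval_root 2 2) +
      \<Lambda> (interval_root 1 2) * (slope 1 * time 2 (j div n) + offset 1)"
proof -
  have k: "j div n < m" using copy_less[OF j] .
  have in2: "1 \<in> {1..n}" "2 \<in> {1..n}" using n2 by auto
  have e1: "counting_entry n c m (interval_root 1 1) j = (if W ! j = 1 then 1 else 0)"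
    using restrict_cases2[OF n2] reduced_words_first_letter[of n] j n2 in2 by (intro counting_entry_single) auto
  have e2: "counting_entry n c m (interval_root 2 2) j = (if W ! j = 2 then 1 else 0)"
    using restrict_cases2[OF n2] reduced_words_coxeter j n2 in2 by (intro counting_entry_single) auto
  have e12: "counting_entry n c m (interval_root 1 2) j =
    (if W ! j = 1 then partners 1 2 (j div n) else if W ! j = 2 then partners 2 1 (j div n) else 0)"
    using restrict_cases2[OF n2] reduced_words_coxeter j n2 in2
    by (intro counting_entry_pair[OF refl]) auto
  have sum: "rootsum \<Lambda> j = \<Lambda> (interval_root 1 1) * real (counting_entry n c m (interval_root 1 1) j) +
    \<Lambda> (interval_root 2 2) * real (counting_entry n c m (interval_root 2 2) j) +
    \<Lambda> (interval_root 1 2) * real (counting_entry n c m (interval_root 1 2) j)"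
  proof -
    have "{(i, k). 1 \<le> i \<and> i \<le> k \<and> k \<le> n} = {(1, 1), (2, 2), (1, 2)}" unfolding n2 intervals_small ..
    then show ?thesis unfolding rootsum_intervals by simp
  qed
  show "rootsum \<Lambda> j = \<Lambda> (interval_root 1 1) +
      \<Lambda> (interval_root 1 2) * ((if before 1 2 then m else 0) - slope 1 * time 1 (j div n))" if "W ! j = 1"
    unfolding sum e1 e2 e12 using that real_partners_end[of 1 "j div n"] k by simp
  show "rootsum \<Lambda> j = \<Lambda> (interval_root 2 2) +
      \<Lambda> (interval_root 1 2) * (slope 1 * time 2 (j div n) + offset 1)" if "W ! j = 2"
    unfolding sum e1 e2 e12 using that real_partners_two[OF in2, of "j div n"] k by simp
qed

lemma restrict_cases3:
  assumes n3: "n = 3"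
  shows "cox_restrict n c (interval_root 1 1) = [1]" "cox_restrict n c (interval_root 2 2) = [2]"
    "cox_restrict n c (interval_root 3 3) = [3]"
    "cox_restrict n c (interval_root 1 2) = (if before 1 2 then [1, 2] else [2, 1])"
    "cox_restrict n c (interval_root 2 3) = (if before 3 2 then [3, 2] else [2, 3])"
    "set (reduced_words n (word_prod (cox_restrict n c (interval_root 1 3)))) =
      (if before 1 2 then if before 3 2 then {[3,1,2], [1,3,2]} else {[1,2,3]}
        else if before 3 2 then {[3,2,1]} else {[2,3,1], [2,1,3]})"
proof -
  have c3: "c = [1, 2, 3] \<or> c = [1, 3, 2] \<or> c = [3, 1, 2] \<or> c = [2, 1, 3] \<or> c = [2, 3, 1] \<or> c = [3, 2, 1]"
    using c n3 coxeter_words_small by simp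
  have "before 1 2 \<and> \<not> before 3 2" if "c = [1, 2, 3]"
  proof -
    have "c ! 0 = 1" "c ! 1 = 2" "c ! 2 = 3" using that by simp_all
    then show ?thesis using before_nth[of 0 1] before_nth[of 2 1] n3 by simp
  qed
  moreover have "before 1 2 \<and> before 3 2" if "c = [1, 3, 2]"
  proof -
    have "c ! 0 = 1" "c ! 1 = 3" "c ! 2 = 2" using that by simp_all
    then show ?thesis using before_nth[of 0 2] before_nth[of 1 2] n3 by simp
  qed
  moreover have "before 1 2 \<and> before 3 2" if "c = [3, 1, 2]"
  proof -
    have "c ! 0 = 3" "c ! 1 = 1" "c ! 2 = 2" using that by simp_all
    then show ?thesis using before_nth[of 1 2] before_nth[of 0 2] n3 by simp
  qed
  moreover have "\<not> before 1 2 \<and> \<not> before 3 2" if "c = [2, 1, 3]"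
  proof -
    have "c ! 0 = 2" "c ! 1 = 1" "c ! 2 = 3" using that by simp_all
    then show ?thesis using before_nth[of 1 0] before_nth[of 2 0] n3 by simp
  qed
  moreover have "\<not> before 1 2 \<and> \<not> before 3 2" if "c = [2, 3, 1]"
  proof -
    have "c ! 0 = 2" "c ! 1 = 3" "c ! 2 = 1" using that by simp_all
    then show ?thesis using before_nth[of 2 0] before_nth[of 1 0] n3 by simp
  qed
  moreover have "\<not> before 1 2 \<and> before 3 2" if "c = [3, 2, 1]"
  proof -
    have "c ! 0 = 3" "c ! 1 = 2" "c ! 2 = 1" using that by simp_all
    then show ?thesis using before_nth[of 2 1] before_nth[of 0 1] n3 by simp
  qed
  moreover obtain b1 b3 where b: "before 1 2 = b1" "before 3 2 = b3" by blast
  ultimately have cases: "c = [1, 2, 3] \<and> b1 \<and> \<not> b3 \<or> c = [1, 3, 2] \<and> b1 \<and> b3 \<or> c = [3, 1, 2] \<and> b1 \<and> b3 \<or>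
      c = [2, 1, 3] \<and> \<not> b1 \<and> \<not> b3 \<or> c = [2, 3, 1] \<and> \<not> b1 \<and> \<not> b3 \<or> c = [3, 2, 1] \<and> \<not> b1 \<and> b3"
    using c3 by argo
  note simps = cox_restrict_def root_support_interval reduced_words_coxeter
  show "cox_restrict n c (interval_root 1 1) = [1]" "cox_restrict n c (interval_root 2 2) = [2]"
    "cox_restrict n c (interval_root 3 3) = [3]"
    using c3 unfolding n3 by (elim disjE; simp add: simps)+
  show "cox_restrict n c (interval_root 1 2) = (if before 1 2 then [1, 2] else [2, 1])"
    "cox_restrict n c (interval_root 2 3) = (if before 3 2 then [3, 2] else [2, 3])"
    unfolding b unfolding n3 using cases by (elim disjE conjE; simp add: simps)+
  have "cox_restrict n c (interval_root 1 3) = c"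
    using c3 unfolding n3 by (elim disjE; simp add: simps)
  then show "set (reduced_words n (word_prod (cox_restrict n c (interval_root 1 3)))) =
      (if before 1 2 then if before 3 2 then {[3,1,2], [1,3,2]} else {[1,2,3]}
        else if before 3 2 then {[3,2,1]} else {[2,3,1], [2,1,3]})"
    unfolding b unfolding n3 using cases
    by (elim disjE conjE) (simp_all only: reduced_words_coxeter list.set if_True if_False simp_thms)
qed

lemma rootsum3:
  assumes n3: "n = 3" and j: "j < m * n"
  shows "W ! j = 1 \<Longrightarrow> rootsum \<Lambda> j = \<Lambda> (interval_root 1 1) +
      \<Lambda> (interval_root 1 2) * ((if before 1 2 then m else 0) - slope 1 * time 1 (j div n)) +
      \<Lambda> (interval_root 1 3) * ((if before 1 2 then slope 3 / 2 * (real m)^2 + offset 3 * real m else 0) -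
        slope 1 * (slope 3 / 2 * (time 1 (j div n))^2 + offset 3 * time 1 (j div n)))"
    "W ! j = 2 \<Longrightarrow> rootsum \<Lambda> j = \<Lambda> (interval_root 2 2) +
      \<Lambda> (interval_root 1 2) * (slope 1 * time 2 (j div n) + offset 1) +
      \<Lambda> (interval_root 2 3) * (slope 3 * time 2 (j div n) + offset 3) +
      \<Lambda> (interval_root 1 3) * ((slope 1 * time 2 (j div n) + offset 1) * (slope 3 * time 2 (j div n) + offset 3))"
    "W ! j = 3 \<Longrightarrow> rootsum \<Lambda> j = \<Lambda> (interval_root 3 3) +
      \<Lambda> (interval_root 2 3) * ((if before 3 2 then m else 0) - slope 3 * time 3 (j div n)) +
      \<Lambda> (interval_root 1 3) * ((if before 3 2 then slope 1 / 2 * (real m)^2 + offset 1 * real m else 0) -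
        slope 3 * (slope 1 / 2 * (time 3 (j div n))^2 + offset 1 * time 3 (j div n)))"
proof -
  have k: "j div n < m" using copy_less[OF j] .
  have in3: "1 \<in> {1..n}" "2 \<in> {1..n}" "3 \<in> {1..n}" using n3 by auto
  have dist: "distinct [1, 2, 3::nat]" "distinct [3, 2, 1::nat]" by auto
  note restr = restrict_cases3[OF n3] and red = reduced_words_coxeter reduced_words_first_letter[of n]
  have e1: "counting_entry n c m (interval_root 1 1) j = (if W ! j = 1 then 1 else 0)"
    using restr red j n3 in3 by (intro counting_entry_single) auto
  have e2: "counting_entry n c m (interval_root 2 2) j = (if W ! j = 2 then 1 else 0)"
    using restr red j n3 in3 by (intro counting_entry_single) auto
  have e3: "counting_entry n c m (interval_root 3 3) j = (if W ! j = 3 then 1 else 0)"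
    using restr red j n3 in3 by (intro counting_entry_single) auto
  have e12: "counting_entry n c m (interval_root 1 2) j =
    (if W ! j = 1 then partners 1 2 (j div n) else if W ! j = 2 then partners 2 1 (j div n) else 0)"
    using restr red j n3 in3 by (intro counting_entry_pair[OF refl]) auto
  have e23: "counting_entry n c m (interval_root 2 3) j =
    (if W ! j = 3 then partners 3 2 (j div n) else if W ! j = 2 then partners 2 3 (j div n) else 0)"
    using restr red j n3 in3 by (intro counting_entry_pair[OF refl]) auto
  have "{X. X \<subseteq> {..<m * n} \<and> j \<in> X \<and> nths W X \<in> set (reduced_words n (word_prod (cox_restrict n c (interval_root 1 3))))}
      = {X. j \<in> X \<and> X \<in> triples 1 2 3}"
    unfolding restr(6) using nths_W_triples[OF _ in3] triples_subset[OF _ in3] by blast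
  then have e13: "counting_entry n c m (interval_root 1 3) j = card {X. j \<in> X \<and> X \<in> triples 1 2 3}"
    unfolding counting_entry_eq by simp
  have sum: "rootsum \<Lambda> j = \<Lambda> (interval_root 1 1) * real (counting_entry n c m (interval_root 1 1) j) +
    \<Lambda> (interval_root 2 2) * real (counting_entry n c m (interval_root 2 2) j) +
    \<Lambda> (interval_root 3 3) * real (counting_entry n c m (interval_root 3 3) j) +
    \<Lambda> (interval_root 1 2) * real (counting_entry n c m (interval_root 1 2) j) +
    \<Lambda> (interval_root 2 3) * real (counting_entry n c m (interval_root 2 3) j) +
    \<Lambda> (interval_root 1 3) * real (counting_entry n c m (interval_root 1 3) j)"
  proof -
    have "{(i, k). 1 \<le> i \<and> i \<le> k \<and> k \<le> n} = {(1, 1), (2, 2), (3, 3), (1, 2), (2, 3), (1, 3)}"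
      unfolding n3 intervals_small ..
    then show ?thesis unfolding rootsum_intervals by simp
  qed
  show "rootsum \<Lambda> j = \<Lambda> (interval_root 1 1) +
      \<Lambda> (interval_root 1 2) * ((if before 1 2 then m else 0) - slope 1 * time 1 (j div n)) +
      \<Lambda> (interval_root 1 3) * ((if before 1 2 then slope 3 / 2 * (real m)^2 + offset 3 * real m else 0) -
        slope 1 * (slope 3 / 2 * (time 1 (j div n))^2 + offset 3 * time 1 (j div n)))" if "W ! j = 1"
    unfolding sum e1 e2 e3 e12 e23 e13 card_triples_end[OF in3 dist(1) j that]
    using that real_partners_end[of 1 "j div n"] k
      real_sum_partners[of 1 3 "j div n"] in3 by (simp del: of_nat_sum)
  show "rootsum \<Lambda> j = \<Lambda> (interval_root 2 2) +
      \<Lambda> (interval_root 1 2) * (slope 1 * time 2 (j div n) + offset 1) +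
      \<Lambda> (interval_root 2 3) * (slope 3 * time 2 (j div n) + offset 3) +
      \<Lambda> (interval_root 1 3) * ((slope 1 * time 2 (j div n) + offset 1) * (slope 3 * time 2 (j div n) + offset 3))"
    if "W ! j = 2"
    unfolding sum e1 e2 e3 e12 e23 e13 card_triples_middle[OF in3 dist(1) j that]
    using that real_partners_two[of 1 "j div n"] real_partners_two[of 3 "j div n"] k in3 by simp
  show "rootsum \<Lambda> j = \<Lambda> (interval_root 3 3) +
      \<Lambda> (interval_root 2 3) * ((if before 3 2 then m else 0) - slope 3 * time 3 (j div n)) +
      \<Lambda> (interval_root 1 3) * ((if before 3 2 then slope 1 / 2 * (real m)^2 + offset 1 * real m else 0) -
        slope 3 * (slope 1 / 2 * (time 3 (j div n))^2 + offset 1 * time 3 (j div n)))" if "W ! j = 3"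
    \<comment> \<open>Reading the triples from the other end turns the letter 3 into the first
      one.\<close>
    unfolding sum e1 e2 e3 e12 e23 e13 triples_sym[of 1 2 3] card_triples_end[OF in3(3,2,1) dist(2) j that]
    using that real_partners_end[of 3 "j div n"] k
      real_sum_partners[of 3 1 "j div n"] in3 by (simp del: of_nat_sum)
qed

end

section \<open>Sign and exchange properties of reduced expressions\<close>

text \<open>The alternatives are the reduced words of the elements behind
  \<open>full_times3\<close>; the six words of length 5 are those of the transposition of 1 and 4.
  By the subword property of the Bruhat order, every reduced word of the longest element contains a
  reduced word of each element.\<close>

definition bruhat_check3 :: "nat list \<Rightarrow> bool" where
  "bruhat_check3 u \<longleftrightarrow> (subseq [2,1,3,2] u \<or> subseq [2,3,1,2] u) \<and>
     (subseq [1,2,3,2,1] u \<or> subseq [3,2,1,2,3] u \<or> subseq [1,3,2,1,3] u \<or> subseq [1,3,2,3,1] u \<or>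
      subseq [3,1,2,1,3] u \<or> subseq [3,1,2,3,1] u) \<and> subseq [1,2,3] u \<and> subseq [3,2,1] u"

lemma bruhat_check3: "u \<in> set (longest_words 3) \<Longrightarrow> bruhat_check3 u"
proof -
  have "\<forall>u\<in>set (longest_words 3). bruhat_check3 u" unfolding longest_words_small by code_simp
  then show "u \<in> set (longest_words 3) \<Longrightarrow> bruhat_check3 u" by blast
qed

section \<open>Inequalities between times forced by subwords\<close>

context coxeter_power
begin

lemma letter_timesI: "j \<in> X \<Longrightarrow> W ! j = s \<Longrightarrow> time s (j div n) \<in> letter_times X s"
  by (auto simp: letter_times_def)

definition embeds :: "nat set \<Rightarrow> nat list \<Rightarrow> bool" where
  "embeds X v \<longleftrightarrow> (\<exists>ps. sorted_wrt (<) ps \<and> set ps \<subseteq> X \<and> map ((!) W) ps = v)"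

lemma embedsD:
  assumes "embeds X v"
  obtains f where "\<And>i. i < length v \<Longrightarrow> f i \<in> X" "\<And>i. i < length v \<Longrightarrow> W ! f i = v ! i"
    "\<And>i j. i < j \<Longrightarrow> j < length v \<Longrightarrow> f i < f j"
proof -
  obtain ps where ps: "sorted_wrt (<) ps" "set ps \<subseteq> X" "map ((!) W) ps = v"
    using assms by (auto simp: embeds_def)
  show thesis
  proof (rule that[of "(!) ps"])
    show "ps ! i \<in> X" if "i < length v" for i using ps that by auto
    show "W ! (ps ! i) = v ! i" if "i < length v" for i using ps that by auto
    show "ps ! i < ps ! j" if "i < j" "j < length v" for i j
      using ps that by (auto simp: sorted_wrt_iff_nth_less)
  qed
qed

lemma time_less_pos:
  assumes "j < m * n" "j' < m * n" "j < j'" "2 \<in> {1..n}" "W ! j = 2 \<longleftrightarrow> W ! j' \<noteq> 2"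
  shows "time (W ! j) (j div n) < time (W ! j') (j' div n)"
proof (cases "W ! j = 2")
  case True
  then show ?thesis using time_less(2)[of "W ! j'" "j div n" "j' div n"] assms
      pos_letter[of j] pos_letter[of j'] letter_W[of j'] by simp
next
  case False
  then show ?thesis using time_less(1)[of "W ! j" "j div n" "j' div n"] assms
      pos_letter[of j] pos_letter[of j'] letter_W[of j] by simp
qed

lemma full_times2I:
  assumes X: "X \<subseteq> {..<m * n}" and two: "2 \<in> {1..n}" and e: "embeds X [1, 2]" "embeds X [2, 1]"
  shows "full_times2 (letter_times X)"
proof -
  obtain p q where 1: "p \<in> X" "q \<in> X" "p < q" "W ! p = 1" "W ! q = 2"
    using e(1) by (auto simp: embeds_def map_eq_Cons_conv)
  obtain p' q' where 2: "p' \<in> X" "q' \<in> X" "p' < q'" "W ! p' = 2" "W ! q' = 1"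
    using e(2) by (auto simp: embeds_def map_eq_Cons_conv)
  have "time 1 (p div n) < time 2 (q div n)" "time 2 (p' div n) < time 1 (q' div n)"
    using time_less_pos[of p q] time_less_pos[of p' q'] 1 2 X two by auto
  then show ?thesis unfolding full_times2_def using 1 2 letter_timesI by blast
qed

text \<open>The order of two positions passes to their times when exactly one of them carries the
  letter 2. \<open>full_times3\<close> consists of such comparisons only, which is why it leaves the
  order of neighbouring letters 1 and 3 open.\<close>

lemma full_times3I:
  assumes X: "X \<subseteq> {..<m * n}" and two: "2 \<in> {1..n}"
    and sub: "\<And>v. subseq v u \<Longrightarrow> embeds X v" and u: "bruhat_check3 u"
  shows "full_times3 (letter_times X)"
proof -
  define T where "T j = time (W ! j) (j div n)" for j
  have T: "T j \<in> letter_times X (W ! j)" if "j \<in> X" for j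
    unfolding T_def using that by (rule letter_timesI) simp
  have less: "T j < T j'" if "j \<in> X" "j' \<in> X" "j < j'" "W ! j = 2 \<longleftrightarrow> W ! j' \<noteq> 2" for j j'
    unfolding T_def using that X two by (intro time_less_pos) auto
  have "embeds X [2,1,3,2] \<or> embeds X [2,3,1,2]" using u sub unfolding bruhat_check3_def by blast
  moreover have mid: "\<exists>y\<in>letter_times X 2. \<exists>x\<in>letter_times X a. \<exists>z\<in>letter_times X b. \<exists>y'\<in>letter_times X 2.
      y < x \<and> x < y' \<and> y < z \<and> z < y'" if ab: "embeds X [2,a,b,2]" "a \<noteq> 2" "b \<noteq> 2" for a b
  proof -
    obtain p q h l where X: "p \<in> X" "q \<in> X" "h \<in> X" "l \<in> X"
      and W: "W ! p = 2" "W ! q = a" "W ! h = b" "W ! l = 2" and lt: "p < q" "q < h" "h < l"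
    proof (rule embedsD[OF ab(1)])
      fix f
      assume f: "\<And>i. i < length [2,a,b,2] \<Longrightarrow> f i \<in> X" "\<And>i. i < length [2,a,b,2] \<Longrightarrow> W ! f i = [2,a,b,2] ! i"
        "\<And>i j. i < j \<Longrightarrow> j < length [2,a,b,2] \<Longrightarrow> f i < f j"
      show thesis
        using f(1)[of 0] f(1)[of 1] f(1)[of 2] f(1)[of 3] f(2)[of 0] f(2)[of 1] f(2)[of 2] f(2)[of 3]
          f(3)[of 0 1] f(3)[of 1 2] f(3)[of 2 3]
        by (intro that[of "f 0" "f 1" "f 2" "f 3"]) simp_all
    qed
    have "T p < T q" "T p < T h" "T q < T l" "T h < T l"
      using less[OF X(1,2)] less[OF X(1,3)] less[OF X(2,4)] less[OF X(3,4)] lt ab(2,3)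
      unfolding W by simp_all
    then show ?thesis using T[OF X(1)] T[OF X(2)] T[OF X(3)] T[OF X(4)] unfolding W by blast
  qed
  ultimately have 1: "\<exists>y\<in>letter_times X 2. \<exists>x\<in>letter_times X 1. \<exists>z\<in>letter_times X 3. \<exists>y'\<in>letter_times X 2.
      y < x \<and> x < y' \<and> y < z \<and> z < y'"
  proof (elim disjE)
    assume "embeds X [2,1,3,2]"
    then show ?thesis by (rule mid) simp_all
  next
    assume "embeds X [2,3,1,2]"
    then have "\<exists>y\<in>letter_times X 2. \<exists>x\<in>letter_times X 3. \<exists>z\<in>letter_times X 1. \<exists>y'\<in>letter_times X 2.
      y < x \<and> x < y' \<and> y < z \<and> z < y'" by (rule mid) simp_all
    then show ?thesis by blast
  qed
  have long: "\<exists>x\<in>letter_times X a. \<exists>y\<in>letter_times X 2. \<exists>z\<in>letter_times X b.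
      \<exists>y'\<in>letter_times X 2. \<exists>x'\<in>letter_times X a. x < y \<and> y < z \<and> z < y' \<and> y' < x'"
    if ab: "embeds X [a,2,b,2,a]" "a \<noteq> 2" "b \<noteq> 2" for a b
  proof -
    obtain p q h l w where X: "p \<in> X" "q \<in> X" "h \<in> X" "l \<in> X" "w \<in> X"
      and W: "W ! p = a" "W ! q = 2" "W ! h = b" "W ! l = 2" "W ! w = a"
      and lt: "p < q" "q < h" "h < l" "l < w"
    proof (rule embedsD[OF ab(1)])
      fix f
      assume f: "\<And>i. i < length [a,2,b,2,a] \<Longrightarrow> f i \<in> X"
        "\<And>i. i < length [a,2,b,2,a] \<Longrightarrow> W ! f i = [a,2,b,2,a] ! i"
        "\<And>i j. i < j \<Longrightarrow> j < length [a,2,b,2,a] \<Longrightarrow> f i < f j"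
      show thesis
        using f(1)[of 0] f(1)[of 1] f(1)[of 2] f(1)[of 3] f(1)[of 4]
          f(2)[of 0] f(2)[of 1] f(2)[of 2] f(2)[of 3] f(2)[of 4]
          f(3)[of 0 1] f(3)[of 1 2] f(3)[of 2 3] f(3)[of 3 4]
        by (intro that[of "f 0" "f 1" "f 2" "f 3" "f 4"]) simp_all
    qed
    have "T p < T q" "T q < T h" "T h < T l" "T l < T w"
      using less[OF X(1,2) lt(1)] less[OF X(2,3) lt(2)] less[OF X(3,4) lt(3)] less[OF X(4,5) lt(4)] ab(2,3)
      unfolding W by simp_all
    then show ?thesis using T[OF X(1)] T[OF X(2)] T[OF X(3)] T[OF X(4)] T[OF X(5)] unfolding W by blast
  qed
  have disj: "embeds X [1,2,3,2,1] \<or> embeds X [3,2,1,2,3] \<or> embeds X [1,3,2,1,3] \<or> embeds X [1,3,2,3,1] \<or>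
      embeds X [3,1,2,1,3] \<or> embeds X [3,1,2,3,1]"
    using u sub unfolding bruhat_check3_def by blast
  \<comment> \<open>The four words differ by the order of 1 and 3 on either side of the 2;
    forgetting this order leaves a single condition.\<close>
  have alt: "\<exists>x\<in>letter_times X 1. \<exists>z\<in>letter_times X 3. \<exists>y\<in>letter_times X 2. \<exists>x'\<in>letter_times X 1.
      \<exists>z'\<in>letter_times X 3. x < y \<and> z < y \<and> y < x' \<and> y < z'"
    if "embeds X [1,3,2,1,3] \<or> embeds X [1,3,2,3,1] \<or> embeds X [3,1,2,1,3] \<or> embeds X [3,1,2,3,1]"
  proof -
    have "\<exists>p\<in>X. \<exists>q\<in>X. \<exists>h\<in>X. \<exists>l\<in>X. \<exists>w\<in>X. W ! p = 1 \<and> W ! q = 3 \<and> W ! h = 2 \<and> W ! l = 1 \<and> W ! w = 3 \<and>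
        p < h \<and> q < h \<and> h < l \<and> h < w"
      using that by (elim disjE) (force simp: embeds_def map_eq_Cons_conv)+
    then obtain p q h l w where X: "p \<in> X" "q \<in> X" "h \<in> X" "l \<in> X" "w \<in> X"
      and W: "W ! p = 1" "W ! q = 3" "W ! h = 2" "W ! l = 1" "W ! w = 3"
      and lt: "p < h" "q < h" "h < l" "h < w" by blast
    have "T p < T h" "T q < T h" "T h < T l" "T h < T w"
      using less[OF X(1,3) lt(1)] less[OF X(2,3) lt(2)] less[OF X(3,4) lt(3)] less[OF X(3,5) lt(4)]
      unfolding W by simp_all
    then show ?thesis using T[OF X(1)] T[OF X(2)] T[OF X(3)] T[OF X(4)] T[OF X(5)] unfolding W by blast
  qed
  have 2: "(\<exists>x\<in>letter_times X 1. \<exists>y\<in>letter_times X 2. \<exists>z\<in>letter_times X 3. \<exists>y'\<in>letter_times X 2.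
        \<exists>x'\<in>letter_times X 1. x < y \<and> y < z \<and> z < y' \<and> y' < x') \<or>
     (\<exists>z\<in>letter_times X 3. \<exists>y\<in>letter_times X 2. \<exists>x\<in>letter_times X 1. \<exists>y'\<in>letter_times X 2.
        \<exists>z'\<in>letter_times X 3. z < y \<and> y < x \<and> x < y' \<and> y' < z') \<or>
     (\<exists>x\<in>letter_times X 1. \<exists>z\<in>letter_times X 3. \<exists>y\<in>letter_times X 2. \<exists>x'\<in>letter_times X 1.
        \<exists>z'\<in>letter_times X 3. x < y \<and> z < y \<and> y < x' \<and> y < z')"
  proof -
    consider "embeds X [1,2,3,2,1]" | "embeds X [3,2,1,2,3]"
      | "embeds X [1,3,2,1,3] \<or> embeds X [1,3,2,3,1] \<or> embeds X [3,1,2,1,3] \<or> embeds X [3,1,2,3,1]"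
      using disj by argo
    then show ?thesis
    proof cases
      case 1
      show ?thesis by (rule disjI1, rule long[OF 1]) simp_all
    next
      case 2
      show ?thesis by (rule disjI2, rule disjI1, rule long[OF 2]) simp_all
    next
      case 3
      show ?thesis by (rule disjI2, rule disjI2, rule alt[OF 3])
    qed
  qed
  have short: "\<exists>x\<in>letter_times X a. \<exists>y\<in>letter_times X 2. \<exists>z\<in>letter_times X b. x < y \<and> y < z"
    if ab: "embeds X [a,2,b]" "a \<noteq> 2" "b \<noteq> 2" for a b
  proof -
    obtain p q h where "p \<in> X" "q \<in> X" "h \<in> X" "W ! p = a" "W ! q = 2" "W ! h = b" "p < q" "q < h"
      using ab(1) by (auto simp: embeds_def map_eq_Cons_conv)
    then show ?thesis using ab(2,3) T[of p] T[of q] T[of h] less[of p q] less[of q h]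
      by (intro bexI[of _ "T p"] bexI[of _ "T q"] bexI[of _ "T h"]) auto
  qed
  have "embeds X [1,2,3]" "embeds X [3,2,1]" using u sub unfolding bruhat_check3_def by blast+
  then show ?thesis unfolding full_times3_def using 1 2 short[of 1 3] short[of 3 1] by simp
qed

section \<open>The sign property for row combinations in ranks 1, 2 and 3\<close>

lemma rootsum_sign1:
  assumes n1: "n = 1" and "X \<subseteq> {..<m * n}" "Y \<subseteq> {..<m * n}" "X \<noteq> {}" "Y \<noteq> {}"
    and "\<forall>j\<in>X. 0 \<le> rootsum \<Lambda> j" "\<forall>j\<in>Y. rootsum \<Lambda> j \<le> 0"
  shows "\<forall>\<alpha>\<in>positive_roots n. \<Lambda> \<alpha> = 0"
proof -
  obtain p q where "p \<in> X" "q \<in> Y" using assms by blast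
  then have "\<Lambda> (interval_root 1 1) = 0" using assms rootsum1[OF n1, of p] rootsum1[OF n1, of q] by fastforce
  then show ?thesis unfolding positive_roots_image n1 intervals_small by simp
qed

lemma rootsum_sign2:
  assumes n2: "n = 2" and X: "X \<subseteq> {..<m * n}" and Y: "Y \<subseteq> {..<m * n}"
    and full: "full_times2 (letter_times X)" "full_times2 (letter_times Y)"
    and ge: "\<forall>j\<in>X. 0 \<le> rootsum \<Lambda> j" and le: "\<forall>j\<in>Y. rootsum \<Lambda> j \<le> 0"
  shows "\<forall>\<alpha>\<in>positive_roots n. \<Lambda> \<alpha> = 0"
proof -
  define a b d where "a = \<Lambda> (interval_root 1 1)" "b = \<Lambda> (interval_root 2 2)" "d = \<Lambda> (interval_root 1 2)"
  define e where "e = (if before 1 2 then real m else 0)"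
  let ?A = "a + d * e" and ?B = "- (slope 1 * d)" and ?E = "b + d * offset 1"
  have r1: "rootsum \<Lambda> j = ?A + ?B * time 1 (j div n)" if "j < m * n" "W ! j = 1" for j
    using rootsum2(1)[OF n2 that] by (simp add: a_b_d_def e_def algebra_simps)
  have r2: "rootsum \<Lambda> j = ?E + (- ?B) * time 2 (j div n)" if "j < m * n" "W ! j = 2" for j
    using rootsum2(2)[OF n2 that] by (simp add: a_b_d_def e_def algebra_simps)
  have "?A = 0 \<and> ?B = 0 \<and> ?E = 0"
  proof (rule sign2[OF full]; intro ballI)
    show "0 \<le> ?A + ?B * t" if "t \<in> letter_times X 1" for t
    proof -
      obtain j where j: "j \<in> X" "W ! j = 1" "t = time 1 (j div n)" using \<open>t \<in> _\<close> by (auto simp: letter_times_def)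
      then have "j < m * n" using X by auto
      then show ?thesis using ge[rule_format, OF j(1)] r1[OF _ j(2)] j(3) by simp
    qed
    show "0 \<le> ?E + (- ?B) * t" if "t \<in> letter_times X 2" for t
    proof -
      obtain j where j: "j \<in> X" "W ! j = 2" "t = time 2 (j div n)" using \<open>t \<in> _\<close> by (auto simp: letter_times_def)
      then have "j < m * n" using X by auto
      then show ?thesis using ge[rule_format, OF j(1)] r2[OF _ j(2)] j(3) by simp
    qed
    show "?A + ?B * t \<le> 0" if "t \<in> letter_times Y 1" for t
    proof -
      obtain j where j: "j \<in> Y" "W ! j = 1" "t = time 1 (j div n)" using \<open>t \<in> _\<close> by (auto simp: letter_times_def)
      then have "j < m * n" using Y by auto
      then show ?thesis using le[rule_format, OF j(1)] r1[OF _ j(2)] j(3) by simp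
    qed
    show "?E + (- ?B) * t \<le> 0" if "t \<in> letter_times Y 2" for t
    proof -
      obtain j where j: "j \<in> Y" "W ! j = 2" "t = time 2 (j div n)" using \<open>t \<in> _\<close> by (auto simp: letter_times_def)
      then have "j < m * n" using Y by auto
      then show ?thesis using le[rule_format, OF j(1)] r2[OF _ j(2)] j(3) by simp
    qed
  qed
  then have "a = 0" "b = 0" "d = 0" by (auto simp: slope_def split: if_splits)
  then show ?thesis unfolding positive_roots_image n2 intervals_small a_b_d_def by simp
qed

lemma rootsum_sign3:
  assumes n3: "n = 3" and X: "X \<subseteq> {..<m * n}" and Y: "Y \<subseteq> {..<m * n}"
    and full: "full_times3 (letter_times X)" "full_times3 (letter_times Y)"
    and ge: "\<forall>j\<in>X. 0 \<le> rootsum \<Lambda> j" and le: "\<forall>j\<in>Y. rootsum \<Lambda> j \<le> 0"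
  shows "\<forall>\<alpha>\<in>positive_roots n. \<Lambda> \<alpha> = 0"
proof -
  define l1 l2 l3 l12 l23 l13 where l: "l1 = \<Lambda> (interval_root 1 1)" "l2 = \<Lambda> (interval_root 2 2)"
    "l3 = \<Lambda> (interval_root 3 3)" "l12 = \<Lambda> (interval_root 1 2)" "l23 = \<Lambda> (interval_root 2 3)"
    "l13 = \<Lambda> (interval_root 1 3)"
  define s1 s3 c1 c3 where s: "s1 = slope 1" "s3 = slope 3" "c1 = offset 1" "c3 = offset 3"
  define e1 e3 where e: "e1 = (if before 1 2 then real m else 0)" "e3 = (if before 3 2 then real m else 0)"
  define f1 f3 where f: "f1 = (if before 1 2 then slope 3 / 2 * (real m)^2 + offset 3 * real m else 0)"
    "f3 = (if before 3 2 then slope 1 / 2 * (real m)^2 + offset 1 * real m else 0)"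
  \<comment> \<open>\<open>A\<close>, \<open>B\<close>, \<open>q / 2\<close> belong to the letter 1,
    \<open>C\<close>, \<open>D\<close>, \<open>q / 2\<close> to the letter 3, and \<open>E\<close>,
    \<open>F\<close>, \<open>- q\<close> to the letter 2. The linear parts of the outer letters
    cancel against \<open>F\<close>.\<close>
  define A B C D E F q where coeffs: "A = l1 + l12 * e1 + l13 * f1" "B = - (s1 * l12) - s1 * c3 * l13"
    "C = l3 + l23 * e3 + l13 * f3" "D = - (s3 * l23) - s3 * c1 * l13"
    "E = l2 + l12 * c1 + l23 * c3 + l13 * c1 * c3"
    "F = s1 * l12 + s3 * l23 + l13 * (s1 * c3 + s3 * c1)" "q = - (s1 * s3 * l13)"
  have r1: "rootsum \<Lambda> j = A + B * time 1 (j div n) + q / 2 * (time 1 (j div n))^2" if "j < m * n" "W ! j = 1" for j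
    unfolding rootsum3(1)[OF n3 that] l[symmetric] s[symmetric] e[symmetric] f[symmetric] coeffs
    by (simp add: f s e algebra_simps)
  have r2: "rootsum \<Lambda> j = E + F * time 2 (j div n) - q * (time 2 (j div n))^2" if "j < m * n" "W ! j = 2" for j
    unfolding rootsum3(2)[OF n3 that] l[symmetric] s[symmetric] e[symmetric] f[symmetric] coeffs
    by (simp add: algebra_simps power2_eq_square)
  have r3: "rootsum \<Lambda> j = C + D * time 3 (j div n) + q / 2 * (time 3 (j div n))^2" if "j < m * n" "W ! j = 3" for j
    unfolding rootsum3(3)[OF n3 that] l[symmetric] s[symmetric] e[symmetric] f[symmetric] coeffs
    by (simp add: f s e algebra_simps)
  have times: "\<exists>j\<in>Z. W ! j = i \<and> t = time i (j div n)" if "t \<in> letter_times Z i" for t Z i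
    using that by (auto simp: letter_times_def)
  have "A = 0 \<and> B = 0 \<and> C = 0 \<and> D = 0 \<and> E = 0 \<and> F = 0 \<and> q = 0"
  proof (rule sign3[OF full])
    show "B + D + F = 0" by (simp add: coeffs algebra_simps)
    show "\<forall>t\<in>letter_times X 1. 0 \<le> A + B * t + q / 2 * t^2"
      using times[of _ X 1] r1 ge X by fastforce
    show "\<forall>t\<in>letter_times X 3. 0 \<le> C + D * t + q / 2 * t^2"
      using times[of _ X 3] r3 ge X by fastforce
    show "\<forall>t\<in>letter_times X 2. 0 \<le> E + F * t - q * t^2"
      using times[of _ X 2] r2 ge X by fastforce
    show "\<forall>t\<in>letter_times Y 1. A + B * t + q / 2 * t^2 \<le> 0"
      using times[of _ Y 1] r1 le Y by fastforce
    show "\<forall>t\<in>letter_times Y 3. C + D * t + q / 2 * t^2 \<le> 0"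
      using times[of _ Y 3] r3 le Y by fastforce
    show "\<forall>t\<in>letter_times Y 2. E + F * t - q * t^2 \<le> 0"
      using times[of _ Y 2] r2 le Y by fastforce
  qed
  note zero = this
  \<comment> \<open>As the slopes are nonzero, the system is triangular: \<open>q\<close> determines
    the coefficient of the highest root, then \<open>B\<close> and \<open>D\<close> those of the
    roots of height 2, then the constants those of the simple roots.\<close>
  have "s1 \<noteq> 0" "s3 \<noteq> 0" by (auto simp: s slope_def)
  then have "l13 = 0" using zero by (simp add: coeffs)
  moreover from this have "l12 = 0" "l23 = 0" using zero \<open>s1 \<noteq> 0\<close> \<open>s3 \<noteq> 0\<close> by (simp_all add: coeffs)
  ultimately have "l1 = 0" "l2 = 0" "l3 = 0" "l12 = 0" "l23 = 0" "l13 = 0" using zero by (simp_all add: coeffs)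
  then show ?thesis unfolding positive_roots_image n3 intervals_small l by simp
qed

end

section \<open>Position sets of reduced expressions of the longest element\<close>

definition longest_positions :: "nat \<Rightarrow> nat list \<Rightarrow> nat set set" where
  "longest_positions n Q = {P. P \<subseteq> {..<length Q} \<and> nths Q P \<in> set (longest_words n)}"

lemma subseq_nths_mono:
  assumes "P \<subseteq> Z"
  shows "subseq (nths xs P) (nths xs Z)"
proof -
  have "filter (\<lambda>i. i \<in> P) ys = filter (\<lambda>i. i \<in> P) (filter (\<lambda>i. i \<in> Z) ys)" for ys
    using assms by (auto intro: filter_cong)
  then have "subseq (filter (\<lambda>i. i \<in> P) ys) (filter (\<lambda>i. i \<in> Z) ys)" for ys
    by (metis subseq_filter_left)
  then show ?thesis unfolding nths_eq_map_filter by (rule subseq_map)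
qed

lemma contains_reduced_expression_nths:
  assumes "Z \<subseteq> {..<length Q}"
  shows "contains_reduced_expression n (nths Q Z) (longest_element n) \<longleftrightarrow> (\<exists>P\<in>longest_positions n Q. P \<subseteq> Z)"
proof
  assume "contains_reduced_expression n (nths Q Z) (longest_element n)"
  then obtain u where u: "subseq u (nths Q Z)" "u \<in> set (longest_words n)"
    by (auto simp: contains_reduced_expression_def reduced_expression_longest_iff)
  from subseq_nthsD[OF u(1)] obtain ps where ps: "sorted_wrt (<) ps" "set ps \<subseteq> Z \<inter> {..<length Q}" "map ((!) Q) ps = u"
    by blast
  then have "nths Q (set ps) = u" using nths_eq_iff[of "set ps" Q u] by auto
  then show "\<exists>P\<in>longest_positions n Q. P \<subseteq> Z" using u ps
    by (intro bexI[of _ "set ps"]) (auto simp: longest_positions_def)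
next
  assume "\<exists>P\<in>longest_positions n Q. P \<subseteq> Z"
  then show "contains_reduced_expression n (nths Q Z) (longest_element n)"
    using subseq_nths_mono
    unfolding contains_reduced_expression_def reduced_expression_longest_iff longest_positions_def by blast
qed

lemma subword_complex_eq:
  "subword_complex n Q = {I. I \<subseteq> {..<length Q} \<and> (\<exists>P\<in>longest_positions n Q. P \<inter> I = {})}"
proof -
  have "(\<exists>P\<in>longest_positions n Q. P \<subseteq> {..<length Q} - I) \<longleftrightarrow> (\<exists>P\<in>longest_positions n Q. P \<inter> I = {})" for I
    by (auto simp: longest_positions_def)
  then show ?thesis unfolding subword_complex_def by (simp add: contains_reduced_expression_nths)
qed

lemma card_longest_positions:
  assumes "P \<in> longest_positions n Q"
  shows "card P = cox_length n (longest_element n)"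
proof -
  have "reduced_expression n (nths Q P) (longest_element n)"
    using assms by (simp add: longest_positions_def reduced_expression_longest_iff)
  then have "length (nths Q P) = cox_length n (longest_element n)" by (simp add: reduced_expression_def)
  moreover have "{i. i < length Q \<and> i \<in> P} = P" using assms by (auto simp: longest_positions_def)
  ultimately show ?thesis by (simp add: length_nths)
qed

text \<open>Adding the position \<open>i\<close> to \<open>P\<close> inserts the letter
  \<open>Q ! i\<close> into the word, at the place \<open>k\<close> given by the number of positions
  of \<open>P\<close> before \<open>i\<close>. The letter deleted by \<open>flip_check\<close> is a
  different one, so its position \<open>j\<close> belongs to \<open>P\<close>.\<close>

lemma longest_positions_flip:
  assumes Q: "is_word n Q" and check: "flip_check (longest_words n) n"
    and P: "P \<in> longest_positions n Q" and i: "i < length Q" "i \<notin> P"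
  shows "\<exists>j\<in>P. insert i (P - {j}) \<in> longest_positions n Q"
proof -
  define A B where "A = filter (\<lambda>j. j \<in> P) [0..<i]" "B = filter (\<lambda>j. j \<in> P) [Suc i..<length Q]"
  have upt: "[0..<length Q] = [0..<i] @ i # [Suc i..<length Q]"
    using i(1) upt_add_eq_append[of 0 i "length Q - i"] upt_conv_Cons[of i "length Q"] by simp
  have AB: "filter (\<lambda>j. j \<in> P) [0..<length Q] = A @ B" unfolding upt A_B_def using i(2) by simp
  have PAB: "set (A @ B) = P" using P unfolding AB[symmetric] by (auto simp: longest_positions_def)
  have "sorted_wrt (<) (filter (\<lambda>j. j \<in> insert i P) [0..<length Q])" by (intro sorted_wrt_filter) simp
  moreover have "filter (\<lambda>j. j \<in> insert i P) [0..<i] = A" "filter (\<lambda>j. j \<in> insert i P) [Suc i..<length Q] = B"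
    unfolding A_B_def by (auto intro: filter_cong)
  ultimately have sorted: "sorted_wrt (<) (A @ i # B)" unfolding upt by simp
  define u where "u = nths Q P"
  have u: "u \<in> set (longest_words n)" "u = map ((!) Q) A @ map ((!) Q) B"
    using P unfolding u_def longest_positions_def by (simp_all add: nths_eq_map_filter AB)
  define k where "k = length A"
  have w: "take k u @ Q ! i # drop k u = map ((!) Q) (A @ i # B)" by (simp add: u(2) k_def)
  have "Q ! i \<in> {1..n}" using Q i(1) nth_mem[of i Q] unfolding is_word_def by blast
  then have Qi: "Q ! i \<in> set [1..<n + 1]" by auto
  have k: "k \<in> set [0..<Suc (length u)]" by (simp add: u(2) k_def)
  from check[unfolded flip_check_def, THEN bspec, OF u(1), THEN bspec, OF k, THEN bspec, OF Qi]
  obtain l where l: "l < Suc (length u)" "l \<noteq> k"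
    "take l (take k u @ Q ! i # drop k u) @ drop (Suc l) (take k u @ Q ! i # drop k u) \<in> set (longest_words n)"
  proof (elim bexE conjE)
    fix l assume "l \<in> set [0..<Suc (length u)]" "l \<noteq> k"
      and *: "take l (take k u @ Q ! i # drop k u) @ drop (Suc l) (take k u @ Q ! i # drop k u) \<in> set (longest_words n)"
    then show thesis by (intro that[OF _ _ *]) auto
  qed
  define ps where "ps = A @ i # B"
  have len: "l < length ps" "k < length ps" using l(1) by (simp_all add: ps_def u(2) k_def)
  have dist: "distinct ps" using sorted unfolding ps_def[symmetric] strict_sorted_iff by blast
  have pk: "ps ! k = i" by (simp add: ps_def k_def)
  define j where "j = ps ! l"
  have ji: "j \<noteq> i" using dist len l(2) pk unfolding j_def by (metis nth_eq_iff_index_eq)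
  have "set ps = insert i P" unfolding ps_def using PAB by auto
  then have jP: "j \<in> P" using len(1) ji unfolding j_def by (metis insertE nth_mem)
  have split: "ps = take l ps @ j # drop (Suc l) ps" using len(1) unfolding j_def by (rule id_take_nth_drop)
  have "set (take l ps @ drop (Suc l) ps) = set ps - {j}"
  proof -
    have "distinct (take l ps @ j # drop (Suc l) ps)" using dist split by simp
    moreover have "set ps = insert j (set (take l ps @ drop (Suc l) ps))" by (subst split) auto
    ultimately show ?thesis by auto
  qed
  then have set: "set (take l ps @ drop (Suc l) ps) = insert i (P - {j})"
    using \<open>set ps = insert i P\<close> ji by auto
  have "sorted_wrt (<) (take l ps @ j # drop (Suc l) ps)" using sorted split unfolding ps_def[symmetric] by simp
  then have "sorted_wrt (<) (take l ps @ drop (Suc l) ps)" by (auto simp: sorted_wrt_append)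
  moreover have "insert i (P - {j}) \<subseteq> {..<length Q}" using P i by (auto simp: longest_positions_def)
  ultimately have "nths Q (insert i (P - {j})) = map ((!) Q) (take l ps @ drop (Suc l) ps)"
    using set nths_eq_iff by blast
  also have "\<dots> \<in> set (longest_words n)" using l(3) unfolding w ps_def[symmetric] by (simp add: take_map drop_map)
  finally show ?thesis using jP \<open>insert i (P - {j}) \<subseteq> _\<close> by (auto simp: longest_positions_def)
qed

lemma (in coxeter_power) embeds_image:
  assumes \<phi>: "word_embedding \<phi> Q W" and P: "P \<in> longest_positions n Q" and v: "subseq v (nths Q P)"
  shows "embeds (\<phi> ` P) v"
proof -
  from subseq_nthsD[OF v] obtain ps where ps: "sorted_wrt (<) ps" "set ps \<subseteq> P \<inter> {..<length Q}" "map ((!) Q) ps = v"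
    by blast
  have mono: "strict_mono_on {..<length Q} \<phi>" and letter: "\<And>j. j < length Q \<Longrightarrow> W ! \<phi> j = Q ! j"
    using \<phi> by (auto simp: word_embedding_def)
  have "sorted_wrt (<) (map \<phi> ps)" unfolding sorted_wrt_map
    by (rule sorted_wrt_mono_rel[OF _ ps(1)]) (use ps(2) mono in \<open>auto simp: strict_mono_on_def\<close>)
  moreover have "map ((!) W) (map \<phi> ps) = v" unfolding ps(3)[symmetric] using letter ps(2) by auto
  ultimately show ?thesis using ps(2) unfolding embeds_def by (intro exI[of _ "map \<phi> ps"]) auto
qed

lemma (in coxeter_power) longest_rootsum_sign:
  assumes n3: "n \<le> 3" and \<phi>: "word_embedding \<phi> Q W"
    and P: "P \<in> longest_positions n Q" "P' \<in> longest_positions n Q"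
    and ge: "\<forall>j\<in>P. 0 \<le> rootsum \<Lambda> (\<phi> j)" and le: "\<forall>j\<in>P'. rootsum \<Lambda> (\<phi> j) \<le> 0"
  shows "\<forall>\<alpha>\<in>positive_roots n. \<Lambda> \<alpha> = 0"
proof -
  have sub: "\<phi> ` P \<subseteq> {..<m * n}" if "P \<in> longest_positions n Q" for P
    using \<phi> that by (auto simp: word_embedding_def longest_positions_def length_W)
  note emb = embeds_image[OF \<phi>]
  have ge': "\<forall>j\<in>\<phi> ` P. 0 \<le> rootsum \<Lambda> j" and le': "\<forall>j\<in>\<phi> ` P'. rootsum \<Lambda> j \<le> 0" using ge le by auto
  consider "n = 1" | "n = 2" | "n = 3" using n n3 by linarith
  then show ?thesis
  proof cases
    case 1
    have "P \<noteq> {}" if "P \<in> longest_positions n Q" for P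
      using that 1 by (auto simp: longest_positions_def longest_words_small[unfolded One_nat_def])
    then show ?thesis using rootsum_sign1[OF 1 sub[OF P(1)] sub[OF P(2)] _ _ ge' le'] P by blast
  next
    case 2
    have full: "full_times2 (letter_times (\<phi> ` P))" if P: "P \<in> longest_positions n Q" for P
    proof (rule full_times2I[OF sub[OF P]])
      have "nths Q P \<in> {[1,2,1], [2,1,2]}" using P unfolding 2 longest_positions_def longest_words_small by simp
      then have "subseq [1,2] (nths Q P)" "subseq [2,1] (nths Q P)" by auto
      then show "embeds (\<phi> ` P) [1, 2]" "embeds (\<phi> ` P) [2, 1]" using emb[OF P] by auto
    qed (simp add: 2)
    show ?thesis by (rule rootsum_sign2[OF 2 sub[OF P(1)] sub[OF P(2)] full[OF P(1)] full[OF P(2)] ge' le'])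
  next
    case 3
    have full: "full_times3 (letter_times (\<phi> ` P))" if P: "P \<in> longest_positions n Q" for P
    proof (rule full_times3I[OF sub[OF P] _ emb[OF P]])
      have "nths Q P \<in> set (longest_words 3)" using P unfolding 3 longest_positions_def by simp
      then show "bruhat_check3 (nths Q P)" by (rule bruhat_check3)
    qed (simp_all add: 3)
    show ?thesis by (rule rootsum_sign3[OF 3 sub[OF P(1)] sub[OF P(2)] full[OF P(1)] full[OF P(2)] ge' le'])
  qed
qed

lemma card_positive_roots_small:
  assumes "1 \<le> n" "n \<le> 3"
  shows "card (positive_roots n) = cox_length n (longest_element n)"
proof -
  consider "n = 1" | "n = 2" | "n = 3" using assms by linarith
  then show ?thesis
    by cases (simp_all only: card_positive_roots intervals_small cox_length_longest_small, simp_all)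
qed

lemma flip_check_small: "1 \<le> n \<Longrightarrow> n \<le> 3 \<Longrightarrow> flip_check (longest_words n) n"
proof -
  assume "1 \<le> n" "n \<le> 3"
  then consider "n = 1" | "n = 2" | "n = 3" by linarith
  then show ?thesis by cases (simp_all only: flip_check_longest_words)
qed

text \<open>Full rank is proved together with the fan property because Gale duals are taken of full
  rank matrices. The list \<open>rs\<close> expresses that the order of the rows is
  arbitrary.\<close>

theorem theorem2p7:
  fixes n m :: nat
    and c Q :: "nat list"
    and \<phi> :: "nat \<Rightarrow> nat"
    and rs :: "(nat \<Rightarrow> int) list"
  assumes "1 \<le> n" and "n \<le> 3"
    and "coxeter_word n c"
    and "is_word n Q"
    and "contains_reduced_expression n Q (longest_element n)"
    and "word_embedding \<phi> Q (word_power c m)"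
    and "distinct rs" and "set rs = positive_roots n"
  shows "full_rank (restrict_cols (counting_matrix n rs c m) \<phi> (length Q)) \<and>
    (\<forall>M \<in> carrier_mat (length Q - cox_length n (longest_element n)) (length Q).
       gale_dual (restrict_cols (counting_matrix n rs c m) \<phi> (length Q)) M \<longrightarrow>
       complete_simplicial_fan_realization n Q M)"
proof -
  interpret coxeter_power n m c by unfold_locales (use assms in auto)
  define N where "N = cox_length n (longest_element n)"
  define A where "A = restrict_cols (counting_matrix n rs c m) \<phi> (length Q)"
  have lenrs: "length rs = N"
    using distinct_card[OF assms(7)] assms(8) card_positive_roots_small[OF assms(1,2)] by (simp add: N_def)
  have A: "A \<in> carrier_mat N (length Q)"
    by (simp add: A_def restrict_cols_def counting_matrix_def lenrs)
  have entry: "A $$ (i, j) = real (counting_entry n c m (rs ! i) (\<phi> j))" if "i < N" "j < length Q" for i j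
    using that assms(6) by (simp add: A_def restrict_cols_def counting_matrix_def lenrs word_embedding_def)
  have bij: "bij_betw ((!) rs) {..<N} (positive_roots n)"
    using bij_betw_nth[OF assms(7) refl assms(8)[symmetric]] lenrs by simp
  \<comment> \<open>\<open>ind\<close> recovers the row of a root, so that a row combination becomes
    a \<open>rootsum\<close> whatever the order of \<open>rs\<close>.\<close>
  define ind where "ind = the_inv_into {..<N} ((!) rs)"
  have ind: "ind (rs ! i) = i" if "i < N" for i
    using that bij unfolding ind_def by (intro the_inv_into_f_f) (auto simp: bij_betw_def)
  have comb: "(\<Sum>i<N. a i * A $$ (i, j)) = rootsum (\<lambda>\<alpha>. a (ind \<alpha>)) (\<phi> j)" if "j < length Q" for a j
  proof -
    have "(\<Sum>i<N. a i * A $$ (i, j)) = (\<Sum>i<N. a (ind (rs ! i)) * real (counting_entry n c m (rs ! i) (\<phi> j)))"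
      using that by (intro sum.cong) (simp_all add: ind entry)
    also have "\<dots> = rootsum (\<lambda>\<alpha>. a (ind \<alpha>)) (\<phi> j)"
      unfolding rootsum_def by (rule sum.reindex_bij_betw[OF bij])
    finally show ?thesis .
  qed
  interpret gale_fan N "length Q" A "longest_positions n Q"
  proof (unfold_locales)
    show "A \<in> carrier_mat N (length Q)" by (rule A)
    have "nths Q {..<length Q} = Q" by (rule nths_all) simp
    then show "longest_positions n Q \<noteq> {}"
      using contains_reduced_expression_nths[of "{..<length Q}" Q n] assms(5) by auto
    fix P assume P: "P \<in> longest_positions n Q"
    show "P \<subseteq> {..<length Q}" using P by (simp add: longest_positions_def)
    show "card P = card {..<N}" using card_longest_positions[OF P] by (simp add: N_def)
    show "\<exists>j\<in>P. insert i (P - {j}) \<in> longest_positions n Q" if "i \<in> {..<length Q}" "i \<notin> P" for i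
      using longest_positions_flip[OF assms(4) flip_check_small[OF assms(1,2)] P] that by simp
    fix P' a assume P': "P' \<in> longest_positions n Q"
      and "\<forall>j\<in>P. 0 \<le> (\<Sum>i<N. a i * A $$ (i, j))" "\<forall>j\<in>P'. (\<Sum>i<N. a i * A $$ (i, j)) \<le> 0"
    moreover have "P \<subseteq> {..<length Q}" "P' \<subseteq> {..<length Q}" using P P' by (simp_all add: longest_positions_def)
    ultimately have "\<forall>j\<in>P. 0 \<le> rootsum (\<lambda>\<alpha>. a (ind \<alpha>)) (\<phi> j)" "\<forall>j\<in>P'. rootsum (\<lambda>\<alpha>. a (ind \<alpha>)) (\<phi> j) \<le> 0"
      using comb by (metis lessThan_iff subsetD)+
    then have "\<forall>\<alpha>\<in>positive_roots n. a (ind \<alpha>) = 0"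
      by (rule longest_rootsum_sign[OF assms(2,6) P P'])
    then show "\<forall>i\<in>{..<N}. a i = 0" using bij ind by (metis bij_betwE lessThan_iff)
  qed simp_all
  have faces: "faces = subword_complex n Q" by (simp add: faces_def subword_complex_eq)
  show ?thesis
    unfolding A_def[symmetric] N_def[symmetric]
    using full_rank faces_cols_indep faces_cone_inter faces_cones_cover
    unfolding complete_simplicial_fan_realization_def subword_fan_def faces by blast
qed

end
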